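(* Let $f\in\mathbb{R}[x]=\mathbb{R}[x_1,\dots,x_n]$ have degree $d$, let $c_j\in\mathbb{R}[x]$ ($j\in\mathcal{E}\cup\mathcal{I}$, with $\mathcal{E},\mathcal{I}$ finite disjoint index sets), let $K=\{x\in\mathbb{R}^n:c_j(x)=0\ (j\in\mathcal{E}),\ c_j(x)\ge0\ (j\in\mathcal{I})\}$ be nonempty, and let $f_{\min}=\inf_{x\in K}f(x)$. Put $\theta(x)=1+\|x\|^2$, $c_{eq}=(c_j)_{j\in\mathcal{E}}$, $c_{in}=(c_j)_{j\in\mathcal{I}}$, and let $f_k^{\mathit{den}}$ be the optimal value of $$\max\ \gamma\quad\text{s.t.}\quad\theta^k(f-\gamma)\in\mathrm{Ideal}[c_{eq}]_{2k+d}+\mathrm{QM}[c_{in}]_{2k+d}.$$ (i) Suppose $K$ is closed at infinity, the degrees of $f$ and of $c_j$ ($j\in\mathcal{I}$) are all even, and $f\in\mathbb{R}+\mathrm{int}(\mathscr{P}_d(K))$. If the LICQC, SCC and SOSC hold at every (global) minimizer of the problem in $\tilde x=(x_0,x)\in\mathbb{R}^{n+1}$ $$\min\ \tilde f(\tilde x)-f_{\min}\cdot x_0^d\quad\text{s.t.}\quad\tilde c_j(\tilde x)=0\ (j\in\mathcal{E}),\ x_0^2+\|x\|^2-1=0,\ \tilde c_j(\tilde x)\ge0\ (j\in\mathcal{I}),$$ then $f_k^{\mathit{den}}=f_{\min}$ for all $k$ big enough. (ii) Suppose $f^{\mathit{hom}}$ is a positive definite form. If the LICQC, SCC and SOSC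 hold at every (global) minimizer of the problem $$\min\ \tilde f(\tilde x)-f_{\min}\cdot x_0^d\quad\text{s.t.}\quad\tilde c_j(\tilde x)=0\ (j\in\mathcal{E}),\ x_0^2+\|x\|^2-1=0,\ \tilde c_j(\tilde x)\ge0\ (j\in\mathcal{I}),\ x_0\ge0,$$ then $f_k^{\mathit{den}}=f_{\min}$ for all $k$ big enough.
   Context: Notation. $\mathbb{R}[x]_d$ is the space of polynomials of degree at most $d$. $\mathscr{P}_d(K)=\{p\in\mathbb{R}[x]_d:p\ge0\text{ on }K\}$, with interior taken in $\mathbb{R}[x]_d$; $f\in\mathbb{R}+\mathrm{int}(\mathscr{P}_d(K))$ means $f-c\in\mathrm{int}(\mathscr{P}_d(K))$ for some constant $c\in\mathbb{R}$. $f^{\mathit{hom}}$ denotes the homogeneous part of $f$ of the highest degree; a form $p$ is positive definite if $p(x)>0$ for all nonzero $x\in\mathbb{R}^n$. Homogenization. For $p\in\mathbb{R}[x]$, $\tilde p(\tilde x)=x_0^{\deg p}p(x/x_0)$ with $\tilde x=(x_0,x_1,\dots,x_n)$. Set $\widetilde K=\{\tilde x\in\mathbb{R}^{n+1}:\tilde c_j(\tilde x)=0\ (j\in\mathcal{E}),\ \tilde c_j(\tilde x)\ge0\ (j\in\mathcal{I}),\ \|\tilde x\|^2-1=0,\ x_0\ge0\}$. $K$ is closed at infinity if $\widetilde K=\mathrm{cl}(\widetilde K\cap\{x_0>0\})$. Ideals and quadratic modules. $\Sigma[x]$ is the set of sums of squares of polynomials, $\Sigma[x]_k=\Sigma[x]\cap\mathbb{R}[x]_k$.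 For a tuple $h=(h_1,\dots,h_t)$, $\mathrm{Ideal}[h]_k=\sum_ih_i\,\mathbb{R}[x]_{k-\deg h_i}$; for $g=(g_1,\dots,g_\ell)$, $\mathrm{QM}[g]_k=\Sigma[x]_k+\sum_ig_i\,\Sigma[x]_{k-\deg g_i}$ (terms with negative degree index are $\{0\}$). Optimality conditions. For a problem $\min F(u)$ s.t. $g_j(u)=0$ ($j\in E$), $g_j(u)\ge0$ ($j\in I$), and a minimizer $u^*$, let $J(u^* )=\{j\in E\cup I:g_j(u^* )=0\}$. LICQC: the gradients $\nabla g_j(u^* )$, $j\in J(u^* )$, are linearly independent; then there are (unique) multipliers $\lambda_j$ with $\nabla F(u^* )=\sum_{j\in E\cup I}\lambda_j\nabla g_j(u^* )$, and $\lambda_j\ge0$, $\lambda_jg_j(u^* )=0$ for $j\in I$. SCC: $\lambda_j+g_j(u^* )>0$ for all $j\in I$. SOSC: with $\mathscr{L}=F-\sum_j\lambda_jg_j$, $v^T\nabla^2\mathscr{L}(u^* )v>0$ for every nonzero $v$ with $v^T\nabla g_j(u^* )=0$ for all $j\in J(u^* )$. Here all listed constraints, including the sphere constraint (and $x_0\ge0$ where listed), count as constraints. *)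

theory Defs
  imports "HOL-Analysis.Analysis" "HOL-Library.Poly_Mapping"
begin

section \<open>Real polynomials in finitely many variables\<close>

text \<open>
  The variables are indexed by a finite type \<open>'n\<close>, so \<open>n = CARD('n)\<close>. A polynomial is a finitely
  supported map from exponent vectors to coefficients, with the ring structure (convolution
  product) of \<open>Poly_Mapping\<close>.
\<close>

type_synonym 'n rpoly = "('n \<Rightarrow>\<^sub>0 nat) \<Rightarrow>\<^sub>0 real"

definition const :: "real \<Rightarrow> 'n rpoly" where
  "const a = Poly_Mapping.single 0 a"

definition var :: "'n \<Rightarrow> 'n rpoly" where
  "var i = Poly_Mapping.single (Poly_Mapping.single i 1) 1"

definition eval :: "'n::finite rpoly \<Rightarrow> real ^ 'n \<Rightarrow> real" where
  "eval p x = (\<Sum>m\<in>Poly_Mapping.keys p. Poly_Mapping.lookup p m * (\<Prod>i\<in>UNIV. (x $ i) ^ Poly_Mapping.lookup m i))"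

definition mdeg :: "('n::finite \<Rightarrow>\<^sub>0 nat) \<Rightarrow> nat" where
  "mdeg m = (\<Sum>i\<in>UNIV. Poly_Mapping.lookup m i)"

text \<open>Total degree; the zero polynomial gets degree \<open>0\<close>.\<close>

definition tdeg :: "'n::finite rpoly \<Rightarrow> nat" where
  "tdeg p = Max (insert 0 (mdeg ` Poly_Mapping.keys p))"

text \<open>
  \<open>polys_le k\<close> is the space of polynomials of degree at most \<open>k\<close>. The bound is an integer because
  truncated ideals and quadratic modules use bounds \<open>k - deg h\<close>, for which a negative value means
  the space \<open>{0}\<close>.
\<close>

definition polys_le :: "int \<Rightarrow> 'n::finite rpoly set" where
  "polys_le k = {p. p = 0 \<or> int (tdeg p) \<le> k}"

definition leading_form :: "'n::finite rpoly \<Rightarrow> 'n rpoly" where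
  "leading_form p =
     (\<Sum>m \<in> {m \<in> Poly_Mapping.keys p. mdeg m = tdeg p}. Poly_Mapping.single m (Poly_Mapping.lookup p m))"

definition positive_definite :: "'n::finite rpoly \<Rightarrow> bool" where
  "positive_definite p \<longleftrightarrow> (\<forall>x. x \<noteq> 0 \<longrightarrow> eval p x > 0)"

text \<open>
  Homogenization. The \<open>n + 1\<close> variables are indexed by \<open>'n option\<close>: \<open>None\<close> is the homogenizing
  variable \<open>x\<^sub>0\<close> and \<open>Some i\<close> is the original variable \<open>x\<^sub>i\<close>.
\<close>

definition homogenize :: "'n::finite rpoly \<Rightarrow> 'n option rpoly" where
  "homogenize p =
     (\<Sum>m\<in>Poly_Mapping.keys p.
        Poly_Mapping.single
          (Poly_Mapping.single None (tdeg p - mdeg m)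
            + (\<Sum>i\<in>UNIV. Poly_Mapping.single (Some i) (Poly_Mapping.lookup m i)))
          (Poly_Mapping.lookup p m))"

lemma mdeg_le_tdeg: "m \<in> Poly_Mapping.keys p \<Longrightarrow> mdeg m \<le> tdeg p"
  by (simp add: tdeg_def)

lemma eval_superset:
  assumes "finite S" "Poly_Mapping.keys p \<subseteq> S"
  shows "eval p x = (\<Sum>m\<in>S. Poly_Mapping.lookup p m * (\<Prod>i\<in>UNIV. (x $ i) ^ Poly_Mapping.lookup m i))"
  unfolding eval_def using assms
  by (intro sum.mono_neutral_left) (auto simp: in_keys_iff)

lemma eval_0 [simp]: "eval 0 x = 0"
  by (simp add: eval_def)

lemma eval_add: "eval (p + q) x = eval p x + eval q x"
proof -
  let ?S = "Poly_Mapping.keys p \<union> Poly_Mapping.keys q"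
  have "Poly_Mapping.keys (p + q) \<subseteq> ?S"
    by (rule Poly_Mapping.keys_add)
  then show ?thesis
    by (simp add: eval_superset[of ?S] lookup_add algebra_simps sum.distrib)
qed

lemma eval_sum: "eval (sum p A) x = (\<Sum>a\<in>A. eval (p a) x)"
  by (induction A rule: infinite_finite_induct) (auto simp: eval_add)

lemma eval_single:
  "eval (Poly_Mapping.single m a) x = a * (\<Prod>i\<in>UNIV. (x $ i) ^ Poly_Mapping.lookup m i)"
  by (subst eval_superset[of "{m}"]) auto

text \<open>The defining identity of the homogenization, \<open>x\<^sub>0 ^ deg p * p (x / x\<^sub>0)\<close>.\<close>

lemma eval_homogenize:
  fixes p :: "'n::finite rpoly"
  assumes "u $ None \<noteq> 0"
  shows "eval (homogenize p) u = (u $ None) ^ tdeg p * eval p (\<chi> i. u $ Some i / u $ None)"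
proof -
  define z where "z = u $ None"
  have prod_option: "(\<Prod>i\<in>UNIV. h i) = h None * (\<Prod>i\<in>UNIV. h (Some i))"
    for h :: "'n option \<Rightarrow> real"
    by (simp add: UNIV_option_conv prod.reindex)
  have term_eq: "Poly_Mapping.lookup p m * (\<Prod>i\<in>UNIV. (u $ i) ^ Poly_Mapping.lookup
       (Poly_Mapping.single None (tdeg p - mdeg m)
         + (\<Sum>i\<in>UNIV. Poly_Mapping.single (Some i) (Poly_Mapping.lookup m i))) i)
    = z ^ tdeg p * (Poly_Mapping.lookup p m * (\<Prod>i\<in>UNIV. (u $ Some i / z) ^ Poly_Mapping.lookup m i))"
    if "m \<in> Poly_Mapping.keys p" for m
  proof -
    have "z ^ tdeg p = z ^ (tdeg p - mdeg m) * z ^ mdeg m"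
      using mdeg_le_tdeg[OF that] by (simp flip: power_add)
    moreover have "z ^ mdeg m = (\<Prod>i\<in>UNIV. z ^ Poly_Mapping.lookup m i)"
      by (simp add: mdeg_def power_sum)
    moreover have "(\<Prod>i\<in>UNIV. z ^ Poly_Mapping.lookup m i) \<noteq> 0"
      using assms by (simp add: z_def)
    ultimately show ?thesis
      by (simp add: prod_option lookup_add lookup_sum lookup_single when_def sum.delta
          power_divide prod_dividef z_def assms)
  qed
  show ?thesis
    unfolding homogenize_def eval_sum eval_single
    unfolding eval_def sum_distrib_left
    by (intro sum.cong refl) (use term_eq in \<open>simp add: z_def\<close>)
qed


section \<open>Constrained optimization problems\<close>

text \<open>
  A problem is given by an objective \<open>F\<close>, constraint functions \<open>g\<close>, and the index sets \<open>Eq\<close> of the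
  equality constraints \<open>g j u = 0\<close> and \<open>Ineq\<close> of the inequality constraints \<open>g j u \<ge> 0\<close>.
\<close>

definition feasible_set :: "('j \<Rightarrow> 'a \<Rightarrow> real) \<Rightarrow> 'j set \<Rightarrow> 'j set \<Rightarrow> 'a set" where
  "feasible_set g Eq Ineq = {u. (\<forall>j\<in>Eq. g j u = 0) \<and> (\<forall>j\<in>Ineq. g j u \<ge> 0)}"

definition global_minimizer ::
  "('a \<Rightarrow> real) \<Rightarrow> ('j \<Rightarrow> 'a \<Rightarrow> real) \<Rightarrow> 'j set \<Rightarrow> 'j set \<Rightarrow> 'a \<Rightarrow> bool" where
  "global_minimizer F g Eq Ineq u \<longleftrightarrow>
     u \<in> feasible_set g Eq Ineq \<and> (\<forall>w\<in>feasible_set g Eq Ineq. F u \<le> F w)"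

definition gradient :: "(real ^ 'm \<Rightarrow> real) \<Rightarrow> real ^ 'm \<Rightarrow> real ^ 'm::finite" where
  "gradient F u = (\<chi> i. frechet_derivative F (at u) (axis i 1))"

lemma GDERIV_gradient:
  assumes "F differentiable at u"
  shows "GDERIV F u :> gradient F u"
proof -
  let ?D = "frechet_derivative F (at u)"
  have D: "(F has_derivative ?D) (at u)"
    using assms by (simp add: frechet_derivative_works)
  then interpret linear ?D
    by (rule has_derivative_linear)
  have "?D h = h \<bullet> gradient F u" for h
  proof -
    have "?D h = ?D (\<Sum>i\<in>UNIV. (h $ i) *\<^sub>R axis i 1)"
      by (simp add: basis_expansion flip: scalar_mult_eq_scaleR)
    then show ?thesis
      by (simp add: sum scaleR inner_vec_def gradient_def)
  qed
  then have "?D = (\<lambda>h. h \<bullet> gradient F u)"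
    by (rule ext)
  with D have "(F has_derivative (\<lambda>h. h \<bullet> gradient F u)) (at u)"
    by (rule subst[rotated])
  then show ?thesis
    unfolding gderiv_def .
qed

definition hessian :: "(real ^ 'm \<Rightarrow> real) \<Rightarrow> real ^ 'm \<Rightarrow> real ^ 'm ^ 'm::finite" where
  "hessian F u = jacobian (gradient F) (at u)"

definition active_set :: "('j \<Rightarrow> 'a \<Rightarrow> real) \<Rightarrow> 'j set \<Rightarrow> 'j set \<Rightarrow> 'a \<Rightarrow> 'j set" where
  "active_set g Eq Ineq u = {j \<in> Eq \<union> Ineq. g j u = 0}"

text \<open>
  Linear independence is that of the family of active gradients, hence the injectivity: two active
  constraints with the same gradient violate the condition.
\<close>

definition LICQC :: "('j \<Rightarrow> real ^ 'm \<Rightarrow> real) \<Rightarrow> 'j set \<Rightarrow> 'j set \<Rightarrow> real ^ 'm::finite \<Rightarrow> bool" where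
  "LICQC g Eq Ineq u \<longleftrightarrow>
     inj_on (\<lambda>j. gradient (g j) u) (active_set g Eq Ineq u) \<and>
     independent ((\<lambda>j. gradient (g j) u) ` active_set g Eq Ineq u)"

definition lagrange_multipliers ::
  "(real ^ 'm \<Rightarrow> real) \<Rightarrow> ('j \<Rightarrow> real ^ 'm \<Rightarrow> real) \<Rightarrow> 'j set \<Rightarrow> 'j set \<Rightarrow> real ^ 'm::finite
     \<Rightarrow> ('j \<Rightarrow> real) \<Rightarrow> bool" where
  "lagrange_multipliers F g Eq Ineq u lam \<longleftrightarrow>
     gradient F u = (\<Sum>j\<in>Eq \<union> Ineq. lam j *\<^sub>R gradient (g j) u) \<and>
     (\<forall>j\<in>Ineq. lam j \<ge> 0 \<and> lam j * g j u = 0)"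

text \<open>
  The two conditions below are about the multipliers of \<open>u\<close>. At a minimizer satisfying \<open>LICQC\<close>
  these exist and are unique on \<open>Eq \<union> Ineq\<close>, so quantifying universally over them, instead of
  naming them, does not presuppose this fact.
\<close>

definition SCC ::
  "(real ^ 'm \<Rightarrow> real) \<Rightarrow> ('j \<Rightarrow> real ^ 'm \<Rightarrow> real) \<Rightarrow> 'j set \<Rightarrow> 'j set \<Rightarrow> real ^ 'm::finite \<Rightarrow> bool" where
  "SCC F g Eq Ineq u \<longleftrightarrow>
     (\<forall>lam. lagrange_multipliers F g Eq Ineq u lam \<longrightarrow> (\<forall>j\<in>Ineq. lam j + g j u > 0))"

definition SOSC ::
  "(real ^ 'm \<Rightarrow> real) \<Rightarrow> ('j \<Rightarrow> real ^ 'm \<Rightarrow> real) \<Rightarrow> 'j set \<Rightarrow> 'j set \<Rightarrow> real ^ 'm::finite \<Rightarrow> bool" where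
  "SOSC F g Eq Ineq u \<longleftrightarrow>
     (\<forall>lam. lagrange_multipliers F g Eq Ineq u lam \<longrightarrow>
        (\<forall>v. v \<noteq> 0 \<and> (\<forall>j\<in>active_set g Eq Ineq u. v \<bullet> gradient (g j) u = 0) \<longrightarrow>
           v \<bullet> (hessian (\<lambda>w. F w - (\<Sum>j\<in>Eq \<union> Ineq. lam j * g j w)) u *v v) > 0))"


section \<open>The polynomial optimization problem and its homogenization\<close>

text \<open>The set \<open>K\<close>.\<close>

definition semialg_set :: "('i \<Rightarrow> 'n::finite rpoly) \<Rightarrow> 'i set \<Rightarrow> 'i set \<Rightarrow> (real ^ 'n) set" where
  "semialg_set c E I = feasible_set (\<lambda>j. eval (c j)) E I"

text \<open>An infimum in \<open>real\<close>: meaningful only if \<open>f\<close> is bounded below on the nonempty set \<open>K\<close>.\<close>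

definition f_min :: "'n::finite rpoly \<Rightarrow> (real ^ 'n) set \<Rightarrow> real" where
  "f_min f K = (INF x\<in>K. eval f x)"

text \<open>
  The space of polynomials of degree at most \<open>d\<close> is finite-dimensional; its Euclidean topology is
  the one induced by the coefficient functionals, i.e. the topology of pointwise convergence of
  \<open>Poly_Mapping.lookup\<close>.
\<close>

definition poly_topology :: "int \<Rightarrow> 'n::finite rpoly topology" where
  "poly_topology d = pullback_topology (polys_le d) Poly_Mapping.lookup euclidean"

definition nonneg_polys :: "int \<Rightarrow> (real ^ 'n) set \<Rightarrow> 'n::finite rpoly set" where
  "nonneg_polys d K = {p \<in> polys_le d. \<forall>x\<in>K. eval p x \<ge> 0}"

lemma finite_mdeg_le: "finite {m :: 'n::finite \<Rightarrow>\<^sub>0 nat. mdeg m \<le> N}"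
proof (rule finite_imageD)
  have "Poly_Mapping.lookup ` {m :: 'n \<Rightarrow>\<^sub>0 nat. mdeg m \<le> N} \<subseteq> Pi\<^sub>E UNIV (\<lambda>_. {..N})"
  proof -
    have "Poly_Mapping.lookup m i \<le> mdeg m" for m :: "'n \<Rightarrow>\<^sub>0 nat" and i
      unfolding mdeg_def by (rule member_le_sum) auto
    then have "Poly_Mapping.lookup m i \<le> N" if "mdeg m \<le> N" for m :: "'n \<Rightarrow>\<^sub>0 nat" and i
      using that order_trans by blast
    then show ?thesis by (auto simp: PiE_iff)
  qed
  then show "finite (Poly_Mapping.lookup ` {m :: 'n \<Rightarrow>\<^sub>0 nat. mdeg m \<le> N})"
    by (rule finite_subset) (simp add: finite_PiE)
qed (rule inj_onI, rule poly_mapping_eqI, simp)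

lemma lookup_polys_le:
  assumes "p \<in> polys_le d" "m \<notin> {m. mdeg m \<le> nat d}"
  shows "Poly_Mapping.lookup p m = 0"
proof (rule ccontr)
  assume "Poly_Mapping.lookup p m \<noteq> 0"
  then have "m \<in> Poly_Mapping.keys p" and "p \<noteq> 0"
    by (auto simp: in_keys_iff)
  then show False
    using assms mdeg_le_tdeg[of m p] by (simp add: polys_le_def)
qed

lemma interior_nonneg_polys_iff:
  "p \<in> poly_topology d interior_of nonneg_polys d K \<longleftrightarrow>
     p \<in> polys_le d \<and>
     (\<exists>\<epsilon>>0. \<forall>q\<in>polys_le d. (\<forall>m. \<bar>Poly_Mapping.lookup q m - Poly_Mapping.lookup p m\<bar> < \<epsilon>)
              \<longrightarrow> q \<in> nonneg_polys d K)"
  (is "?L \<longleftrightarrow> ?R")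
proof
  assume ?L
  then obtain U where U: "open U" "Poly_Mapping.lookup p \<in> U" "p \<in> polys_le d"
      "Poly_Mapping.lookup -` U \<inter> polys_le d \<subseteq> nonneg_polys d K"
    by (auto simp: interior_of_def poly_topology_def openin_pullback_topology)
  then obtain X where X: "Poly_Mapping.lookup p \<in> Pi\<^sub>E UNIV X" "\<And>m. open (X m)"
      "finite {m. X m \<noteq> UNIV}" "Pi\<^sub>E UNIV X \<subseteq> U"
    using product_topology_open_contains_basis[of "\<lambda>_. euclidean" UNIV U "Poly_Mapping.lookup p"]
    by (auto simp: open_fun_def)
  have "\<exists>e>0. ball (Poly_Mapping.lookup p m) e \<subseteq> X m" for m
    using X(1,2) by (meson PiE_mem UNIV_I open_contains_ball)
  then obtain e where e: "\<And>m. e m > 0" "\<And>m. ball (Poly_Mapping.lookup p m) (e m) \<subseteq> X m"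
    by metis
  define \<epsilon> where "\<epsilon> = Min (insert 1 (e ` {m. X m \<noteq> UNIV}))"
  have "\<epsilon> > 0" using X(3) e(1) by (simp add: \<epsilon>_def)
  moreover have "q \<in> nonneg_polys d K"
    if q: "q \<in> polys_le d" "\<forall>m. \<bar>Poly_Mapping.lookup q m - Poly_Mapping.lookup p m\<bar> < \<epsilon>" for q
  proof -
    have "Poly_Mapping.lookup q m \<in> X m" for m
    proof (cases "X m = UNIV")
      case False
      then have "\<epsilon> \<le> e m" using X(3) by (simp add: \<epsilon>_def)
      then have "Poly_Mapping.lookup q m \<in> ball (Poly_Mapping.lookup p m) (e m)"
        using q(2)[rule_format, of m] by (simp add: dist_real_def abs_minus_commute)
      then show ?thesis using e(2) by blast
    qed simp
    then have "Poly_Mapping.lookup q \<in> Pi\<^sub>E UNIV X"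
      by (simp add: PiE_iff)
    then have "Poly_Mapping.lookup q \<in> U"
      using X(4) by (rule rev_subsetD)
    then have "q \<in> Poly_Mapping.lookup -` U \<inter> polys_le d"
      using q(1) by simp
    then show ?thesis
      using U(4) by (rule rev_subsetD)
  qed
  ultimately show ?R using U(3) by blast
next
  assume ?R
  then obtain \<epsilon> where eps: "\<epsilon> > 0" "p \<in> polys_le d"
    "\<And>q. q \<in> polys_le d \<Longrightarrow> (\<forall>m. \<bar>Poly_Mapping.lookup q m - Poly_Mapping.lookup p m\<bar> < \<epsilon>)
       \<Longrightarrow> q \<in> nonneg_polys d K" by blast
  let ?M = "{m :: 'a \<Rightarrow>\<^sub>0 nat. mdeg m \<le> nat d}"
  define U where "U = Pi\<^sub>E UNIV (\<lambda>m. if m \<in> ?M then ball (Poly_Mapping.lookup p m) \<epsilon> else UNIV)"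
  have "open U" unfolding U_def
  proof (rule open_PiE)
    show "finite {m. (if m \<in> ?M then ball (Poly_Mapping.lookup p m) \<epsilon> else UNIV) \<noteq> UNIV}"
      by (rule finite_subset[OF _ finite_mdeg_le[of "nat d"]]) auto
  qed auto
  moreover have "Poly_Mapping.lookup p \<in> U" using eps(1) by (simp add: U_def PiE_iff)
  moreover have "q \<in> nonneg_polys d K" if q: "q \<in> polys_le d" "Poly_Mapping.lookup q \<in> U" for q
  proof (rule eps(3)[OF q(1)], rule allI)
    fix m
    show "\<bar>Poly_Mapping.lookup q m - Poly_Mapping.lookup p m\<bar> < \<epsilon>"
    proof (cases "m \<in> ?M")
      case True
      have "Poly_Mapping.lookup q m \<in> (if m \<in> ?M then ball (Poly_Mapping.lookup p m) \<epsilon> else UNIV)"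
        using q(2) unfolding U_def by (rule PiE_mem) simp
      with True show ?thesis by (simp add: dist_real_def abs_minus_commute)
    next
      case False
      then show ?thesis using lookup_polys_le[OF q(1)] lookup_polys_le[OF eps(2)] eps(1) by simp
    qed
  qed
  ultimately show ?L using eps(2)
    unfolding interior_of_def poly_topology_def openin_pullback_topology
    by (intro CollectI exI[of _ "Poly_Mapping.lookup -` U \<inter> polys_le d"]) auto
qed

text \<open>The constraints of the homogenized problems.\<close>

datatype 'i hom_index = Orig 'i | Sphere | X0

fun hom_constraint :: "('i \<Rightarrow> 'n::finite rpoly) \<Rightarrow> 'i hom_index \<Rightarrow> real ^ 'n option \<Rightarrow> real" where
  "hom_constraint c (Orig j) u = eval (homogenize (c j)) u"
| "hom_constraint c Sphere u = (norm u)\<^sup>2 - 1"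
| "hom_constraint c X0 u = u $ None"

definition hom_objective :: "'n::finite rpoly \<Rightarrow> real \<Rightarrow> real ^ 'n option \<Rightarrow> real" where
  "hom_objective f a u = eval (homogenize f) u - a * (u $ None) ^ tdeg f"

definition hom_set :: "('i \<Rightarrow> 'n::finite rpoly) \<Rightarrow> 'i set \<Rightarrow> 'i set \<Rightarrow> (real ^ 'n option) set" where
  "hom_set c E I = feasible_set (hom_constraint c) (insert Sphere (Orig ` E)) (insert X0 (Orig ` I))"

text \<open>Closedness at infinity depends on the description \<open>c\<close>, not only on the set \<open>K\<close>.\<close>

definition closed_at_infinity :: "('i \<Rightarrow> 'n::finite rpoly) \<Rightarrow> 'i set \<Rightarrow> 'i set \<Rightarrow> bool" where
  "closed_at_infinity c E I \<longleftrightarrow> hom_set c E I = closure (hom_set c E I \<inter> {u. u $ None > 0})"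


section \<open>Truncated ideals and quadratic modules, and the denominator hierarchy\<close>

definition sos :: "'n::finite rpoly set" where
  "sos = {p. \<exists>(l::nat) q. p = (\<Sum>i<l. (q i)\<^sup>2)}"

definition ideal_trunc :: "('i \<Rightarrow> 'n::finite rpoly) \<Rightarrow> 'i set \<Rightarrow> int \<Rightarrow> 'n rpoly set" where
  "ideal_trunc h E k = {\<Sum>j\<in>E. h j * q j | q. \<forall>j\<in>E. q j \<in> polys_le (k - int (tdeg (h j)))}"

definition qmodule_trunc :: "('i \<Rightarrow> 'n::finite rpoly) \<Rightarrow> 'i set \<Rightarrow> int \<Rightarrow> 'n rpoly set" where
  "qmodule_trunc g I k =
     {s + (\<Sum>j\<in>I. g j * t j) | s t. s \<in> sos \<inter> polys_le k \<and>
        (\<forall>j\<in>I. t j \<in> sos \<inter> polys_le (k - int (tdeg (g j))))}"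

definition theta :: "'n::finite rpoly" where
  "theta = 1 + (\<Sum>i\<in>UNIV. (var i)\<^sup>2)"

text \<open>
  The optimal value is an extended real, equal to \<open>-\<infinity>\<close> if no \<open>\<gamma>\<close> is feasible. The sum of the ideal
  and the quadratic module is the elementwise sum of sets.
\<close>

definition f_den :: "'n::finite rpoly \<Rightarrow> ('i \<Rightarrow> 'n rpoly) \<Rightarrow> 'i set \<Rightarrow> 'i set \<Rightarrow> nat \<Rightarrow> ereal" where
  "f_den f c E I k =
     Sup {ereal \<gamma> | \<gamma>. theta ^ k * (f - const \<gamma>)
        \<in> ideal_trunc c E (int (2 * k + tdeg f)) + qmodule_trunc c I (int (2 * k + tdeg f))}"

end

theory Submission
  imports Defs
begin

text \<open>
  A polynomial that is positive on the unit sphere is a sum of squares modulo the sphere equation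
  (archimedean Positivstellensatz for preorderings). Penalty multipliers \<open>N max 0 (- g)\<close>,
  approximated by positive polynomials, extend this to polynomials that are positive on the feasible set and to
  the quadratic module of the constraints (Putinar).

  The homogenized objective \<open>F\<close> is nonnegative on the feasible part of the sphere, and LICQC, SCC and SOSC make
  its zeros isolated. Subtracting an element \<open>a\<close> of the module that encodes the multipliers at all zeros leaves a
  polynomial with positive definite Hessian at every zero, hence \<open>F = a + \<Sum> v\<^sup>2 r\<close> where the \<open>v\<close> generate the
  vanishing ideal of the zeros and \<open>r > 0\<close> there. The freedom in the choice of \<open>r\<close> (syzygies) makes all
  coefficients strictly positive, so \<open>F\<close> lies in the module without any degree bound.

  Odd inequality constraints are multiplied by \<open>x\<^sub>0\<close>, which is harmless because no zero of \<open>F\<close> lies at infinity.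
  Then everything is invariant under \<open>x \<mapsto> - x\<close>, and averaging the identity over the two lifts
  \<open>\<plusminus> (1, y) / sqrt (\<theta> y)\<close> of \<open>y\<close> removes all square roots and produces the denominator \<open>\<theta>^k\<close>.
\<close>

section \<open>The evaluation homomorphism\<close>

text \<open>The obstacle is that \<open>F\<close> vanishes at the minimizers, while the
  Positivstellensatz covers only strictly positive polynomials. The optimality conditions are
  therefore first converted into \<open>nondegenerate\<close>: strict quadratic growth of an
  augmented Lagrangian in a full neighbourhood, with positive multipliers at active inequalities.
  This form mentions no derivatives and survives both the reflection and the multiplication of
  constraints by x0. SCC and SOSC quantify over all multipliers, so the existence of multipliers has
  to be proved as well, by a penalty argument.

  Membership in \<open>qm\<close> is only an identity of functions on the sphere, with polynomials
  of unknown degree. This suffices because a point y is seen only through its lifts to the sphere.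
  After averaging, the identity becomes polynomial once it is multiplied by a large power of theta.
  Theta has degree 2 and the truncation bound is 2k + d, so every degree fits for large k, and the
  unknown degree only influences how large k must be.\<close>

lemma rpoly_sum_single:
  fixes p :: "'n rpoly"
  shows "p = (\<Sum>m\<in>Poly_Mapping.keys p. Poly_Mapping.single m (Poly_Mapping.lookup p m))"
proof (rule poly_mapping_eqI)
  fix k
  show "Poly_Mapping.lookup p k =
    Poly_Mapping.lookup (\<Sum>m\<in>Poly_Mapping.keys p. Poly_Mapping.single m (Poly_Mapping.lookup p m)) k"
    by (auto simp: lookup_sum lookup_single when_def sum.delta in_keys_iff)
qed

lemma monomial_eq_sum_single:
  fixes m :: "'n::finite \<Rightarrow>\<^sub>0 nat"
  shows "m = (\<Sum>i\<in>UNIV. Poly_Mapping.single i (Poly_Mapping.lookup m i))"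
  by (rule poly_mapping_eqI) (simp add: lookup_sum lookup_single when_def sum.delta)

lemma var_power: "var i ^ k = Poly_Mapping.single (Poly_Mapping.single i k) 1"
  by (induction k) (simp_all add: var_def mult_single flip: single_add)

lemma single_sum_prod:
  "finite A \<Longrightarrow> Poly_Mapping.single (\<Sum>i\<in>A. g i) (1::real) = (\<Prod>i\<in>A. Poly_Mapping.single (g i) 1)"
proof (induction A rule: finite_induct)
  case (insert x F)
  then show ?case by (simp add: mult_single flip: insert.IH)
qed simp

lemma single_eq_const_prod_var:
  fixes m :: "'n::finite \<Rightarrow>\<^sub>0 nat"
  shows "Poly_Mapping.single m a = const a * (\<Prod>i\<in>UNIV. var i ^ Poly_Mapping.lookup m i)"
proof -
  have "Poly_Mapping.single m a = const a * Poly_Mapping.single m 1"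
    by (simp add: const_def mult_single)
  also have "Poly_Mapping.single m (1::real) =
      Poly_Mapping.single (\<Sum>i\<in>UNIV. Poly_Mapping.single i (Poly_Mapping.lookup m i)) 1"
    using monomial_eq_sum_single[of m] by simp
  finally show ?thesis by (simp add: single_sum_prod var_power)
qed

lemma const_0 [simp]: "const 0 = 0" and const_1 [simp]: "const 1 = 1"
  and const_add: "const (a + b) = const a + const b"
  and const_mult: "const (a * b) = const a * const b"
  and const_uminus: "const (- a) = - const a"
  and const_diff: "const (a - b) = const a - const b"
  by (simp_all add: const_def single_add mult_single single_uminus single_diff)

text \<open>Constants and variables generate the ring. Bounds on the sphere, Taylor expansions,
  derivatives and dehomogenization all obey a sum rule and a product rule, so each of them is
  obtained by this induction.\<close>

lemma rpoly_induct [case_names const var add mult]: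
  fixes p :: "'n::finite rpoly"
  assumes const: "\<And>a. P (const a)" and var: "\<And>i. P (var i)"
    and add: "\<And>p q. P p \<Longrightarrow> P q \<Longrightarrow> P (p + q)"
    and mult: "\<And>p q. P p \<Longrightarrow> P q \<Longrightarrow> P (p * q)"
  shows "P p"
proof -
  have one: "P 1" using const[of 1] by simp
  have zero: "P 0" using const[of 0] by simp
  have power: "P (q ^ k)" if "P q" for q k
    using that by (induction k) (auto intro: one mult)
  have prod: "P (\<Prod>i\<in>A. f i)" if "\<And>i. P (f i)" for f and A :: "'n set"
    using that by (induction A rule: infinite_finite_induct) (auto intro: one mult)
  have sum: "P (\<Sum>i\<in>A. f i)" if "\<And>i. P (f i)" for f :: "_ \<Rightarrow> 'n rpoly" and A :: "('n \<Rightarrow>\<^sub>0 nat) set"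
    using that by (induction A rule: infinite_finite_induct) (auto intro: zero add)
  show ?thesis
    by (subst rpoly_sum_single) (auto simp: single_eq_const_prod_var intro!: sum mult const prod power var)
qed

lemma prod_power_when:
  fixes x :: "real ^ 'n::finite"
  shows "(\<Prod>j\<in>UNIV. (x $ j) ^ (k when i = j)) = (x $ i) ^ k"
proof -
  have "(\<Prod>j\<in>UNIV. (x $ j) ^ (k when i = j)) = (\<Prod>j\<in>UNIV. if j = i then (x $ j) ^ k else 1)"
    by (intro prod.cong) (auto simp: when_def)
  then show ?thesis by simp
qed

lemma eval_const [simp]: "eval (const a) x = a"
  by (simp add: const_def eval_single)

lemma eval_var [simp]: "eval (var i) x = x $ i"
  by (simp add: var_def eval_single lookup_single prod_power_when)

lemma eval_1 [simp]: "eval 1 x = 1"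
  using eval_const[of 1 x] by simp

lemma eval_mult: "eval (p * q) x = eval p x * eval q x"
proof -
  have *: "eval (Poly_Mapping.single m a * Poly_Mapping.single n b) x =
      eval (Poly_Mapping.single m a) x * eval (Poly_Mapping.single n b) x" for m n a b
    by (simp add: mult_single eval_single lookup_add power_add prod.distrib)
  have "p * q = (\<Sum>m\<in>Poly_Mapping.keys p. \<Sum>n\<in>Poly_Mapping.keys q.
      Poly_Mapping.single m (Poly_Mapping.lookup p m) * Poly_Mapping.single n (Poly_Mapping.lookup q n))"
    by (subst rpoly_sum_single[of p], subst rpoly_sum_single[of q]) (simp add: sum_product)
  moreover have "eval p x * eval q x = (\<Sum>m\<in>Poly_Mapping.keys p. \<Sum>n\<in>Poly_Mapping.keys q.
      eval (Poly_Mapping.single m (Poly_Mapping.lookup p m)) x * eval (Poly_Mapping.single n (Poly_Mapping.lookup q n)) x)"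
    by (subst rpoly_sum_single[of p], subst rpoly_sum_single[of q]) (simp add: eval_sum sum_product)
  ultimately show ?thesis by (simp add: eval_sum *)
qed

lemma eval_uminus: "eval (- p) x = - eval p x"
  using eval_add[of p "- p" x] by simp

lemma eval_diff: "eval (p - q) x = eval p x - eval q x"
  using eval_add[of p "- q" x] by (simp add: eval_uminus)

lemma eval_power: "eval (p ^ k) x = eval p x ^ k"
  by (induction k) (simp_all add: eval_mult)

lemma eval_prod: "eval (prod p A) x = (\<Prod>a\<in>A. eval (p a) x)"
  by (induction A rule: infinite_finite_induct) (auto simp: eval_mult)

lemmas eval_simps = eval_add eval_mult eval_uminus eval_diff eval_power eval_prod eval_sum

lemma eval_of_nat [simp]: "eval (of_nat n) x = of_nat n"
  by (induction n) (simp_all add: eval_simps)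

lemma eval_numeral [simp]: "eval (numeral k) x = numeral k"
  using eval_of_nat[of "numeral k" x] by simp

lemma continuous_on_eval [continuous_intros]:
  "continuous_on S f \<Longrightarrow> continuous_on S (\<lambda>x. eval p (f x))"
  unfolding eval_def by (intro continuous_intros)

lemma eval_theta: "eval theta x = 1 + (norm x)\<^sup>2"
  by (simp add: theta_def eval_simps norm_vec_def L2_set_def sum_nonneg)

text \<open>Monomials are characters of the multiplicative monoid of vectors, so Artin's argument shows that
  they are linearly independent.\<close>

lemma independent_characters:
  fixes X :: "'k \<Rightarrow> (real ^ 'n::finite) \<Rightarrow> real"
  assumes "finite A"
    and mult: "\<And>m x y. m \<in> A \<Longrightarrow> X m (\<chi> i. x $ i * y $ i) = X m x * X m y"
    and one: "\<And>m. m \<in> A \<Longrightarrow> X m (\<chi> i. 1) = 1"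
    and distinct: "\<And>m n. m \<in> A \<Longrightarrow> n \<in> A \<Longrightarrow> m \<noteq> n \<Longrightarrow> \<exists>y. X m y \<noteq> X n y"
    and zero: "\<And>x. (\<Sum>m\<in>A. a m * X m x) = 0"
    and "m \<in> A"
  shows "a m = 0"
  using assms
proof (induction A arbitrary: a m rule: finite_induct)
  case (insert n A)
  have A0: "a m' = 0" if m': "m' \<in> A" for m'
  proof -
    obtain y where y: "X m' y \<noteq> X n y"
      using insert.prems(3)[of m' n] insert.hyps m' by auto
    have "(X m' y - X n y) * a m' = 0"
    proof (rule insert.IH[of "\<lambda>m. (X m y - X n y) * a m"])
      fix x
      have "(\<Sum>m\<in>insert n A. a m * X m (\<chi> i. x $ i * y $ i)) - X n y * (\<Sum>m\<in>insert n A. a m * X m x) = 0"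
        using insert.prems(4)[of x] insert.prems(4)[of "\<chi> i. x $ i * y $ i"] by simp
      moreover have "(\<Sum>m\<in>insert n A. a m * X m (\<chi> i. x $ i * y $ i)) =
          (\<Sum>m\<in>insert n A. a m * (X m x * X m y))"
        by (intro sum.cong refl) (simp add: insert.prems(1))
      ultimately have "(\<Sum>m\<in>insert n A. (X m y - X n y) * a m * X m x) = 0"
        by (simp add: sum_distrib_left sum_subtractf algebra_simps)
      then show "(\<Sum>m\<in>A. (X m y - X n y) * a m * X m x) = 0"
        using insert.hyps by simp
    qed (use insert.prems m' in auto)
    with y show ?thesis by simp
  qed
  moreover have "a n = 0"
    using insert.prems(4)[of "\<chi> i. 1"] insert.hyps A0 insert.prems(2)[of n] by simp
  ultimately show ?case using insert.prems(5) by blast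
qed simp

lemma eval_eq_0_imp_eq_0:
  fixes p :: "'n::finite rpoly"
  assumes "\<And>x. eval p x = 0"
  shows "p = 0"
proof (rule ccontr)
  assume "p \<noteq> 0"
  then obtain m where m: "m \<in> Poly_Mapping.keys p"
    by (metis all_not_in_conv keys_eq_empty)
  have "Poly_Mapping.lookup p m = 0"
  proof (rule independent_characters[where A = "Poly_Mapping.keys p"
        and a = "Poly_Mapping.lookup p" and X = "\<lambda>m x. \<Prod>i\<in>UNIV. (x $ i) ^ Poly_Mapping.lookup m i"])
    fix m n :: "'n \<Rightarrow>\<^sub>0 nat" assume "m \<noteq> n"
    then obtain i where i: "Poly_Mapping.lookup m i \<noteq> Poly_Mapping.lookup n i"
      by (meson poly_mapping_eqI)
    \<comment> \<open>The test point has 2 in coordinate \<open>i\<close> and 1 elsewhere, so a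
      monomial takes there the value 2 to its exponent at \<open>i\<close>, which tells
      \<open>m\<close> and \<open>n\<close> apart.\<close>
    have *: "(\<Prod>j\<in>UNIV. ((\<chi> j. if j = i then 2 else (1::real)) $ j) ^ Poly_Mapping.lookup k j) = 2 ^ Poly_Mapping.lookup k i"
      for k
    proof -
      have "(\<Prod>j\<in>UNIV. ((\<chi> j. if j = i then 2 else (1::real)) $ j) ^ Poly_Mapping.lookup k j) =
        (\<Prod>j\<in>UNIV. if j = i then 2 ^ Poly_Mapping.lookup k i else 1)"
        by (intro prod.cong) auto
      then show ?thesis by simp
    qed
    show "\<exists>y. (\<Prod>j\<in>UNIV. (y $ j) ^ Poly_Mapping.lookup m j) \<noteq> (\<Prod>j\<in>UNIV. (y $ j :: real) ^ Poly_Mapping.lookup n j)"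
      by (rule exI[of _ "\<chi> j. if j = i then 2 else 1"]) (simp only: *, use i in simp)
  qed (use assms m in \<open>auto simp: power_mult_distrib prod.distrib eval_def\<close>)
  with m show False by (simp add: in_keys_iff)
qed

text \<open>Certificates are computed pointwise, with square roots of theta that cancel only as
  values. This converts the final identity of functions into one of polynomials.\<close>

lemma eval_inject: "(\<And>x. eval p x = eval q x) \<Longrightarrow> p = q"
  using eval_eq_0_imp_eq_0[of "p - q"] by (simp add: eval_diff)

section \<open>Uniform approximation by polynomials\<close>

lemma real_polynomial_function_imp_eval:
  fixes g :: "real ^ 'n::finite \<Rightarrow> real"
  assumes "real_polynomial_function g"
  shows "\<exists>p. \<forall>x. g x = eval p x"
  using assms
proof induction
  case (linear f)
  have "f x = eval (\<Sum>i\<in>UNIV. const (f (axis i 1)) * var i) x" for x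
  proof -
    have "f x = f (\<Sum>i\<in>UNIV. (x $ i) *\<^sub>R axis i 1)"
      by (simp add: basis_expansion flip: scalar_mult_eq_scaleR)
    also have "\<dots> = (\<Sum>i\<in>UNIV. x $ i * f (axis i 1))"
      using bounded_linear.linear[OF linear] by (simp add: linear_sum linear_cmul)
    finally show ?thesis by (simp add: eval_simps mult.commute)
  qed
  then show ?case by blast
next
  case (const c)
  then show ?case by (intro exI[of _ "const c"]) simp
next
  case (add f g)
  then show ?case by (metis eval_add)
next
  case (mult f g)
  then show ?case by (metis eval_mult)
qed

lemma Stone_Weierstrass_eval:
  fixes f :: "real ^ 'n::finite \<Rightarrow> real"
  assumes "compact S" "continuous_on S f" "0 < e"
  shows "\<exists>p. \<forall>x\<in>S. \<bar>f x - eval p x\<bar> < e"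
proof -
  obtain g where g: "real_polynomial_function g" "\<And>x. x \<in> S \<Longrightarrow> \<bar>f x - g x\<bar> < e"
    using Stone_Weierstrass_real_polynomial_function[OF assms] by blast
  obtain p where "\<forall>x. g x = eval p x"
    using real_polynomial_function_imp_eval[OF g(1)] by blast
  with g(2) show ?thesis by (intro exI[of _ p]) simp
qed

section \<open>Degree bounds\<close>

lemma polys_le_nat: "p \<in> polys_le (int k) \<longleftrightarrow> tdeg p \<le> k"
  by (auto simp: polys_le_def tdeg_def)

lemma tdeg_le_iff: "tdeg p \<le> k \<longleftrightarrow> (\<forall>m\<in>Poly_Mapping.keys p. mdeg m \<le> k)"
  by (simp add: tdeg_def)

lemma mdeg_add: "mdeg (m + n) = mdeg m + mdeg n"
  by (simp add: mdeg_def lookup_add sum.distrib)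

lemma tdeg_add_le: "tdeg p \<le> k \<Longrightarrow> tdeg q \<le> k \<Longrightarrow> tdeg (p + q) \<le> k"
  unfolding tdeg_le_iff using Poly_Mapping.keys_add[of p q] by blast

lemma tdeg_uminus: "tdeg (- p) = tdeg p"
  by (simp add: tdeg_def)

lemma tdeg_sum_le: "(\<And>a. a \<in> A \<Longrightarrow> tdeg (p a) \<le> k) \<Longrightarrow> tdeg (sum p A) \<le> k"
proof (induction A rule: infinite_finite_induct)
  case (insert x F)
  then show ?case by (auto intro: tdeg_add_le)
qed (simp_all add: tdeg_le_iff)

lemma tdeg_mult_le: "tdeg p \<le> k \<Longrightarrow> tdeg q \<le> l \<Longrightarrow> tdeg (p * q) \<le> k + l"
  unfolding tdeg_le_iff using keys_mult[of p q]
  by (fastforce simp: mdeg_add intro: add_mono)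

lemma tdeg_0 [simp]: "tdeg 0 = 0"
  by (simp add: tdeg_def)

lemma tdeg_const [simp]: "tdeg (const a) = 0"
  by (simp add: tdeg_def const_def mdeg_def)

lemma tdeg_1 [simp]: "tdeg (1 :: 'n::finite rpoly) = 0"
  using tdeg_const[of 1, where ?'a = 'n] by simp

lemma tdeg_var_le: "tdeg (var i) \<le> 1"
  by (simp add: tdeg_le_iff var_def mdeg_def lookup_single when_def)

lemma tdeg_power_le: "tdeg p \<le> k \<Longrightarrow> tdeg (p ^ n) \<le> n * k"
proof (induction n)
  case 0
  show ?case by simp
next
  case (Suc n)
  then show ?case using tdeg_mult_le[of p k "p ^ n" "n * k"] by simp
qed

lemma tdeg_theta_le: "tdeg theta \<le> 2"
  unfolding theta_def
proof (intro tdeg_add_le tdeg_sum_le)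
  show "tdeg (1 :: 'a rpoly) \<le> 2" by simp
  show "tdeg ((var i)\<^sup>2) \<le> 2" for i :: 'a
    using tdeg_power_le[OF tdeg_var_le[of i], of 2] by simp
qed

section \<open>Archimedean preorderings\<close>

definition ring_preordering :: "'n rpoly set \<Rightarrow> bool" where
  "ring_preordering T \<longleftrightarrow> (\<forall>a\<in>T. \<forall>b\<in>T. a + b \<in> T \<and> a * b \<in> T) \<and> (\<forall>a. a\<^sup>2 \<in> T)"

definition archimedean :: "'n rpoly set \<Rightarrow> bool" where
  "archimedean T \<longleftrightarrow> (\<forall>a. \<exists>N. const N - a \<in> T)"

lemma ring_preorderingD:
  assumes "ring_preordering T"
  shows "a \<in> T \<Longrightarrow> b \<in> T \<Longrightarrow> a + b \<in> T" "a \<in> T \<Longrightarrow> b \<in> T \<Longrightarrow> a * b \<in> T" "a\<^sup>2 \<in> T" "a * a \<in> T"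
  using assms by (auto simp: ring_preordering_def simp flip: power2_eq_square)

lemma ring_preordering_const: "ring_preordering T \<Longrightarrow> 0 \<le> r \<Longrightarrow> const r \<in> T"
  using ring_preorderingD(4)[of T "const (sqrt r)"] by (simp flip: const_mult)

lemma ring_preordering_0: "ring_preordering T \<Longrightarrow> 0 \<in> T"
  and ring_preordering_1: "ring_preordering T \<Longrightarrow> 1 \<in> T"
  using ring_preordering_const[of T 0] ring_preordering_const[of T 1] by auto

section \<open>Extension of a preordering to a total one\<close>

definition adjoin :: "'n rpoly set \<Rightarrow> 'n rpoly \<Rightarrow> 'n rpoly set" where
  "adjoin T a = {s + a * t | s t. s \<in> T \<and> t \<in> T}"

lemma adjoinI: "s \<in> T \<Longrightarrow> t \<in> T \<Longrightarrow> s + a * t \<in> adjoin T a"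
  by (auto simp: adjoin_def)

lemma adjoin_subset: "ring_preordering T \<Longrightarrow> T \<subseteq> adjoin T a"
  using adjoinI[of _ T 0 a] by (auto simp: ring_preordering_0)

lemma adjoin_mem: "ring_preordering T \<Longrightarrow> a \<in> adjoin T a"
  using adjoinI[of 0 T 1 a] by (auto simp: ring_preordering_0 ring_preordering_1)

text \<open>Since \<open>a\<^sup>2\<close> lies in \<open>T\<close>, expressions linear in
  \<open>a\<close> already form the preordering generated by \<open>T\<close> and
  \<open>a\<close>.\<close>

lemma ring_preordering_adjoin:
  assumes T: "ring_preordering T"
  shows "ring_preordering (adjoin T a)"
  unfolding ring_preordering_def
proof (intro conjI ballI allI)
  fix p q assume "p \<in> adjoin T a" "q \<in> adjoin T a"
  then obtain s t s' t' where st: "s \<in> T" "t \<in> T" "s' \<in> T" "t' \<in> T" and eq: "p = s + a * t" "q = s' + a * t'"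
    by (auto simp: adjoin_def)
  have "p + q = (s + s') + a * (t + t')"
    by (simp add: eq algebra_simps)
  also have "\<dots> \<in> adjoin T a" by (intro adjoinI ring_preorderingD[OF T] st)
  finally show "p + q \<in> adjoin T a" .
  have "p * q = (s * s' + a\<^sup>2 * (t * t')) + a * (s * t' + t * s')"
    by (simp add: eq algebra_simps power2_eq_square)
  also have "\<dots> \<in> adjoin T a" by (intro adjoinI ring_preorderingD[OF T] st)
  finally show "p * q \<in> adjoin T a" .
next
  show "p\<^sup>2 \<in> adjoin T a" for p
    using adjoin_subset[OF T] ring_preorderingD(3)[OF T] by blast
qed

text \<open>A maximal proper preordering, obtained from Zorn's lemma, is total: if neither
  \<open>a\<close> nor \<open>- a\<close> can be adjoined, each attempt yields a representation of
  -1, and the two multiply to a contradiction.\<close>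

lemma ring_preordering_extend_total:
  fixes T :: "'n rpoly set"
  assumes T: "ring_preordering T" "- 1 \<notin> T"
  obtains Q where "T \<subseteq> Q" "ring_preordering Q" "- 1 \<notin> Q" "\<And>a. a \<in> Q \<or> - a \<in> Q"
proof -
  let ?A = "{Q. T \<subseteq> Q \<and> ring_preordering Q \<and> - 1 \<notin> Q}"
  have "\<exists>M\<in>?A. \<forall>X\<in>?A. M \<subseteq> X \<longrightarrow> X = M"
  proof (rule subset_Zorn_nonempty)
    show "?A \<noteq> {}" using T by blast
    fix C assume C: "C \<noteq> {}" "subset.chain ?A C"
    then have sub: "C \<subseteq> ?A" and lin: "X \<in> C \<Longrightarrow> Y \<in> C \<Longrightarrow> X \<subseteq> Y \<or> Y \<subseteq> X" for X Y
      by (auto simp: subset_chain_def)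
    have "ring_preordering (\<Union>C)"
      unfolding ring_preordering_def
    proof (intro conjI ballI allI)
      fix a b assume "a \<in> \<Union>C" "b \<in> \<Union>C"
      then obtain X where X: "X \<in> C" "a \<in> X" "b \<in> X" using lin by blast
      then have "ring_preordering X" using sub by blast
      with X show "a + b \<in> \<Union>C" "a * b \<in> \<Union>C" using ring_preorderingD(1,2) by blast+
    next
      obtain X where X: "X \<in> C" using C(1) by blast
      then have "ring_preordering X" using sub by blast
      with X show "a\<^sup>2 \<in> \<Union>C" for a using ring_preorderingD(3) by blast
    qed
    with C sub show "\<Union>C \<in> ?A" by blast
  qed
  then obtain Q where Q: "T \<subseteq> Q" "ring_preordering Q" "- 1 \<notin> Q"
      and max: "\<And>X. T \<subseteq> X \<Longrightarrow> ring_preordering X \<Longrightarrow> - 1 \<notin> X \<Longrightarrow> Q \<subseteq> X \<Longrightarrow> X = Q"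
    by auto
  have neg: "- 1 \<in> adjoin Q a" if "a \<notin> Q" for a
    using max[of "adjoin Q a"] ring_preordering_adjoin[OF Q(2)] adjoin_subset[OF Q(2), of a]
      adjoin_mem[OF Q(2), of a] Q(1) that by blast
  have "a \<in> Q \<or> - a \<in> Q" for a
  proof (rule ccontr)
    assume "\<not> (a \<in> Q \<or> - a \<in> Q)"
    then obtain s t s' t' where st: "s \<in> Q" "t \<in> Q" "s' \<in> Q" "t' \<in> Q"
        and eq: "- 1 = s + a * t" "- 1 = s' + (- a) * t'"
      using neg[of a] neg[of "- a"] by (auto simp: adjoin_def)
    have "s = (s + a * t) - a * t" "s' = (s' + (- a) * t') + a * t'" by simp_all
    then have s: "s = - 1 - a * t" and s': "s' = - 1 + a * t'"
      by (simp_all only: eq(1)[symmetric] eq(2)[symmetric])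
    \<comment> \<open>This is \<open>(1 + s) * (1 + s') = - a\<^sup>2 * (t * t')\<close>, the
      product of \<open>1 + s = - a * t\<close> and \<open>1 + s' = a * t'\<close>, solved for
      -1.\<close>
    have "- 1 = s + s' + s * s' + a\<^sup>2 * (t * t')"
      unfolding s s' by (simp add: algebra_simps power2_eq_square)
    also have "\<dots> \<in> Q" by (intro ring_preorderingD[OF Q(2)] st)
    finally show False using Q(3) by blast
  qed
  with Q that show thesis by blast
qed

text \<open>A total archimedean preordering is an order at a point: every ring element is infinitesimally close
  to a real number, and the resulting ring homomorphism to the reals is evaluation.\<close>

lemma total_archimedean_point:
  fixes Q :: "'n::finite rpoly set"
  assumes Q: "ring_preordering Q" "archimedean Q" "- 1 \<notin> Q" and total: "\<And>a. a \<in> Q \<or> - a \<in> Q"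
  obtains z where "\<And>q. q \<in> Q \<Longrightarrow> eval q z \<ge> 0"
proof -
  note Q_rules = ring_preorderingD(1,2)[OF Q(1)] ring_preordering_const[OF Q(1)]
  have const_nonneg: "r \<ge> 0" if "const r \<in> Q" for r
  proof (rule ccontr)
    assume "\<not> r \<ge> 0"
    then have "const (1 / (- r)) * const r \<in> Q" by (intro Q_rules that) auto
    then have "const (- 1) \<in> Q" using \<open>\<not> r \<ge> 0\<close> by (simp flip: const_mult)
    then show False using Q(3) by (simp add: const_uminus)
  qed
  define inf where "inf a \<longleftrightarrow> (\<forall>\<epsilon>>0. const \<epsilon> + a \<in> Q \<and> const \<epsilon> - a \<in> Q)" for a
  have inf_add: "inf (a + b)" if "inf a" "inf b" for a b
    unfolding inf_def
  proof (intro allI impI)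
    fix \<epsilon> :: real assume "\<epsilon> > 0"
    then have h: "const (\<epsilon>/2) + a \<in> Q" "const (\<epsilon>/2) - a \<in> Q" "const (\<epsilon>/2) + b \<in> Q" "const (\<epsilon>/2) - b \<in> Q"
      using that unfolding inf_def by (meson half_gt_zero)+
    have e: "const \<epsilon> = const (\<epsilon>/2) + const (\<epsilon>/2)" by (simp flip: const_add)
    have "const \<epsilon> + (a + b) = (const (\<epsilon>/2) + a) + (const (\<epsilon>/2) + b)"
      "const \<epsilon> - (a + b) = (const (\<epsilon>/2) - a) + (const (\<epsilon>/2) - b)"
      unfolding e by (simp_all add: algebra_simps)
    then show "const \<epsilon> + (a + b) \<in> Q \<and> const \<epsilon> - (a + b) \<in> Q"
      using Q_rules(1)[OF h(1,3)] Q_rules(1)[OF h(2,4)] by metis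
  qed
  have bound: "\<exists>N>0. const N + b \<in> Q \<and> const N - b \<in> Q" for b
  proof -
    obtain N1 N2 where N: "const N1 - b \<in> Q" "const N2 - (- b) \<in> Q"
      using Q(2) unfolding archimedean_def by blast
    define N where "N = \<bar>N1\<bar> + \<bar>N2\<bar> + 1"
    have "const N + b = (const N2 - (- b)) + const (N - N2)" "const N - b = (const N1 - b) + const (N - N1)"
      by (simp_all add: const_diff)
    moreover have "(const N2 - (- b)) + const (N - N2) \<in> Q" "(const N1 - b) + const (N - N1) \<in> Q"
      by (intro Q_rules N; simp add: N_def)+
    ultimately have "const N + b \<in> Q" "const N - b \<in> Q" by metis+
    moreover have "N > 0" by (simp add: N_def)
    ultimately show ?thesis by blast
  qed
  have inf_mult_half: "const \<epsilon> - a * b \<in> Q" if "inf a" "\<epsilon> > 0" for a b \<epsilon>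
  proof -
    obtain N where N: "N > 0" "const N + b \<in> Q" "const N - b \<in> Q" using bound by blast
    have h: "const (\<epsilon>/N) + a \<in> Q" "const (\<epsilon>/N) - a \<in> Q"
      using \<open>inf a\<close> N(1) \<open>\<epsilon> > 0\<close> unfolding inf_def by (meson divide_pos_pos)+
    \<comment> \<open>All four factors are members of \<open>Q\<close>. In the sum the terms
      containing only \<open>a\<close> or only \<open>b\<close> cancel, and the constant minus
      \<open>a * b\<close> is left; this handles the unknown sign of \<open>b\<close>.\<close>
    have "const (1/2) * ((const (\<epsilon>/N) - a) * (const N + b) + (const (\<epsilon>/N) + a) * (const N - b)) \<in> Q"
      by (intro Q_rules h N) simp
    also have "const (1/2) * ((const (\<epsilon>/N) - a) * (const N + b) + (const (\<epsilon>/N) + a) * (const N - b))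
        = (const (1/2) + const (1/2)) * (const (\<epsilon>/N) * const N - a * b)"
      by (simp add: algebra_simps)
    also have "\<dots> = const \<epsilon> - a * b" using N(1) by (simp flip: const_add const_mult)
    finally show ?thesis .
  qed
  have inf_uminus: "inf (- a)" if "inf a" for a using that by (auto simp: inf_def)
  have inf_mult: "inf (a * b)" if "inf a" for a b
    using inf_mult_half[OF that, of _ b] inf_mult_half[OF inf_uminus[OF that], of _ b] by (simp add: inf_def)
  have near_exists: "\<exists>r. inf (a - const r)" for a
  proof -
    \<comment> \<open>The lower Dedekind cut of \<open>a\<close>; its supremum is the real number
      infinitely close to \<open>a\<close>.\<close>
    let ?L = "{r. a - const r \<in> Q}"
    obtain N where N: "const N + a \<in> Q" "const N - a \<in> Q" using bound by blast
    have ne: "?L \<noteq> {}" using N(1) by (intro ex_in_conv[THEN iffD1] exI[of _ "- N"]) (simp add: const_uminus add.commute)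
    have up: "r \<le> N" if "r \<in> ?L" for r
    proof -
      have "const (N - r) = (const N - a) + (a - const r)" by (simp add: const_diff)
      also have "\<dots> \<in> Q" using that by (intro Q_rules N) simp
      finally show ?thesis using const_nonneg by fastforce
    qed
    then have bdd: "bdd_above ?L" by (rule bdd_aboveI)
    have "inf (a - const (Sup ?L))"
      unfolding inf_def
    proof (intro allI impI conjI)
      fix \<epsilon> :: real assume "\<epsilon> > 0"
      obtain r where r: "a - const r \<in> Q" "Sup ?L - \<epsilon> < r"
        using less_cSup_iff[OF ne bdd, of "Sup ?L - \<epsilon>"] \<open>\<epsilon> > 0\<close> by auto
      have "const \<epsilon> + (a - const (Sup ?L)) = (a - const r) + const (r - (Sup ?L - \<epsilon>))"
        by (simp add: const_diff)
      also have "\<dots> \<in> Q" using r by (intro Q_rules) auto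
      finally show "const \<epsilon> + (a - const (Sup ?L)) \<in> Q" .
      \<comment> \<open>Totality enters here: a number above the supremum is not in the cut, so the
        negated difference must be in \<open>Q\<close>.\<close>
      have "Sup ?L + \<epsilon> \<notin> ?L" using cSup_upper[OF _ bdd, of "Sup ?L + \<epsilon>"] \<open>\<epsilon> > 0\<close> by auto
      then have "- (a - const (Sup ?L + \<epsilon>)) \<in> Q" using total[of "a - const (Sup ?L + \<epsilon>)"] by simp
      then show "const \<epsilon> - (a - const (Sup ?L)) \<in> Q" by (simp add: const_add algebra_simps)
    qed
    then show ?thesis by blast
  qed
  then have "\<forall>i. \<exists>r. inf (var i - const r)" by blast
  then obtain zf where zf: "\<And>i. inf (var i - const (zf i))" by metis
  define z where "z = (\<chi> i. zf i)"
  have near: "inf (p - const (eval p z))" for p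
  proof (induction p rule: rpoly_induct)
    case (const a)
    then show ?case using Q_rules by (simp add: inf_def)
  next
    case (var i)
    then show ?case using zf by (simp add: z_def)
  next
    case (add p q)
    from inf_add[OF this] show ?case by (simp add: eval_simps const_add algebra_simps)
  next
    case (mult p q)
    from inf_add[OF inf_mult[OF mult(1), of q] inf_mult[OF mult(2), of "const (eval p z)"]]
    show ?case by (simp add: eval_simps const_mult algebra_simps)
  qed
  have "eval q z \<ge> 0" if "q \<in> Q" for q
  proof (rule ccontr)
    assume "\<not> eval q z \<ge> 0"
    then have "const (- eval q z / 2) - (q - const (eval q z)) \<in> Q"
      using near[of q] unfolding inf_def by simp
    from Q_rules(1)[OF this that] have "const (eval q z / 2) \<in> Q"
      by (simp add: algebra_simps flip: const_add)
    then show False using const_nonneg \<open>\<not> eval q z \<ge> 0\<close> by force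
  qed
  then show thesis using that by blast
qed

text \<open>Krivine's representation theorem. If -1 were not in \<open>adjoin T (- p)\<close>, a
  total extension would give a point at which \<open>T\<close> is nonnegative and \<open>p\<close>
  is not positive. So \<open>p * t = 1 + s\<close> with \<open>s\<close> and \<open>t\<close> in
  \<open>T\<close>, and it remains to get rid of the factor \<open>t\<close>.\<close>

theorem archimedean_positivstellensatz:
  fixes T :: "'n::finite rpoly set"
  assumes T: "ring_preordering T" "archimedean T"
    and pos: "\<And>z. (\<And>q. q \<in> T \<Longrightarrow> eval q z \<ge> 0) \<Longrightarrow> eval p z > 0"
  shows "p \<in> T"
proof -
  note T_rules = ring_preorderingD(1,2)[OF T(1)] ring_preordering_const[OF T(1)]
  have "- 1 \<in> adjoin T (- p)"
  proof (rule ccontr)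
    assume "- 1 \<notin> adjoin T (- p)"
    from ring_preordering_extend_total[OF ring_preordering_adjoin[OF T(1)] this]
    obtain Q where Q: "adjoin T (- p) \<subseteq> Q" "ring_preordering Q" "- 1 \<notin> Q" "\<And>a. a \<in> Q \<or> - a \<in> Q" by blast
    have "T \<subseteq> Q" "- p \<in> Q" using Q(1) adjoin_subset[OF T(1)] adjoin_mem[OF T(1)] by blast+
    moreover have "archimedean Q" using T(2) \<open>T \<subseteq> Q\<close> unfolding archimedean_def by blast
    ultimately obtain z where "\<And>q. q \<in> Q \<Longrightarrow> eval q z \<ge> 0"
      using total_archimedean_point[of Q] Q by metis
    then have "eval p z > 0" "eval (- p) z \<ge> 0" using pos \<open>T \<subseteq> Q\<close> \<open>- p \<in> Q\<close> by blast+
    then show False by (simp add: eval_simps)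
  qed
  then obtain s t where st: "s \<in> T" "t \<in> T" and eq: "- 1 = s + (- p) * t"
    unfolding adjoin_def by auto
  have "- (- 1) = - (s + (- p) * t)" by (simp only: eq)
  then have pt: "p * t = 1 + s" by (simp add: algebra_simps)
  obtain N0 where N0: "const N0 - t \<in> T" using T(2) by (auto simp: archimedean_def)
  define N where "N = \<bar>N0\<bar> + 1"
  have "const N - t = (const N0 - t) + const (N - N0)" by (simp add: const_diff)
  also have "\<dots> \<in> T" by (intro T_rules N0) (simp add: N_def)
  finally have N: "const N - t \<in> T" "N > 0" by (simp_all add: N_def)
  obtain M where "const M - (- p) \<in> T" using T(2) unfolding archimedean_def by blast
  then have M: "p + const M \<in> T" by (simp add: add.commute)
  text \<open>Multiplying by \<open>N - t \<ge> 0\<close> and using \<open>p * t = 1 + s\<close> improves the lower bound by \<open>1 / N\<close>.\<close>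
  have step: "p + const (r - 1 / N) \<in> T" if r: "p + const r \<in> T" "r \<ge> 0" for r
  proof -
    have "(p + const r) * (const N - t) + s + const r * t \<in> T"
      by (rule T_rules(1)[OF T_rules(1)[OF T_rules(2)[OF r(1) N(1)] st(1)] T_rules(2)[OF T_rules(3)[OF r(2)] st(2)]])
    also have "(p + const r) * (const N - t) + s + const r * t = (p + const r) * const N - 1"
      using pt by (simp add: algebra_simps)
    finally have "const (1 / N) * ((p + const r) * const N - 1) \<in> T"
      using N(2) by (intro T_rules) auto
    moreover have "const (1 / N) * ((p + const r) * const N - 1) = (p + const r) * (const N * const (1 / N)) - const (1 / N)"
      by (simp add: algebra_simps)
    ultimately show ?thesis using N(2) by (simp add: const_diff algebra_simps flip: const_mult)
  qed
  have nonpos: "p \<in> T" if "p + const r \<in> T" "r \<le> 0" for r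
  proof -
    have "(p + const r) + const (- r) \<in> T" using T_rules(1)[OF that(1) T_rules(3)[of "- r"]] that(2) by simp
    then show ?thesis by (simp add: const_uminus)
  qed
  have "p \<in> T \<or> p + const (M - k / N) \<in> T" for k :: nat
  proof (induction k)
    case (Suc k)
    show ?case
    proof (cases "p \<in> T")
      case False
      with Suc nonpos[of "M - k / N"] have "p + const (M - k / N - 1 / N) \<in> T"
        by (intro step) force+
      then show ?thesis by (simp add: diff_divide_distrib add_divide_distrib algebra_simps)
    qed simp
  qed (use M in simp)
  moreover obtain k :: nat where "M * N \<le> real k" using real_arch_simple by blast
  then have "M - k / N \<le> 0" using N(2) by (simp add: field_simps)
  ultimately show ?thesis using nonpos by blast
qed

section \<open>Positive polynomials on the sphere\<close>

definition sos_on :: "(real ^ 'n::finite) set \<Rightarrow> 'n rpoly set" where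
  "sos_on X = {p. \<exists>s\<in>sos. \<forall>x\<in>X. eval p x = eval s x}"

lemma sos_0 [simp]: "0 \<in> sos"
  unfolding sos_def by (auto intro: exI[of _ 0])

lemma sos_square: "a\<^sup>2 \<in> sos"
  unfolding sos_def by (rule CollectI, rule exI[of _ 1], rule exI[of _ "\<lambda>_. a"]) simp

lemma sos_add:
  assumes "p \<in> sos" "q \<in> sos"
  shows "p + q \<in> sos"
proof -
  have add_square: "r + b\<^sup>2 \<in> sos" if r: "r \<in> sos" for r b :: "'a rpoly"
  proof -
    obtain l :: nat and a where "r = (\<Sum>i<l. (a i)\<^sup>2)" using r by (auto simp: sos_def)
    then have "r + b\<^sup>2 = (\<Sum>i<Suc l. ((a(l := b)) i)\<^sup>2)" by simp
    then show ?thesis unfolding sos_def by blast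
  qed
  obtain l :: nat and b where q: "q = (\<Sum>i<l. (b i)\<^sup>2)" using assms(2) by (auto simp: sos_def)
  have "p + (\<Sum>i<k. (b i)\<^sup>2) \<in> sos" for k :: nat
    by (induction k) (use assms(1) add_square in \<open>auto simp flip: add.assoc\<close>)
  then show ?thesis using q by simp
qed

lemma sos_sum: "(\<And>i. i \<in> A \<Longrightarrow> f i \<in> sos) \<Longrightarrow> sum f A \<in> sos"
  by (induction A rule: infinite_finite_induct) (auto intro: sos_add)

lemma sos_mult:
  assumes "p \<in> sos" "q \<in> sos"
  shows "p * q \<in> sos"
proof -
  obtain l :: nat and a and l' :: nat and a' where "p = (\<Sum>i<l. (a i)\<^sup>2)" "q = (\<Sum>i<l'. (a' i)\<^sup>2)"
    using assms by (auto simp: sos_def)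
  then have "p * q = (\<Sum>i<l. \<Sum>j<l'. (a i * a' j)\<^sup>2)"
    by (simp add: sum_product power_mult_distrib)
  then show ?thesis by (auto intro!: sos_sum sos_square)
qed

lemma sos_const: "0 \<le> r \<Longrightarrow> const r \<in> sos"
  using sos_square[of "const (sqrt r)"] by (simp add: power2_eq_square flip: const_mult)

lemma sos_eval_nonneg: "s \<in> sos \<Longrightarrow> eval s x \<ge> 0"
  by (auto simp: sos_def eval_simps intro!: sum_nonneg)

lemma sos_onI: "s \<in> sos \<Longrightarrow> (\<And>x. x \<in> X \<Longrightarrow> eval p x = eval s x) \<Longrightarrow> p \<in> sos_on X"
  by (auto simp: sos_on_def)

lemma sos_imp_sos_on: "s \<in> sos \<Longrightarrow> s \<in> sos_on X"
  by (rule sos_onI[of s]) simp_all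

lemma ring_preordering_sos_on: "ring_preordering (sos_on X)"
  unfolding ring_preordering_def
proof (intro conjI ballI allI)
  fix a b assume "a \<in> sos_on X" "b \<in> sos_on X"
  then obtain s t where "s \<in> sos" "t \<in> sos" "\<And>x. x \<in> X \<Longrightarrow> eval a x = eval s x" "\<And>x. x \<in> X \<Longrightarrow> eval b x = eval t x"
    by (auto simp: sos_on_def)
  then show "a + b \<in> sos_on X" "a * b \<in> sos_on X"
    by (auto intro: sos_onI[OF sos_add] sos_onI[OF sos_mult] simp: eval_simps)
qed (auto intro: sos_imp_sos_on sos_square)

lemma norm_eq_1_iff_sum_squares:
  fixes x :: "real ^ 'n::finite"
  shows "norm x = 1 \<longleftrightarrow> (\<Sum>i\<in>UNIV. (x $ i)\<^sup>2) = 1"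
  by (simp add: norm_vec_def L2_set_def)

text \<open>Bounded elements form a ring, so only the variables need an argument: on the sphere, 1 +
  x_i is half the sum of (1 + x_i)^2 and the squares of the other coordinates, and likewise for 1 -
  x_i.\<close>

lemma archimedean_sos_on_sphere: "archimedean (sos_on (sphere (0 :: real ^ 'n::finite) 1))"
proof -
  let ?T = "sos_on (sphere (0 :: real ^ 'n) 1)"
  note T_rules = ring_preorderingD(1,2)[OF ring_preordering_sos_on] ring_preordering_const[OF ring_preordering_sos_on]
  have "\<exists>N\<ge>0. const N + p \<in> ?T \<and> const N - p \<in> ?T" for p
  proof (induction p rule: rpoly_induct)
    case (const a)
    have "const \<bar>a\<bar> + const a \<in> ?T" "const \<bar>a\<bar> - const a \<in> ?T"
      by (simp_all add: T_rules flip: const_add const_diff)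
    then show ?case by (intro exI[of _ "\<bar>a\<bar>"]) simp
  next
    case (var i)
    have *: "(\<Sum>j\<in>UNIV. (x $ j)\<^sup>2) = (x $ i)\<^sup>2 + (\<Sum>j\<in>UNIV - {i}. (x $ j)\<^sup>2)" for x :: "real ^ 'n"
      by (simp add: sum.remove)
    have "const 1 + var i \<in> ?T"
    proof (rule sos_onI)
      show "const (1/2) * ((1 + var i)\<^sup>2 + (\<Sum>j\<in>UNIV - {i}. (var j)\<^sup>2)) \<in> sos"
        by (intro sos_mult sos_const sos_add sos_sum sos_square) simp
    qed (simp add: norm_eq_1_iff_sum_squares * eval_simps, simp add: power2_sum)
    moreover have "const 1 - var i \<in> ?T"
    proof (rule sos_onI)
      show "const (1/2) * ((1 - var i)\<^sup>2 + (\<Sum>j\<in>UNIV - {i}. (var j)\<^sup>2)) \<in> sos"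
        by (intro sos_mult sos_const sos_add sos_sum sos_square) simp
    qed (simp add: norm_eq_1_iff_sum_squares * eval_simps, simp add: power2_diff)
    ultimately show ?case by (intro exI[of _ 1]) simp
  next
    case (add p q)
    then obtain N M where h: "N \<ge> 0" "const N + p \<in> ?T" "const N - p \<in> ?T" "M \<ge> 0" "const M + q \<in> ?T" "const M - q \<in> ?T"
      by blast
    have "const (N + M) + (p + q) = (const N + p) + (const M + q)" "const (N + M) - (p + q) = (const N - p) + (const M - q)"
      by (simp_all add: const_add)
    then have "const (N + M) + (p + q) \<in> ?T" "const (N + M) - (p + q) \<in> ?T"
      using T_rules(1)[OF h(2,5)] T_rules(1)[OF h(3,6)] by metis+
    with h(1,4) show ?case by (intro exI[of _ "N + M"]) simp
  next
    case (mult p q)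
    then obtain N M where h: "N \<ge> 0" "const N + p \<in> ?T" "const N - p \<in> ?T" "M \<ge> 0" "const M + q \<in> ?T" "const M - q \<in> ?T"
      by blast
    \<comment> \<open>The mixed terms cancel, so half the sum of the two products is
      \<open>N * M + p * q\<close> in the first line and \<open>N * M - p * q\<close> in the
      second.\<close>
    have "const (1/2) * ((const N + p) * (const M + q) + (const N - p) * (const M - q)) \<in> ?T"
      "const (1/2) * ((const N - p) * (const M + q) + (const N + p) * (const M - q)) \<in> ?T"
      using h by (auto intro!: T_rules)
    moreover have "const (1/2) * ((const N + p) * (const M + q) + (const N - p) * (const M - q)) =
        (const (1/2) + const (1/2)) * (const (N * M) + p * q)"
      "const (1/2) * ((const N - p) * (const M + q) + (const N + p) * (const M - q)) =
        (const (1/2) + const (1/2)) * (const (N * M) - p * q)"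
      by (simp_all add: const_mult algebra_simps)
    moreover have "const (1/2) + const (1/2) = (1 :: 'n rpoly)" by (simp flip: const_add)
    ultimately show ?case using h(1,4) by (intro exI[of _ "N * M"]) simp
  qed
  then show ?thesis unfolding archimedean_def by blast
qed

theorem positive_on_sphere_imp_sos_on:
  fixes p :: "'n::finite rpoly"
  assumes "\<And>x. x \<in> sphere 0 1 \<Longrightarrow> eval p x > 0"
  shows "p \<in> sos_on (sphere 0 1)"
proof (rule archimedean_positivstellensatz[OF ring_preordering_sos_on archimedean_sos_on_sphere])
  fix z :: "real ^ 'n" assume z: "\<And>q. q \<in> sos_on (sphere 0 1) \<Longrightarrow> eval q z \<ge> 0"
  \<comment> \<open>Both \<open>?q\<close> and \<open>- ?q\<close> agree with 0 on the sphere and so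
    lie in \<open>sos_on\<close>. Nonnegativity of both at \<open>z\<close> puts \<open>z\<close> on
    the sphere.\<close>
  let ?q = "(\<Sum>i\<in>UNIV. (var i)\<^sup>2) - 1 :: 'n rpoly"
  have "?q \<in> sos_on (sphere 0 1)" "- ?q \<in> sos_on (sphere 0 1)"
    by (auto intro!: sos_onI[OF sos_0] simp: norm_eq_1_iff_sum_squares eval_simps)
  from this[THEN z] have "z \<in> sphere 0 1" by (simp add: norm_eq_1_iff_sum_squares eval_simps)
  then show "eval p z > 0" by (rule assms)
qed

section \<open>Quadratic modules on the sphere\<close>

lemma compact_pos_lower_bound:
  fixes p :: "'a::topological_space \<Rightarrow> real"
  assumes "compact X" "continuous_on X p" "\<And>x. x \<in> X \<Longrightarrow> p x > 0"
  shows "\<exists>d>0. \<forall>x\<in>X. d \<le> p x"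
proof (cases "X = {}")
  case False
  from continuous_attains_inf[OF assms(1) False assms(2)] assms(3) show ?thesis by blast
qed (auto intro: exI[of _ 1])

lemma compact_upper_bound:
  fixes p :: "'a::topological_space \<Rightarrow> real"
  assumes "compact X" "continuous_on X p"
  shows "\<exists>B>0. \<forall>x\<in>X. \<bar>p x\<bar> \<le> B"
proof -
  have "compact ((\<lambda>x. \<bar>p x\<bar>) ` X)"
    by (intro compact_continuous_image continuous_intros assms)
  then have "bdd_above ((\<lambda>x. \<bar>p x\<bar>) ` X)"
    by (intro bounded_imp_bdd_above compact_imp_bounded)
  then obtain B where "\<forall>x\<in>X. \<bar>p x\<bar> \<le> B"
    unfolding bdd_above_def by blast
  then show ?thesis by (intro exI[of _ "\<bar>B\<bar> + 1"]) force
qed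

text \<open>The set where \<open>p\<close> is not positive is compact and avoids the zeros of
  \<open>q\<close>, so \<open>q\<close> has a positive lower bound on it.\<close>

lemma compact_pos_near_zeros:
  fixes p q :: "'a::t2_space \<Rightarrow> real"
  assumes X: "compact X" "continuous_on X p" "continuous_on X q"
    and "\<And>x. x \<in> X \<Longrightarrow> q x \<ge> 0" and "\<And>x. x \<in> X \<Longrightarrow> q x = 0 \<Longrightarrow> p x > 0"
  shows "\<exists>e>0. \<forall>x\<in>X. q x < e \<longrightarrow> p x > 0"
proof -
  let ?Y = "X \<inter> p -` {..0}"
  have "closed ?Y"
    by (rule continuous_closed_preimage[OF X(2) compact_imp_closed[OF X(1)] closed_atMost])
  then have "compact (X \<inter> ?Y)" by (rule compact_Int_closed[OF X(1)])
  then have Y: "compact ?Y" by (simp add: Int_absorb1)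
  have "q x > 0" if "x \<in> ?Y" for x
    using that assms(4,5)[of x] by (cases "q x = 0") auto
  then have "\<exists>d>0. \<forall>x\<in>?Y. d \<le> q x"
    by (intro compact_pos_lower_bound[OF Y continuous_on_subset[OF X(3)]]) auto
  then obtain d where "d > 0" "\<forall>x\<in>?Y. d \<le> q x" by blast
  then show ?thesis by (intro exI[of _ d]) force
qed

text \<open>Used whenever positivity on a zero set must be extended to a compact set: to absorb
  constraints, to locate stationary points of a penalty function, to make a Hessian definite and to
  bound \<open>f\<close> from below.\<close>

lemma compact_penalty:
  fixes p q :: "'a::t2_space \<Rightarrow> real"
  assumes X: "compact X" "continuous_on X p" "continuous_on X q"
    and q: "\<And>x. x \<in> X \<Longrightarrow> q x \<ge> 0" and p: "\<And>x. x \<in> X \<Longrightarrow> q x = 0 \<Longrightarrow> p x > 0"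
  shows "\<exists>N>0. \<forall>x\<in>X. p x + N * q x > 0"
proof -
  obtain e where e: "e > 0" "\<And>x. x \<in> X \<Longrightarrow> q x < e \<Longrightarrow> p x > 0"
    using compact_pos_near_zeros[OF X q p] by blast
  obtain B where B: "B > 0" "\<And>x. x \<in> X \<Longrightarrow> \<bar>p x\<bar> \<le> B"
    using compact_upper_bound[OF X(1,2)] by blast
  \<comment> \<open>Where \<open>q x \<ge> e\<close> the penalty is at least \<open>2 * B\<close>,
    which beats the bound \<open>B\<close> on the absolute value of \<open>p\<close>.\<close>
  define N where "N = 2 * B / e"
  have N: "N > 0" using B e by (simp add: N_def)
  have "p x + N * q x > 0" if x: "x \<in> X" for x
  proof (cases "q x < e")
    case True
    then show ?thesis using e(2)[OF x] q[OF x] N by (simp add: add_pos_nonneg)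
  next
    case False
    then have "N * e \<le> N * q x" using N by simp
    then show ?thesis using B(1) B(2)[OF x] e(1) by (simp add: N_def abs_if split: if_splits)
  qed
  with N show ?thesis by blast
qed

lemma finite_uniform_eps:
  assumes "finite L" and "\<And>l. l \<in> L \<Longrightarrow> \<exists>e>0::real. Q l e"
    and mono: "\<And>l e e'. l \<in> L \<Longrightarrow> Q l e \<Longrightarrow> 0 < e' \<Longrightarrow> e' \<le> e \<Longrightarrow> Q l e'"
  shows "\<exists>e>0. \<forall>l\<in>L. Q l e"
proof -
  obtain e where e: "\<And>l. l \<in> L \<Longrightarrow> e l > 0 \<and> Q l (e l)" using assms(2) by metis
  have "Min (insert 1 (e ` L)) > 0" "\<And>l. l \<in> L \<Longrightarrow> Min (insert 1 (e ` L)) \<le> e l"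
    using assms(1) e by auto
  then show ?thesis using mono e by (intro exI[of _ "Min (insert 1 (e ` L))"]) blast
qed

section \<open>Quadratic modules of problems on the sphere\<close>

locale sphere_problem =
  fixes g :: "'j \<Rightarrow> 'm::finite rpoly" and E I :: "'j set"
  assumes finite_E: "finite E" and finite_I: "finite I"
begin

definition feas :: "(real ^ 'm) set" where
  "feas = sphere 0 1 \<inter> feasible_set (\<lambda>j. eval (g j)) E I"

text \<open>The identity is required on the sphere only and degrees are not recorded;
  dehomogenization evaluates at points of the sphere and absorbs every degree. If the sphere
  equation is itself listed in \<open>E\<close>, its term is zero here, but its gradient still
  counts for LICQC.\<close>

definition qm :: "'m rpoly set" where
  "qm = {p. \<exists>s0 s q. s0 \<in> sos \<and> (\<forall>j\<in>I. s j \<in> sos) \<and>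
     (\<forall>x\<in>sphere 0 1. eval p x =
        eval s0 x + (\<Sum>j\<in>I. eval (g j) x * eval (s j) x) + (\<Sum>j\<in>E. eval (g j) x * eval (q j) x))}"

lemma qmI:
  assumes "s0 \<in> sos" "\<And>j. j \<in> I \<Longrightarrow> s j \<in> sos"
    "\<And>x. x \<in> sphere 0 1 \<Longrightarrow> eval p x =
        eval s0 x + (\<Sum>j\<in>I. eval (g j) x * eval (s j) x) + (\<Sum>j\<in>E. eval (g j) x * eval (q j) x)"
  shows "p \<in> qm"
  using assms unfolding qm_def by blast

lemma qmE:
  assumes "p \<in> qm"
  obtains s0 s q where "s0 \<in> sos" "\<And>j. j \<in> I \<Longrightarrow> s j \<in> sos"
    "\<And>x. x \<in> sphere 0 1 \<Longrightarrow> eval p x =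
        eval s0 x + (\<Sum>j\<in>I. eval (g j) x * eval (s j) x) + (\<Sum>j\<in>E. eval (g j) x * eval (q j) x)"
  using assms unfolding qm_def by blast

lemma sos_on_imp_qm: "p \<in> sos_on (sphere 0 1) \<Longrightarrow> p \<in> qm"
  by (auto simp: sos_on_def intro!: qmI[of _ "\<lambda>_. 0" _ "\<lambda>_. 0"])

lemma ineq_imp_qm:
  assumes "j \<in> I" shows "g j \<in> qm"
proof (rule qmI[of 0 "\<lambda>i. if i = j then 1 else 0" _ "\<lambda>_. 0"])
  fix x
  have "(\<Sum>i\<in>I. eval (g i) x * eval (if i = j then 1 else 0) x) = (\<Sum>i\<in>I. if i = j then eval (g i) x else 0)"
    by (intro sum.cong) auto
  then show "eval (g j) x = eval 0 x + (\<Sum>i\<in>I. eval (g i) x * eval (if i = j then 1 else 0) x) +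
      (\<Sum>j\<in>E. eval (g j) x * eval 0 x)"
    using assms finite_I by simp
qed (use sos_square[of 1] in auto)

lemma eq_mult_imp_qm:
  assumes "j \<in> E" shows "g j * p \<in> qm"
proof (rule qmI[of 0 "\<lambda>_. 0" _ "\<lambda>i. if i = j then p else 0"])
  fix x
  have "(\<Sum>i\<in>E. eval (g i) x * eval (if i = j then p else 0) x) = (\<Sum>i\<in>E. if i = j then eval (g i) x * eval p x else 0)"
    by (intro sum.cong) auto
  then show "eval (g j * p) x = eval 0 x + (\<Sum>i\<in>I. eval (g i) x * eval 0 x) +
      (\<Sum>i\<in>E. eval (g i) x * eval (if i = j then p else 0) x)"
    using assms finite_E by (simp add: eval_simps)
qed auto

lemma qm_add:
  assumes "p \<in> qm" "q \<in> qm" shows "p + q \<in> qm"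
proof -
  obtain s0 s r where p: "s0 \<in> sos" "\<And>j. j \<in> I \<Longrightarrow> s j \<in> sos"
    "\<And>x. x \<in> sphere 0 1 \<Longrightarrow> eval p x =
        eval s0 x + (\<Sum>j\<in>I. eval (g j) x * eval (s j) x) + (\<Sum>j\<in>E. eval (g j) x * eval (r j) x)"
    using qmE[OF assms(1)] by blast
  obtain s0' s' r' where q: "s0' \<in> sos" "\<And>j. j \<in> I \<Longrightarrow> s' j \<in> sos"
    "\<And>x. x \<in> sphere 0 1 \<Longrightarrow> eval q x =
        eval s0' x + (\<Sum>j\<in>I. eval (g j) x * eval (s' j) x) + (\<Sum>j\<in>E. eval (g j) x * eval (r' j) x)"
    using qmE[OF assms(2)] by blast
  show ?thesis
    by (rule qmI[of "s0 + s0'" "\<lambda>j. s j + s' j" _ "\<lambda>j. r j + r' j"])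
      (use p q in \<open>auto simp: eval_simps algebra_simps sum.distrib intro: sos_add\<close>)
qed

text \<open>Multipliers come from \<open>sos_on\<close> so that every polynomial positive on the
  sphere is admissible. This is how approximations of continuous weights enter.\<close>

lemma qm_mult:
  assumes "t \<in> sos_on (sphere 0 1)" "p \<in> qm" shows "t * p \<in> qm"
proof -
  obtain s0 s r where p: "s0 \<in> sos" "\<And>j. j \<in> I \<Longrightarrow> s j \<in> sos"
    "\<And>x. x \<in> sphere 0 1 \<Longrightarrow> eval p x =
        eval s0 x + (\<Sum>j\<in>I. eval (g j) x * eval (s j) x) + (\<Sum>j\<in>E. eval (g j) x * eval (r j) x)"
    using qmE[OF assms(2)] by blast
  obtain u where u: "u \<in> sos" "\<And>x. x \<in> sphere 0 1 \<Longrightarrow> eval t x = eval u x"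
    using assms(1) by (auto simp: sos_on_def)
  show ?thesis
    by (rule qmI[of "u * s0" "\<lambda>j. u * s j" _ "\<lambda>j. u * r j"])
      (use p u in \<open>auto simp: eval_simps algebra_simps sum_distrib_left intro: sos_mult\<close>)
qed

lemma qm_0: "0 \<in> qm"
  by (intro sos_on_imp_qm sos_imp_sos_on sos_0)

lemma qm_sum: "(\<And>i. i \<in> A \<Longrightarrow> f i \<in> qm) \<Longrightarrow> sum f A \<in> qm"
  by (induction A rule: infinite_finite_induct) (auto intro: qm_add qm_0)

lemma qm_nonneg:
  assumes "p \<in> qm" "x \<in> feas" shows "eval p x \<ge> 0"
proof -
  obtain s0 s r where p: "s0 \<in> sos" "\<And>j. j \<in> I \<Longrightarrow> s j \<in> sos"
    "\<And>x. x \<in> sphere 0 1 \<Longrightarrow> eval p x =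
        eval s0 x + (\<Sum>j\<in>I. eval (g j) x * eval (s j) x) + (\<Sum>j\<in>E. eval (g j) x * eval (r j) x)"
    using qmE[OF assms(1)] by blast
  have "x \<in> sphere 0 1" "\<And>j. j \<in> I \<Longrightarrow> eval (g j) x \<ge> 0" "\<And>j. j \<in> E \<Longrightarrow> eval (g j) x = 0"
    using assms(2) by (auto simp: feas_def feasible_set_def)
  with p(3) show ?thesis
    by (simp add: sum_nonneg sos_eval_nonneg[OF p(1)] sos_eval_nonneg[OF p(2)])
qed

lemma compact_feas: "compact feas"
proof -
  have "closed {x. eval p x = 0}" "closed {x. 0 \<le> eval p x}" for p :: "'m rpoly"
    by (intro closed_Collect_eq closed_Collect_le continuous_intros)+
  moreover have "feasible_set (\<lambda>j. eval (g j)) E I = (\<Inter>j\<in>E. {x. eval (g j) x = 0}) \<inter> (\<Inter>j\<in>I. {x. 0 \<le> eval (g j) x})"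
    by (auto simp: feasible_set_def)
  ultimately show ?thesis
    unfolding feas_def by (auto intro!: compact_Int_closed closed_Int closed_INT)
qed

lemma feas_subset: "feas \<subseteq> sphere 0 1"
  by (auto simp: feas_def)

text \<open>The constraints are absorbed by approximating the penalty multipliers \<open>N * max 0 (- g j)\<close>, so that
  only positivity on the whole sphere remains.\<close>

theorem positive_imp_qm:
  assumes pos: "\<And>x. x \<in> feas \<Longrightarrow> eval p x > 0"
  shows "p \<in> qm"
proof -
  let ?O = "sphere (0 :: real ^ 'm) 1"
  define m where "m j x = max 0 (- eval (g j) x)" for j x
  define pen where "pen x = (\<Sum>j\<in>I. (m j x)\<^sup>2) + (\<Sum>j\<in>E. (eval (g j) x)\<^sup>2)" for x
  have cont_m: "continuous_on X (m j)" for j X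
    unfolding m_def by (intro continuous_intros)
  have pen_nonneg: "pen x \<ge> 0" for x
    by (simp add: pen_def sum_nonneg)
  have pen_0: "x \<in> feas" if "x \<in> ?O" "pen x = 0" for x
  proof -
    have "(\<Sum>j\<in>I. (m j x)\<^sup>2) = 0" "(\<Sum>j\<in>E. (eval (g j) x)\<^sup>2) = 0"
      using that(2) by (auto simp: pen_def sum_nonneg add_nonneg_eq_0_iff)
    then have "\<forall>j\<in>I. m j x = 0" "\<forall>j\<in>E. eval (g j) x = 0"
      using finite_I finite_E by (auto simp: sum_nonneg_eq_0_iff)
    then show ?thesis using that(1) by (fastforce simp: feas_def feasible_set_def m_def max_def split: if_splits)
  qed
  have cont_pen: "continuous_on ?O pen"
    unfolding pen_def by (intro continuous_intros cont_m)
  have "\<exists>N>0. \<forall>x\<in>?O. eval p x + N * pen x > 0"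
    by (intro compact_penalty compact_sphere continuous_on_eval continuous_on_id cont_pen pen_nonneg pos pen_0)
  then obtain N where N: "N > 0" "\<And>x. x \<in> ?O \<Longrightarrow> eval p x + N * pen x > 0" by blast
  have "\<exists>d>0. \<forall>x\<in>?O. d \<le> eval p x + N * pen x"
    by (intro compact_pos_lower_bound compact_sphere continuous_intros cont_pen N(2))
  then obtain d where d: "d > 0" "\<And>x. x \<in> ?O \<Longrightarrow> d \<le> eval p x + N * pen x" by blast
  have "\<exists>B>0. \<forall>x\<in>?O. \<bar>\<Sum>j\<in>I. \<bar>eval (g j) x\<bar>\<bar> \<le> B"
    by (intro compact_upper_bound compact_sphere continuous_intros)
  then obtain B where B: "B > 0" "\<And>x. x \<in> ?O \<Longrightarrow> \<bar>\<Sum>j\<in>I. \<bar>eval (g j) x\<bar>\<bar> \<le> B" by blast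
  \<comment> \<open>The total approximation error is at most \<open>2 * h * B\<close>, which is half
    of the margin \<open>d\<close>.\<close>
  define h where "h = d / (4 * B)"
  have h: "h > 0" "2 * h * B < d" using d B by (auto simp: h_def)
  \<comment> \<open>Shifting the target up by \<open>h\<close> keeps the approximant positive,
    because \<open>N * m j x\<close> is nonnegative; the price is an error below
    \<open>2 * h\<close> instead of \<open>h\<close>.\<close>
  have "\<exists>s. \<forall>x\<in>?O. \<bar>(N * m j x + h) - eval s x\<bar> < h" for j
  proof -
    have "continuous_on ?O (\<lambda>x. N * m j x + h)" by (intro continuous_intros cont_m)
    from Stone_Weierstrass_eval[OF compact_sphere this h(1)] show ?thesis .
  qed
  then have "\<forall>j. \<exists>s. \<forall>x\<in>?O. \<bar>(N * m j x + h) - eval s x\<bar> < h" ..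
  from choice[OF this] obtain s where s: "\<And>j x. x \<in> ?O \<Longrightarrow> \<bar>(N * m j x + h) - eval (s j) x\<bar> < h"
    by blast
  have s_pos: "eval (s j) x > 0" if "x \<in> ?O" for j x
  proof -
    have "N * m j x \<ge> 0" using N(1) by (simp add: m_def)
    then show ?thesis using s[OF that, of j] by linarith
  qed
  have g_s: "eval (g j) x * eval (s j) x \<le> - N * (m j x)\<^sup>2 + 2 * h * \<bar>eval (g j) x\<bar>" if "x \<in> ?O" for j x
  proof -
    have "eval (g j) x * (N * m j x) = - N * (m j x)\<^sup>2"
      by (auto simp: m_def max_def power2_eq_square)
    moreover have "eval (g j) x * (eval (s j) x - N * m j x) \<le> \<bar>eval (g j) x\<bar> * \<bar>eval (s j) x - N * m j x\<bar>"
      by (metis abs_ge_self abs_mult)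
    moreover have "\<bar>eval (g j) x\<bar> * \<bar>eval (s j) x - N * m j x\<bar> \<le> \<bar>eval (g j) x\<bar> * (2 * h)"
      using s[OF that, of j] by (intro mult_left_mono) auto
    ultimately show ?thesis by (simp add: algebra_simps)
  qed
  \<comment> \<open>Up to a small error this is \<open>p + N * pen x\<close>: for an inequality
    \<open>- g * s\<close> is close to \<open>N * m\<^sup>2\<close>, and an equality contributes
    \<open>N * g\<^sup>2\<close> exactly.\<close>
  define r where "r = p - (\<Sum>j\<in>I. g j * s j) + const N * (\<Sum>j\<in>E. g j * g j)"
  have "eval r x > 0" if x: "x \<in> ?O" for x
  proof -
    have "(\<Sum>j\<in>I. eval (g j) x * eval (s j) x) \<le> (\<Sum>j\<in>I. - N * (m j x)\<^sup>2 + 2 * h * \<bar>eval (g j) x\<bar>)"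
      by (intro sum_mono g_s x)
    moreover have "\<dots> = - N * (\<Sum>j\<in>I. (m j x)\<^sup>2) + 2 * h * (\<Sum>j\<in>I. \<bar>eval (g j) x\<bar>)"
      by (simp add: sum.distrib sum_distrib_left sum_negf sum_subtractf)
    moreover have "2 * h * (\<Sum>j\<in>I. \<bar>eval (g j) x\<bar>) \<le> 2 * h * B"
      using B(2)[OF x] h(1) by (intro mult_left_mono) auto
    ultimately have "(\<Sum>j\<in>I. eval (g j) x * eval (s j) x) < - N * (\<Sum>j\<in>I. (m j x)\<^sup>2) + d"
      using h(2) by linarith
    then show ?thesis
      using d(2)[OF x] by (simp add: r_def eval_simps pen_def algebra_simps power2_eq_square)
  qed
  then have "r \<in> sos_on ?O" by (rule positive_on_sphere_imp_sos_on)
  then have "r \<in> qm" by (rule sos_on_imp_qm)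
  moreover have "(\<Sum>j\<in>I. s j * g j) \<in> qm"
    by (intro qm_sum qm_mult ineq_imp_qm positive_on_sphere_imp_sos_on s_pos)
  moreover have "(\<Sum>j\<in>E. g j * (const (- N) * g j)) \<in> qm"
    by (intro qm_sum eq_mult_imp_qm)
  moreover have "p = r + (\<Sum>j\<in>I. s j * g j) + (\<Sum>j\<in>E. g j * (const (- N) * g j))"
    by (simp add: r_def const_uminus sum_distrib_left sum_negf algebra_simps)
  ultimately show ?thesis by (simp add: qm_add)
qed

section \<open>Membership of polynomials that have zeros\<close>

lemma sum_squares_eq_0:
  "finite L \<Longrightarrow> (\<Sum>l\<in>L. (eval (v l) x)\<^sup>2) = 0 \<longleftrightarrow> (\<forall>l\<in>L. eval (v l) x = 0)"
  by (simp add: sum_nonneg_eq_0_iff)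

lemma common_zeros_nbhd:
  assumes L: "finite L"
    and zeros: "\<And>x l. x \<in> feas \<Longrightarrow> \<forall>l\<in>L. eval (v l) x = 0 \<Longrightarrow> l \<in> L \<Longrightarrow> eval (r l) x > 0"
  shows "\<exists>e>0. \<forall>l\<in>L. \<forall>x\<in>feas. (\<Sum>l\<in>L. (eval (v l) x)\<^sup>2) < e \<longrightarrow> eval (r l) x > 0"
proof -
  define V where "V x = (\<Sum>l\<in>L. (eval (v l) x)\<^sup>2)" for x
  have "\<exists>e>0. \<forall>l\<in>L. \<forall>x\<in>feas. V x < e \<longrightarrow> eval (r l) x > 0"
  proof (rule finite_uniform_eps[OF L, of "\<lambda>l e. \<forall>x\<in>feas. V x < e \<longrightarrow> eval (r l) x > 0"])
    fix l assume "l \<in> L"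
    with zeros have *: "\<And>x. x \<in> feas \<Longrightarrow> V x = 0 \<Longrightarrow> eval (r l) x > 0"
      by (simp add: V_def sum_squares_eq_0[OF L])
    have "continuous_on feas (eval (r l))" "continuous_on feas V"
      unfolding V_def by (intro continuous_intros)+
    from compact_pos_near_zeros[OF compact_feas this]
    show "\<exists>e>0. \<forall>x\<in>feas. V x < e \<longrightarrow> eval (r l) x > 0"
      using * by (simp add: V_def sum_nonneg)
  qed auto
  then show ?thesis unfolding V_def .
qed

text \<open>The coefficients of \<open>P = \<Sum> v\<^sup>2 r\<close> are only determined up to syzygies. Replacing \<open>r\<close> by
  \<open>r (1 - t V) + t P\<close> with \<open>V = \<Sum> v\<^sup>2\<close> and \<open>t\<close> close to \<open>1 / max V e\<close> makes them positive everywhere.\<close>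

lemma weighted_squares_imp_qm:
  assumes L: "finite L" and P: "P = (\<Sum>l\<in>L. (v l)\<^sup>2 * r l)"
    and zeros: "\<And>x l. x \<in> feas \<Longrightarrow> \<forall>l\<in>L. eval (v l) x = 0 \<Longrightarrow> l \<in> L \<Longrightarrow> eval (r l) x > 0"
    and pos: "\<And>x l. x \<in> feas \<Longrightarrow> l \<in> L \<Longrightarrow> eval (v l) x \<noteq> 0 \<Longrightarrow> eval P x > 0"
  shows "P \<in> qm"
proof -
  define V where "V = (\<Sum>l\<in>L. (v l)\<^sup>2)"
  have V: "eval V x = (\<Sum>l\<in>L. (eval (v l) x)\<^sup>2)" for x
    by (simp add: V_def eval_simps)
  have V_nonneg: "eval V x \<ge> 0" for x by (simp add: V sum_nonneg)
  have "\<exists>e>0. \<forall>l\<in>L. \<forall>x\<in>feas. eval V x < e \<longrightarrow> eval (r l) x > 0"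
    unfolding V by (rule common_zeros_nbhd[OF L zeros])
  then obtain e where e: "e > 0" "\<And>l x. l \<in> L \<Longrightarrow> x \<in> feas \<Longrightarrow> eval V x < e \<Longrightarrow> eval (r l) x > 0"
    by blast
  have P_nonneg: "eval P x \<ge> 0" and P_pos: "eval V x \<noteq> 0 \<Longrightarrow> eval P x > 0" if "x \<in> feas" for x
  proof -
    show "eval V x \<noteq> 0 \<Longrightarrow> eval P x > 0"
      using pos[OF that] by (auto simp: V sum_squares_eq_0[OF L])
    moreover have "eval P x = 0" if "eval V x = 0"
      using that by (simp add: V sum_squares_eq_0[OF L] P eval_simps)
    ultimately show "eval P x \<ge> 0" by force
  qed
  define t0 where "t0 x = 1 / max (eval V x) e" for x
  have cont_t0: "continuous_on X t0" for X
    unfolding t0_def using e(1) by (intro continuous_intros) (auto simp: max_def)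
  define c where "c l x \<tau> = eval (r l) x * (1 - \<tau> * eval V x) + \<tau> * eval P x" for l x \<tau>
  \<comment> \<open>Where \<open>V\<close> is below \<open>e\<close>, the coefficient
    \<open>r l\<close> is positive and keeps the positive weight \<open>1 - t0 * V\<close>.
    Elsewhere \<open>t0 * V = 1\<close> and only a positive multiple of \<open>P\<close> is left,
    which is positive there.\<close>
  have c_pos: "c l x (t0 x) > 0" if "l \<in> L" "x \<in> feas" for l x
  proof (cases "eval V x < e")
    case True
    then have t0x: "t0 x = 1 / e" by (simp add: t0_def max_def)
    have "t0 x * eval V x < 1" "t0 x > 0"
      unfolding t0x using True e(1) by (simp_all add: divide_simps)
    then show ?thesis using e(2)[OF that True] P_nonneg[OF that(2)] unfolding c_def
      by (intro add_pos_nonneg mult_pos_pos mult_nonneg_nonneg) auto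
  next
    case False
    then have "t0 x * eval V x = 1" "t0 x > 0" using e(1) by (auto simp: t0_def max_def)
    then show ?thesis using P_pos[OF that(2)] False e(1) by (simp add: c_def)
  qed
  have "\<exists>h>0. \<forall>l\<in>L. \<forall>x\<in>feas. \<forall>\<tau>. \<bar>t0 x - \<tau>\<bar> < h \<longrightarrow> c l x \<tau> > 0"
  proof (rule finite_uniform_eps[OF L, of "\<lambda>l h. \<forall>x\<in>feas. \<forall>\<tau>. \<bar>t0 x - \<tau>\<bar> < h \<longrightarrow> c l x \<tau> > 0"])
    fix l assume l: "l \<in> L"
    have "continuous_on feas (\<lambda>x. c l x (t0 x))"
      unfolding c_def by (intro continuous_intros cont_t0)
    then have "\<exists>d>0. \<forall>x\<in>feas. d \<le> c l x (t0 x)"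
      by (intro compact_pos_lower_bound compact_feas c_pos l)
    then obtain d where d: "d > 0" "\<And>x. x \<in> feas \<Longrightarrow> d \<le> c l x (t0 x)" by blast
    have "\<exists>B>0. \<forall>x\<in>feas. \<bar>eval P x - eval (r l) x * eval V x\<bar> \<le> B"
      by (intro compact_upper_bound compact_feas continuous_intros)
    then obtain B where B: "B > 0" "\<And>x. x \<in> feas \<Longrightarrow> \<bar>eval P x - eval (r l) x * eval V x\<bar> \<le> B" by blast
    \<comment> \<open>In \<open>\<tau>\<close> the function \<open>c\<close> is affine with slope
      \<open>P - r * V\<close>, bounded by \<open>B\<close>, so a change below \<open>d / B\<close>
      costs less than the lower bound \<open>d\<close>.\<close>
    have "c l x \<tau> > 0" if "x \<in> feas" "\<bar>t0 x - \<tau>\<bar> < d / B" for x \<tau>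
    proof -
      have "c l x (t0 x) - c l x \<tau> = (t0 x - \<tau>) * (eval P x - eval (r l) x * eval V x)"
        by (simp add: c_def algebra_simps)
      also have "\<dots> \<le> \<bar>t0 x - \<tau>\<bar> * \<bar>eval P x - eval (r l) x * eval V x\<bar>"
        by (metis abs_ge_self abs_mult)
      also have "\<dots> \<le> \<bar>t0 x - \<tau>\<bar> * B" using B that(1) by (intro mult_left_mono) auto
      also have "\<dots> < d" using that(2) B(1) by (simp add: field_simps)
      finally show ?thesis using d(2)[OF that(1)] by linarith
    qed
    then show "\<exists>h>0. \<forall>x\<in>feas. \<forall>\<tau>. \<bar>t0 x - \<tau>\<bar> < h \<longrightarrow> c l x \<tau> > 0"
      using d B by (intro exI[of _ "d / B"]) auto
  qed auto
  then obtain h where h: "h > 0" "\<And>l x \<tau>. l \<in> L \<Longrightarrow> x \<in> feas \<Longrightarrow> \<bar>t0 x - \<tau>\<bar> < h \<Longrightarrow> c l x \<tau> > 0"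
    by blast
  obtain t where t: "\<And>x. x \<in> feas \<Longrightarrow> \<bar>t0 x - eval t x\<bar> < h"
    using Stone_Weierstrass_eval[OF compact_feas cont_t0 h(1)] by blast
  define r' where "r' l = r l * (1 - t * V) + t * P" for l
  have "r' l \<in> qm" if "l \<in> L" for l
    using h(2)[OF that] t by (intro positive_imp_qm) (simp add: r'_def c_def eval_simps)
  then have "(\<Sum>l\<in>L. (v l)\<^sup>2 * r' l) \<in> qm"
    by (intro qm_sum qm_mult sos_imp_sos_on sos_square)
  moreover have "(\<Sum>l\<in>L. (v l)\<^sup>2 * r' l) = (\<Sum>l\<in>L. (v l)\<^sup>2 * r l) * (1 - t * V) + (\<Sum>l\<in>L. (v l)\<^sup>2) * (t * P)"
    unfolding r'_def by (simp add: sum.distrib sum_distrib_right distrib_left mult.assoc)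
  moreover have "\<dots> = P"
    unfolding P[symmetric] V_def[symmetric] by (simp add: algebra_simps)
  ultimately show ?thesis by simp
qed

text \<open>The element \<open>a\<close> of the module carries only the fraction \<open>1 - V t \<ge> 0\<close> of its weight, which is
  negligible away from the zeros of \<open>V\<close>; the rest of it supports the coefficients of the squares.\<close>

theorem local_global_qm:
  assumes L: "finite L" and F: "F = a + (\<Sum>l\<in>L. (v l)\<^sup>2 * r l)" and a: "a \<in> qm"
    and zeros: "\<And>x l. x \<in> feas \<Longrightarrow> \<forall>l\<in>L. eval (v l) x = 0 \<Longrightarrow> l \<in> L \<Longrightarrow> eval (r l) x > 0"
    and pos: "\<And>x l. x \<in> feas \<Longrightarrow> l \<in> L \<Longrightarrow> eval (v l) x \<noteq> 0 \<Longrightarrow> eval F x > 0"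
  shows "F \<in> qm"
proof -
  let ?O = "sphere (0 :: real ^ 'm) 1"
  define V where "V = (\<Sum>l\<in>L. (v l)\<^sup>2)"
  have V: "eval V x = (\<Sum>l\<in>L. (eval (v l) x)\<^sup>2)" for x
    by (simp add: V_def eval_simps)
  have V_nonneg: "eval V x \<ge> 0" for x by (simp add: V sum_nonneg)
  have "\<exists>e>0. \<forall>l\<in>L. \<forall>x\<in>feas. eval V x < e \<longrightarrow> eval (r l) x > 0"
    unfolding V by (rule common_zeros_nbhd[OF L zeros])
  then obtain e where e: "e > 0" "\<And>l x. l \<in> L \<Longrightarrow> x \<in> feas \<Longrightarrow> eval V x < e \<Longrightarrow> eval (r l) x > 0"
    by blast
  have "closed {x. e \<le> eval V x}" by (intro closed_Collect_le continuous_intros)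
  then have Y: "compact (feas \<inter> {x. e \<le> eval V x})" by (rule compact_Int_closed[OF compact_feas])
  have "eval F x > 0" if "x \<in> feas \<inter> {x. e \<le> eval V x}" for x
  proof -
    have "x \<in> feas" "eval V x \<noteq> 0" using e(1) that by auto
    then show "eval F x > 0" using pos by (auto simp: V sum_squares_eq_0[OF L])
  qed
  then have "\<exists>m>0. \<forall>x\<in>feas \<inter> {x. e \<le> eval V x}. m \<le> eval F x"
    by (intro compact_pos_lower_bound Y continuous_on_eval continuous_on_id)
  then obtain m where m: "m > 0" "\<And>x. x \<in> feas \<Longrightarrow> e \<le> eval V x \<Longrightarrow> m \<le> eval F x" by blast
  have bound: "\<exists>B>0. \<forall>x\<in>?O. \<bar>eval q x\<bar> \<le> B" for q
    by (intro compact_upper_bound compact_sphere continuous_on_eval continuous_on_id)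
  obtain B where B: "B > 0" "\<And>x. x \<in> ?O \<Longrightarrow> \<bar>eval a x\<bar> \<le> B" using bound[of a] by blast
  obtain W where W: "W > 0" "\<And>x. x \<in> ?O \<Longrightarrow> \<bar>eval V x\<bar> \<le> W" using bound[of V] by blast
  \<comment> \<open>Where \<open>V \<ge> e\<close> the share of \<open>a\<close> that is left over
    will be below \<open>2 * k\<close>; it contributes at most \<open>2 * k * B\<close>, which is at
    most half of \<open>m\<close>. The bound 1/4 ensures \<open>k \<le> 1 - k\<close>.\<close>
  define k where "k = min (1/4) (m / (4 * B))"
  have k: "0 < k" "k \<le> 1/4" "k * (4 * B) \<le> m"
    using m(1) B(1) by (auto simp: k_def min_def field_simps)
  \<comment> \<open>With this error \<open>V * h < k\<close>, so \<open>V * t\<close> stays below 1;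
    and \<open>h\<close> is at most \<open>(1 - k) / (W + e)\<close>, a lower bound of
    \<open>t0\<close>, so \<open>t\<close> stays nonnegative.\<close>
  define h where "h = k / (W + e)"
  have h: "h > 0" using k W e by (simp add: h_def)
  define t0 where "t0 x = (1 - k) / max (eval V x) e" for x
  have cont_t0: "continuous_on ?O t0"
    unfolding t0_def using e(1) by (intro continuous_intros) (auto simp: max_def)
  obtain t where t: "\<And>x. x \<in> ?O \<Longrightarrow> \<bar>t0 x - eval t x\<bar> < h"
    using Stone_Weierstrass_eval[OF compact_sphere cont_t0 h] by blast
  have Vh: "eval V x * h < k" if "x \<in> ?O" for x
  proof -
    have "eval V x * h \<le> W * h" using W(2)[OF that] h by (intro mult_right_mono) auto
    also have "\<dots> < (W + e) * h" using e(1) h by (intro mult_strict_right_mono) auto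
    also have "\<dots> = k" using W(1) e(1) by (simp add: h_def)
    finally show ?thesis .
  qed
  have t_nonneg: "eval t x \<ge> 0" if "x \<in> ?O" for x
  proof -
    have "h \<le> (1 - k) / (W + e)" using k W e unfolding h_def by (intro divide_right_mono) auto
    also have "\<dots> \<le> t0 x"
      unfolding t0_def using W(2)[OF that] W(1) e(1) k by (intro divide_left_mono) (auto simp: max_def)
    finally show ?thesis using t[OF that] by linarith
  qed
  have Vt: "eval V x * eval t x < 1" if "x \<in> ?O" for x
  proof -
    have "eval V x * t0 x \<le> 1 - k"
    proof -
      have "eval V x / max (eval V x) e \<le> 1" using e(1) by (auto simp: max_def divide_simps)
      then have "(1 - k) * (eval V x / max (eval V x) e) \<le> (1 - k) * 1" using k by (intro mult_left_mono) auto
      then show ?thesis by (simp add: t0_def mult.commute)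
    qed
    moreover have "eval V x * eval t x \<le> eval V x * (t0 x + h)"
      using t[OF that] V_nonneg by (intro mult_left_mono) auto
    ultimately show ?thesis using Vh[OF that] by (simp add: algebra_simps)
  qed
  have Vt': "1 - eval V x * eval t x < 2 * k" if "x \<in> ?O" "e \<le> eval V x" for x
  proof -
    have "eval V x * t0 x = 1 - k" using that(2) e(1) by (simp add: t0_def max_def)
    moreover have "eval V x * eval t x \<ge> eval V x * (t0 x - h)"
      using t[OF that(1)] V_nonneg by (intro mult_left_mono) auto
    ultimately show ?thesis using Vh[OF that(1)] by (simp add: algebra_simps)
  qed
  \<comment> \<open>The part \<open>V * t * a\<close> is moved from \<open>a\<close> into the
    coefficients of the squares, where on \<open>feas\<close> it adds only nonnegative
    amounts.\<close>
  define P where "P = (\<Sum>l\<in>L. (v l)\<^sup>2 * (r l + t * a))"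
  have P_eq: "F = P + (1 - V * t) * a"
  proof -
    have "P = (\<Sum>l\<in>L. (v l)\<^sup>2 * r l) + V * (t * a)"
      by (simp add: P_def V_def sum.distrib sum_distrib_right distrib_left)
    then show ?thesis by (simp add: F algebra_simps)
  qed
  have ta: "eval t x * eval a x \<ge> 0" if "x \<in> feas" for x
    using that t_nonneg qm_nonneg[OF a] feas_subset by (intro mult_nonneg_nonneg) auto
  have "P \<in> qm"
  proof (rule weighted_squares_imp_qm[OF L P_def])
    fix x l assume "x \<in> feas" "\<forall>l\<in>L. eval (v l) x = 0" "l \<in> L"
    then show "eval (r l + t * a) x > 0"
      using zeros ta by (simp add: eval_simps add_pos_nonneg)
  next
    fix x l assume x: "x \<in> feas" and l: "l \<in> L" "eval (v l) x \<noteq> 0"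
    then have O: "x \<in> ?O" using feas_subset by blast
    show "eval P x > 0"
    proof (cases "eval V x < e")
      case True
      have *: "eval (r l') x + eval t x * eval a x > 0" if "l' \<in> L" for l'
        using e(2)[OF that x True] ta[OF x] by linarith
      have "(\<Sum>l\<in>L. (eval (v l) x)\<^sup>2 * (eval (r l) x + eval t x * eval a x)) > 0"
      proof (rule sum_pos2[OF L l(1)])
        show "(eval (v l) x)\<^sup>2 * (eval (r l) x + eval t x * eval a x) > 0" using l * by simp
        show "(eval (v l') x)\<^sup>2 * (eval (r l') x + eval t x * eval a x) \<ge> 0" if "l' \<in> L" for l'
          using *[OF that] by (intro mult_nonneg_nonneg) auto
      qed
      then show ?thesis by (simp add: P_def eval_simps)
    next
      case False
      have "(1 - eval V x * eval t x) * eval a x \<le> (2 * k) * B"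
        using Vt'[OF O] False B(2)[OF O] qm_nonneg[OF a x] k by (intro mult_mono) auto
      also have "\<dots> < m" using k m(1) by linarith
      also have "m \<le> eval F x" using m(2)[OF x] False by simp
      finally show ?thesis by (simp add: P_eq eval_simps)
    qed
  qed
  moreover have "(1 - V * t) * a \<in> qm"
    using Vt by (intro qm_mult a positive_on_sphere_imp_sos_on) (auto simp: eval_simps)
  ultimately show ?thesis unfolding P_eq by (rule qm_add)
qed

end

section \<open>Order of vanishing and Taylor expansion at a point\<close>

text \<open>Order of vanishing as a growth estimate: the rules for sums and products are immediate,
  without any Leibniz rule. The ball is compact, so every polynomial has order at least 0.\<close>

definition vanishes :: "real ^ 'n::finite \<Rightarrow> nat \<Rightarrow> 'n rpoly \<Rightarrow> bool" where
  "vanishes u k p \<longleftrightarrow> (\<exists>B. \<forall>x\<in>cball u 1. \<bar>eval p x\<bar> \<le> B * norm (x - u) ^ k)"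

lemma vanishesI: "(\<And>x. norm (x - u) \<le> 1 \<Longrightarrow> \<bar>eval p x\<bar> \<le> B * norm (x - u) ^ k) \<Longrightarrow> vanishes u k p"
  unfolding vanishes_def by (rule exI[of _ B]) (simp add: dist_norm norm_minus_commute)

lemma vanishesD:
  assumes "vanishes u k p"
  shows "\<exists>B>0. \<forall>x. norm (x - u) \<le> 1 \<longrightarrow> \<bar>eval p x\<bar> \<le> B * norm (x - u) ^ k"
proof -
  obtain B where B: "\<forall>x\<in>cball u 1. \<bar>eval p x\<bar> \<le> B * norm (x - u) ^ k"
    using assms unfolding vanishes_def by blast
  have "\<bar>eval p x\<bar> \<le> (\<bar>B\<bar> + 1) * norm (x - u) ^ k" if "norm (x - u) \<le> 1" for x
  proof -
    have "\<bar>eval p x\<bar> \<le> B * norm (x - u) ^ k"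
      using bspec[OF B, of x] that by (simp add: dist_norm norm_minus_commute)
    also have "\<dots> \<le> (\<bar>B\<bar> + 1) * norm (x - u) ^ k" by (intro mult_right_mono) auto
    finally show ?thesis .
  qed
  then show ?thesis by (intro exI[of _ "\<bar>B\<bar> + 1"]) auto
qed

lemma vanishes_0: "vanishes u 0 p"
proof -
  have "\<exists>B>0. \<forall>x\<in>cball u 1. \<bar>eval p x\<bar> \<le> B"
    by (intro compact_upper_bound compact_cball continuous_on_eval continuous_on_id)
  then obtain B where B: "\<And>x. x \<in> cball u 1 \<Longrightarrow> \<bar>eval p x\<bar> \<le> B" by blast
  show ?thesis by (rule vanishesI[of _ _ B]) (use B in \<open>simp add: dist_norm norm_minus_commute\<close>)
qed

lemma vanishes_mult:
  assumes "vanishes u k p" "vanishes u l q"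
  shows "vanishes u (k + l) (p * q)"
proof -
  obtain B where B: "B > 0" "\<And>x. norm (x - u) \<le> 1 \<Longrightarrow> \<bar>eval p x\<bar> \<le> B * norm (x - u) ^ k"
    using vanishesD[OF assms(1)] by blast
  obtain C where C: "C > 0" "\<And>x. norm (x - u) \<le> 1 \<Longrightarrow> \<bar>eval q x\<bar> \<le> C * norm (x - u) ^ l"
    using vanishesD[OF assms(2)] by blast
  show ?thesis
  proof (rule vanishesI)
    fix x assume x: "norm (x - u) \<le> 1"
    have "\<bar>eval p x\<bar> * \<bar>eval q x\<bar> \<le> (B * norm (x - u) ^ k) * (C * norm (x - u) ^ l)"
      using B(1) by (intro mult_mono B C x) auto
    then show "\<bar>eval (p * q) x\<bar> \<le> (B * C) * norm (x - u) ^ (k + l)"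
      by (simp add: eval_simps abs_mult power_add algebra_simps)
  qed
qed

lemma vanishes_mult_left: "vanishes u k q \<Longrightarrow> vanishes u k (p * q)"
  using vanishes_mult[OF vanishes_0] by fastforce

lemma vanishes_mult_right: "vanishes u k p \<Longrightarrow> vanishes u k (p * q)"
  using vanishes_mult_left[of u k p q] by (simp add: mult.commute)

lemma vanishes_add:
  assumes "vanishes u k p" "vanishes u k q"
  shows "vanishes u k (p + q)"
proof -
  obtain B where B: "B > 0" "\<And>x. norm (x - u) \<le> 1 \<Longrightarrow> \<bar>eval p x\<bar> \<le> B * norm (x - u) ^ k"
    using vanishesD[OF assms(1)] by blast
  obtain C where C: "C > 0" "\<And>x. norm (x - u) \<le> 1 \<Longrightarrow> \<bar>eval q x\<bar> \<le> C * norm (x - u) ^ k"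
    using vanishesD[OF assms(2)] by blast
  show ?thesis
  proof (rule vanishesI)
    fix x assume x: "norm (x - u) \<le> 1"
    show "\<bar>eval (p + q) x\<bar> \<le> (B + C) * norm (x - u) ^ k"
      using B(2)[OF x] C(2)[OF x] by (simp add: eval_simps algebra_simps)
  qed
qed

lemma vanishes_uminus: "vanishes u k p \<Longrightarrow> vanishes u k (- p)"
  by (simp add: vanishes_def eval_simps)

lemma vanishes_diff: "vanishes u k p \<Longrightarrow> vanishes u k q \<Longrightarrow> vanishes u k (p - q)"
  using vanishes_add[of u k p "- q"] vanishes_uminus by fastforce

lemma vanishes_zero_poly: "vanishes u k 0"
  by (rule vanishesI[of _ _ 0]) simp

lemma vanishes_sum: "(\<And>i. i \<in> A \<Longrightarrow> vanishes u k (f i)) \<Longrightarrow> vanishes u k (sum f A)"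
  by (induction A rule: infinite_finite_induct) (auto intro: vanishes_add vanishes_zero_poly)

lemma vanishes_mono:
  assumes "vanishes u l p" "k \<le> l"
  shows "vanishes u k p"
proof -
  obtain B where B: "B > 0" "\<And>x. norm (x - u) \<le> 1 \<Longrightarrow> \<bar>eval p x\<bar> \<le> B * norm (x - u) ^ l"
    using vanishesD[OF assms(1)] by blast
  have "B * norm (x - u) ^ l \<le> B * norm (x - u) ^ k" if "norm (x - u) \<le> 1" for x
    using that B(1) by (intro mult_left_mono power_decreasing assms) auto
  then show ?thesis using B(2) by (intro vanishesI[of _ _ B]) (blast intro: order_trans)
qed

lemma vanishes_imp_zero: "vanishes u k p \<Longrightarrow> k > 0 \<Longrightarrow> eval p u = 0"
  using vanishesD[of u k p] by (auto simp: power_0_left dest!: spec[of _ u])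

section \<open>Algebraic Taylor expansion\<close>

definition shift :: "real ^ 'n \<Rightarrow> 'n \<Rightarrow> 'n rpoly" where
  "shift u i = var i - const (u $ i)"

lemma eval_shift [simp]: "eval (shift u i) x = x $ i - u $ i"
  by (simp add: shift_def eval_simps)

lemma vanishes_shift: "vanishes u 1 (shift u i)"
  by (rule vanishesI[of _ _ 1]) (use component_le_norm_cart[of "_ - u" i] in simp)

text \<open>Hadamard's lemma for polynomials. Iterating it three times gives an expansion whose
  remainder has polynomial coefficients.\<close>

lemma taylor_1:
  fixes p :: "'n::finite rpoly"
  shows "\<exists>q. p = const (eval p u) + (\<Sum>i\<in>UNIV. shift u i * q i)"
proof (induction p rule: rpoly_induct)
  case (const a)
  show ?case by (intro exI[of _ "\<lambda>_. 0"]) simp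
next
  case (var i)
  have "(\<Sum>j\<in>UNIV. shift u j * (if j = i then 1 else 0)) = (\<Sum>j\<in>UNIV. if j = i then shift u j else 0)"
    by (intro sum.cong) auto
  then have "var i = const (eval (var i) u) + (\<Sum>j\<in>UNIV. shift u j * (if j = i then 1 else 0))"
    by (simp add: shift_def)
  then show ?case by (intro exI[of _ "\<lambda>j. if j = i then 1 else 0"])
next
  case (add p q)
  then obtain a b where "p = const (eval p u) + (\<Sum>i\<in>UNIV. shift u i * a i)"
    "q = const (eval q u) + (\<Sum>i\<in>UNIV. shift u i * b i)" by blast
  then have "p + q = const (eval p u) + (\<Sum>i\<in>UNIV. shift u i * a i) + (const (eval q u) + (\<Sum>i\<in>UNIV. shift u i * b i))"
    by simp
  then have "p + q = const (eval (p + q) u) + (\<Sum>i\<in>UNIV. shift u i * (a i + b i))"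
    by (simp add: eval_simps const_add sum.distrib algebra_simps)
  then show ?case by (intro exI[of _ "\<lambda>i. a i + b i"])
next
  case (mult p q)
  then obtain a b where ab: "p = const (eval p u) + (\<Sum>i\<in>UNIV. shift u i * a i)"
    "q = const (eval q u) + (\<Sum>i\<in>UNIV. shift u i * b i)" by blast
  have "(\<Sum>i\<in>UNIV. shift u i * (a i * q + const (eval p u) * b i)) =
      (\<Sum>i\<in>UNIV. shift u i * a i) * q + const (eval p u) * (\<Sum>i\<in>UNIV. shift u i * b i)"
    by (simp add: sum.distrib sum_distrib_left sum_distrib_right algebra_simps)
  also have "(\<Sum>i\<in>UNIV. shift u i * a i) = p - const (eval p u)"
    by (rule add_left_imp_eq[of "const (eval p u)"]) (simp only: ab(1)[symmetric], simp)
  also have "(\<Sum>i\<in>UNIV. shift u i * b i) = q - const (eval q u)"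
    by (rule add_left_imp_eq[of "const (eval q u)"]) (simp only: ab(2)[symmetric], simp)
  finally have "p * q = const (eval (p * q) u) + (\<Sum>i\<in>UNIV. shift u i * (a i * q + const (eval p u) * b i))"
    by (simp add: eval_simps const_mult algebra_simps)
  then show ?case by (intro exI[of _ "\<lambda>i. a i * q + const (eval p u) * b i"])
qed

lemma vanishes_1_iff: "vanishes u 1 p \<longleftrightarrow> eval p u = 0"
proof
  assume "eval p u = 0"
  with taylor_1[of p u] obtain q where "p = (\<Sum>i\<in>UNIV. shift u i * q i)" by auto
  then show "vanishes u 1 p" by (auto intro!: vanishes_sum vanishes_mult_right vanishes_shift[unfolded One_nat_def])
qed (use vanishes_imp_zero in force)

definition quad :: "real ^ 'n::finite \<Rightarrow> ('n \<Rightarrow> 'n \<Rightarrow> real) \<Rightarrow> 'n rpoly" where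
  "quad u A = (\<Sum>i\<in>UNIV. \<Sum>j\<in>UNIV. shift u i * shift u j * const (A i j))"

text \<open>The cube of the maximal ideal at \<open>u\<close>. The explicit triple sum is what
  \<open>vanishing_ideal_cube\<close> regroups into products of functions that vanish on the zero
  set.\<close>

definition cubic :: "real ^ 'n::finite \<Rightarrow> 'n rpoly set" where
  "cubic u = {\<Sum>i\<in>UNIV. \<Sum>j\<in>UNIV. \<Sum>k\<in>UNIV. shift u i * shift u j * shift u k * D i j k | D. True}"

lemma eval_quad: "eval (quad u A) x = (\<Sum>i\<in>UNIV. \<Sum>j\<in>UNIV. (x $ i - u $ i) * (x $ j - u $ j) * A i j)"
  by (simp add: quad_def eval_simps)

lemma vanishes_quad: "vanishes u 2 (quad u A)"
proof -
  have "vanishes u (1 + 1) (quad u A)"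
    unfolding quad_def by (intro vanishes_sum vanishes_mult_right vanishes_mult vanishes_shift)
  then show ?thesis by (simp add: numeral_2_eq_2)
qed

lemma vanishes_cubic: "p \<in> cubic u \<Longrightarrow> vanishes u 3 p"
proof -
  assume "p \<in> cubic u"
  then obtain D where p: "p = (\<Sum>i\<in>UNIV. \<Sum>j\<in>UNIV. \<Sum>k\<in>UNIV. shift u i * shift u j * shift u k * D i j k)"
    unfolding cubic_def by blast
  have "vanishes u (1 + 1 + 1) p"
    unfolding p by (intro vanishes_sum vanishes_mult_right vanishes_mult vanishes_shift)
  then show ?thesis by (simp add: numeral_3_eq_3)
qed

lemma taylor_3:
  fixes p :: "'n::finite rpoly"
  shows "\<exists>c b A r. r \<in> cubic u \<and> p = const c + (\<Sum>i\<in>UNIV. shift u i * const (b i)) + quad u A + r"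
proof -
  obtain q where q: "p = const (eval p u) + (\<Sum>i\<in>UNIV. shift u i * q i)" using taylor_1 by blast
  have "\<forall>i. \<exists>q'. q i = const (eval (q i) u) + (\<Sum>j\<in>UNIV. shift u j * q' j)" using taylor_1 by blast
  from choice[OF this] obtain q' where
    q': "\<And>i. q i = const (eval (q i) u) + (\<Sum>j\<in>UNIV. shift u j * q' i j)" by blast
  have "\<forall>i. \<exists>D. \<forall>j. q' i j = const (eval (q' i j) u) + (\<Sum>k\<in>UNIV. shift u k * D j k)"
    by (intro allI choice taylor_1)
  from choice[OF this] obtain D where
    D: "\<And>i j. q' i j = const (eval (q' i j) u) + (\<Sum>k\<in>UNIV. shift u k * D i j k)" by blast
  define b where "b i = eval (q i) u" for i
  define A where "A i j = eval (q' i j) u" for i j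
  define r where "r = (\<Sum>i\<in>UNIV. \<Sum>j\<in>UNIV. \<Sum>k\<in>UNIV. shift u i * shift u j * shift u k * D i j k)"
  have 1: "(\<Sum>i\<in>UNIV. shift u i * q i) =
    (\<Sum>i\<in>UNIV. shift u i * const (b i)) + (\<Sum>i\<in>UNIV. \<Sum>j\<in>UNIV. shift u i * shift u j * q' i j)"
    by (subst q') (simp add: b_def distrib_left sum.distrib sum_distrib_left mult.assoc)
  have 2: "(\<Sum>i\<in>UNIV. \<Sum>j\<in>UNIV. shift u i * shift u j * q' i j) = quad u A + r"
    by (subst D) (simp add: A_def quad_def r_def distrib_left sum.distrib sum_distrib_left mult.assoc)
  have "p = const (eval p u) + (\<Sum>i\<in>UNIV. shift u i * const (b i)) + quad u A + r"
    by (subst q, subst 1, subst 2) (simp only: add.assoc)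
  moreover have "r \<in> cubic u" unfolding r_def cubic_def by blast
  ultimately show ?thesis by blast
qed

lemma nonneg_perturbation:
  fixes b M :: real
  assumes "0 < r" "\<And>t. 0 < t \<Longrightarrow> t < r \<Longrightarrow> 0 \<le> b + t * M"
  shows "0 \<le> b"
proof (rule ccontr)
  assume "\<not> 0 \<le> b"
  then have b: "b < 0" by simp
  define t where "t = min (r / 2) (- b / (2 * (\<bar>M\<bar> + 1)))"
  have t: "0 < t" "t < r" using b assms(1) by (auto simp: t_def divide_neg_pos)
  have "t * M \<le> t * (\<bar>M\<bar> + 1)" using t by (intro mult_left_mono) auto
  also have "\<dots> \<le> - b / (2 * (\<bar>M\<bar> + 1)) * (\<bar>M\<bar> + 1)" unfolding t_def by (intro mult_right_mono) auto
  also have "\<dots> = - b / 2" by (simp add: field_simps)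
  finally show False using assms(2)[OF t] b by simp
qed

text \<open>Along a ray \<open>u + t *\<^sub>R v\<close> with a unit vector \<open>v\<close>, the
  coefficient of \<open>t\<close> must be nonnegative for \<open>v\<close> and for
  \<open>- v\<close>, hence zero, and then the coefficient of \<open>t\<^sup>2\<close> must be at
  least \<open>d\<close>. The constant \<open>d\<close> may be negative, as it is in
  \<open>vanishes_3_imp_cubic\<close>.\<close>

lemma lower_bound_imp_quad:
  fixes p :: "'n::finite rpoly"
  assumes p0: "eval p u = 0" and r: "r > 0"
    and lower: "\<And>x. norm (x - u) < r \<Longrightarrow> d * (norm (x - u))\<^sup>2 \<le> eval p x"
  shows "\<exists>A. p - quad u A \<in> cubic u \<and>
    (\<forall>v. d * (norm v)\<^sup>2 \<le> (\<Sum>i\<in>UNIV. \<Sum>j\<in>UNIV. v $ i * v $ j * A i j))"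
proof -
  obtain c b A q where q: "q \<in> cubic u"
    and p: "p = const c + (\<Sum>i\<in>UNIV. shift u i * const (b i)) + quad u A + q"
    using taylor_3[of u p] by blast
  obtain B where B: "B > 0" "\<And>x. norm (x - u) \<le> 1 \<Longrightarrow> \<bar>eval q x\<bar> \<le> B * norm (x - u) ^ 3"
    using vanishesD[OF vanishes_cubic[OF q]] by blast
  have "eval q u = 0" using vanishes_imp_zero[OF vanishes_cubic[OF q]] by simp
  then have c: "c = 0" using p0 by (simp add: p eval_simps eval_quad)
  define lin where "lin v = (\<Sum>i\<in>UNIV. v $ i * b i)" for v :: "real ^ 'n"
  define Q where "Q v = (\<Sum>i\<in>UNIV. \<Sum>j\<in>UNIV. v $ i * v $ j * A i j)" for v :: "real ^ 'n"
  have lower': "d * t\<^sup>2 \<le> t * lin v + t\<^sup>2 * Q v + B * t ^ 3" if v: "norm v = 1" and t: "0 < t" "t < min r 1" for v t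
  proof -
    have "eval p (u + t *\<^sub>R v) = t * lin v + t\<^sup>2 * Q v + eval q (u + t *\<^sub>R v)"
      by (simp add: p c eval_simps eval_quad lin_def Q_def sum_distrib_left power2_eq_square algebra_simps)
    moreover have "\<bar>eval q (u + t *\<^sub>R v)\<bar> \<le> B * t ^ 3"
      using B(2)[of "u + t *\<^sub>R v"] v t by simp
    moreover have "d * t\<^sup>2 \<le> eval p (u + t *\<^sub>R v)"
      using lower[of "u + t *\<^sub>R v"] v t by simp
    ultimately show ?thesis by linarith
  qed
  have lin_nonneg: "0 \<le> lin v" if v: "norm v = 1" for v
  proof (rule nonneg_perturbation[of "min r 1" _ "Q v + B - d"])
    fix t :: real assume t: "0 < t" "t < min r 1"
    have "B * t ^ 3 \<le> B * t\<^sup>2" using t B(1) by (intro mult_left_mono power_decreasing) auto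
    then have "0 \<le> t * lin v + t\<^sup>2 * Q v + B * t\<^sup>2 - d * t\<^sup>2" using lower'[OF v t] by linarith
    also have "\<dots> = t * (lin v + t * (Q v + B - d))" by (simp add: power2_eq_square algebra_simps)
    finally show "0 \<le> lin v + t * (Q v + B - d)" using t(1) by (simp add: zero_le_mult_iff)
  qed (use r in simp)
  have lin_0: "lin v = 0" if v: "norm v = 1" for v
    using lin_nonneg[OF v] lin_nonneg[of "- v"] v by (simp add: lin_def sum_negf)
  have "b i = 0" for i
  proof -
    have "lin (axis i 1) = (\<Sum>j\<in>UNIV. if j = i then b j else 0)"
      unfolding lin_def by (intro sum.cong) (auto simp: axis_def)
    then show ?thesis using lin_0[of "axis i 1"] by simp
  qed
  then have b: "b = (\<lambda>_. 0)" by blast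
  have "p - quad u A \<in> cubic u" using q by (simp add: p c b)
  moreover have "d * (norm v)\<^sup>2 \<le> Q v" for v
  proof -
    have unit: "d \<le> Q v" if v: "norm v = 1" for v
    proof -
      have "0 \<le> Q v - d"
      proof (rule nonneg_perturbation[of "min r 1" _ B])
        fix t :: real assume t: "0 < t" "t < min r 1"
        have "0 \<le> t\<^sup>2 * Q v + B * t ^ 3 - d * t\<^sup>2" using lower'[OF v t] lin_0[OF v] by simp
        also have "\<dots> = t\<^sup>2 * (Q v - d + t * B)" by (simp add: power2_eq_square power3_eq_cube algebra_simps)
        finally show "0 \<le> Q v - d + t * B" using t(1) by (simp add: zero_le_mult_iff)
      qed (use r in simp)
      then show ?thesis by simp
    qed
    show ?thesis
    proof (cases "v = 0")
      case False
      have "(norm v)\<^sup>2 * d \<le> (norm v)\<^sup>2 * Q (v /\<^sub>R norm v)"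
        using False by (intro mult_left_mono unit) auto
      also have "\<dots> = (\<Sum>i\<in>UNIV. \<Sum>j\<in>UNIV. (norm v * (v /\<^sub>R norm v) $ i) * (norm v * (v /\<^sub>R norm v) $ j) * A i j)"
        unfolding Q_def by (simp add: sum_distrib_left power2_eq_square algebra_simps)
      also have "\<dots> = Q v" unfolding Q_def using False by (simp add: field_simps)
      finally show ?thesis by (simp add: mult.commute)
    qed (simp add: Q_def)
  qed
  ultimately show ?thesis unfolding Q_def by blast
qed

text \<open>A third-order bound is in particular a quadratic lower bound, which removes the constant
  and the linear term. The remaining quadratic form is homogeneous of degree 2 and of third order at
  \<open>u\<close>, hence zero.\<close>

lemma vanishes_3_imp_cubic:
  fixes p :: "'n::finite rpoly"
  assumes "vanishes u 3 p"
  shows "p \<in> cubic u"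
proof -
  obtain B where B: "B > 0" "\<And>x. norm (x - u) \<le> 1 \<Longrightarrow> \<bar>eval p x\<bar> \<le> B * norm (x - u) ^ 3"
    using vanishesD[OF assms] by blast
  have p0: "eval p u = 0" using vanishes_imp_zero[OF assms] by simp
  have bound: "(- B) * (norm (x - u))\<^sup>2 \<le> eval p x" if x: "norm (x - u) < 1" for x
  proof -
    have "B * norm (x - u) ^ 3 \<le> B * (norm (x - u))\<^sup>2" using x B(1) by (intro mult_left_mono power_decreasing) auto
    then show ?thesis using B(2)[of x] x by simp
  qed
  obtain A where A: "p - quad u A \<in> cubic u" using lower_bound_imp_quad[OF p0 zero_less_one bound] by blast
  have "vanishes u 3 (p - (p - quad u A))"
    by (intro vanishes_diff assms vanishes_cubic A)
  from vanishesD[OF this]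
  obtain C where C: "C > 0" "\<And>x. norm (x - u) \<le> 1 \<Longrightarrow> \<bar>eval (quad u A) x\<bar> \<le> C * norm (x - u) ^ 3"
    by auto
  have nonneg: "0 \<le> s * eval (quad u A) (u + v)" if s: "\<bar>s\<bar> = 1" for s v
  proof (cases "v = 0")
    case False
    show ?thesis
    proof (rule nonneg_perturbation[of "1 / norm v" _ "C * norm v ^ 3"])
      fix t assume t: "0 < t" "t < 1 / norm v"
      have "eval (quad u A) (u + t *\<^sub>R v) = t\<^sup>2 * eval (quad u A) (u + v)"
        by (simp add: eval_quad sum_distrib_left power2_eq_square algebra_simps)
      moreover have "\<bar>s * eval (quad u A) (u + t *\<^sub>R v)\<bar> \<le> C * (t * norm v) ^ 3"
        using C(2)[of "u + t *\<^sub>R v"] t False s by (simp add: abs_mult field_simps)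
      ultimately have "0 \<le> t\<^sup>2 * (s * eval (quad u A) (u + v)) + C * (t * norm v) ^ 3"
        by (simp add: algebra_simps)
      also have "\<dots> = t\<^sup>2 * (s * eval (quad u A) (u + v) + t * (C * norm v ^ 3))"
        by (simp add: power2_eq_square power3_eq_cube algebra_simps)
      finally show "0 \<le> s * eval (quad u A) (u + v) + t * (C * norm v ^ 3)"
        using t(1) by (simp add: zero_le_mult_iff)
    qed (use False in simp)
  qed (simp add: eval_quad)
  have "eval (quad u A) x = 0" for x
    using nonneg[of 1 "x - u"] nonneg[of "-1" "x - u"] by simp
  then have "quad u A = 0" by (intro eval_eq_0_imp_eq_0)
  then show ?thesis using A by simp
qed

section \<open>Positive definite quadratic forms are sums of squares\<close>

text \<open>One step of Lagrange's diagonalization. The matrix may be asymmetric, so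
  \<open>s j\<close> uses the mean of \<open>A i j\<close> and \<open>A j i\<close>.\<close>

lemma complete_square:
  fixes y :: "'i \<Rightarrow> 'n rpoly" and A :: "'i \<Rightarrow> 'i \<Rightarrow> real"
  assumes X: "finite X" "i \<notin> X" and Aii: "A i i \<noteq> 0"
  defines "s \<equiv> \<lambda>j. (A i j + A j i) / (2 * A i i)"
  shows "(\<Sum>j\<in>insert i X. \<Sum>k\<in>insert i X. y j * y k * const (A j k)) =
    const (A i i) * (y i + (\<Sum>j\<in>X. const (s j) * y j))\<^sup>2 +
    (\<Sum>j\<in>X. \<Sum>k\<in>X. y j * y k * const (A j k - A i i * s j * s k))"
proof -
  define l where "l = (\<Sum>j\<in>X. const (s j) * y j)"
  have cross: "(\<Sum>j\<in>X. y i * y j * const (A i j)) + (\<Sum>j\<in>X. y j * y i * const (A j i)) =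
      (const (A i i) + const (A i i)) * (y i * l)"
  proof -
    have s: "const (A i j) + const (A j i) = (const (A i i) + const (A i i)) * (const (s j) :: 'n rpoly)" for j
      using Aii by (simp add: s_def flip: const_add const_mult)
    have "y i * y j * const (A i j) + y j * y i * const (A j i) = (y i * y j) * (const (A i j) + const (A j i))" for j
      by (simp add: algebra_simps)
    also have "(y i * y j) * (const (A i j) + const (A j i)) = (const (A i i) + const (A i i)) * (y i * (const (s j) * y j))" for j
      unfolding s[of j] by (simp add: algebra_simps)
    finally have "y i * y j * const (A i j) + y j * y i * const (A j i) =
        (const (A i i) + const (A i i)) * (y i * (const (s j) * y j))" for j .
    then show ?thesis by (simp add: l_def sum_distrib_left flip: sum.distrib)
  qed
  have "(\<Sum>j\<in>X. \<Sum>k\<in>X. y j * y k * const (A i i * s j * s k)) = const (A i i) * (l * l)"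
    by (simp add: l_def sum_product sum_distrib_left const_mult algebra_simps)
  then have rest: "(\<Sum>j\<in>X. \<Sum>k\<in>X. y j * y k * const (A j k - A i i * s j * s k)) =
      (\<Sum>j\<in>X. \<Sum>k\<in>X. y j * y k * const (A j k)) - const (A i i) * (l * l)"
    by (simp add: const_diff right_diff_distrib sum_subtractf)
  have "(\<Sum>j\<in>insert i X. \<Sum>k\<in>insert i X. y j * y k * const (A j k)) =
     y i * y i * const (A i i) + ((\<Sum>j\<in>X. y i * y j * const (A i j)) + (\<Sum>j\<in>X. y j * y i * const (A j i)))
       + (\<Sum>j\<in>X. \<Sum>k\<in>X. y j * y k * const (A j k))"
    using X by (simp add: sum.distrib algebra_simps)
  then show ?thesis
    unfolding cross rest l_def[symmetric] by (simp add: power2_eq_square algebra_simps)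
qed

lemma positive_definite_form_sos:
  fixes y :: "'i \<Rightarrow> 'n::finite rpoly"
  assumes "finite X"
    and "\<And>v. \<exists>i\<in>X. v i \<noteq> (0::real) \<Longrightarrow> (\<Sum>j\<in>X. \<Sum>k\<in>X. v j * v k * A j k) > 0"
  shows "(\<Sum>j\<in>X. \<Sum>k\<in>X. y j * y k * const (A j k)) \<in> sos"
  using assms
proof (induction X arbitrary: A rule: finite_induct)
  case (insert i X)
  have "(\<Sum>j\<in>insert i X. \<Sum>k\<in>insert i X. (if j = i then 1 else 0) * (if k = i then 1 else 0) * A j k) = A i i"
    using insert.hyps by (simp add: sum.neutral)
  then have Aii: "A i i > 0" using insert.prems[of "\<lambda>j. if j = i then 1 else 0"] by auto
  define s where "s j = (A i j + A j i) / (2 * A i i)" for j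
  note square = complete_square[where A = A, OF insert.hyps, folded s_def]
  have "(\<Sum>j\<in>X. \<Sum>k\<in>X. v j * v k * (A j k - A i i * s j * s k)) > 0" if "\<exists>i\<in>X. v i \<noteq> 0" for v
  proof -
    \<comment> \<open>The entry at \<open>i\<close> makes the completed square vanish, so positivity
      of the full form passes to its Schur complement.\<close>
    define w where "w = v(i := - (\<Sum>j\<in>X. s j * v j))"
    have w: "w j = v j" if "j \<in> X" for j using that insert.hyps by (auto simp: w_def)
    have "0 < (\<Sum>j\<in>insert i X. \<Sum>k\<in>insert i X. w j * w k * A j k)"
      using that w by (intro insert.prems) auto
    \<comment> \<open>\<open>complete_square\<close> is an identity of polynomials; inserting
      constant polynomials and evaluating at 0 gives its real instance.\<close>
    also have "\<dots> = eval (\<Sum>j\<in>insert i X. \<Sum>k\<in>insert i X. const (w j) * const (w k) * const (A j k) :: 'n rpoly) 0"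
      by (simp add: eval_simps)
    also have "\<dots> = A i i * (w i + (\<Sum>j\<in>X. s j * w j))\<^sup>2 + (\<Sum>j\<in>X. \<Sum>k\<in>X. w j * w k * (A j k - A i i * s j * s k))"
      using Aii by (subst square) (simp_all add: eval_simps)
    also have "(\<Sum>j\<in>X. \<Sum>k\<in>X. w j * w k * (A j k - A i i * s j * s k)) =
        (\<Sum>j\<in>X. \<Sum>k\<in>X. v j * v k * (A j k - A i i * s j * s k))"
      by (intro sum.cong refl) (simp add: w)
    also have "w i + (\<Sum>j\<in>X. s j * w j) = 0" using w by (simp add: w_def)
    finally show ?thesis by simp
  qed
  then have "(\<Sum>j\<in>X. \<Sum>k\<in>X. y j * y k * const (A j k - A i i * s j * s k)) \<in> sos"
    by (rule insert.IH)
  then show ?case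
    using Aii by (subst square) (auto intro!: sos_add sos_mult sos_const sos_square)
qed simp

lemma quad_sos:
  assumes "d > 0" "\<And>v. d * (norm v)\<^sup>2 \<le> (\<Sum>i\<in>UNIV. \<Sum>j\<in>UNIV. v $ i * v $ j * A i j)"
  shows "quad u A \<in> sos"
  unfolding quad_def
proof (rule positive_definite_form_sos)
  fix v :: "'a \<Rightarrow> real" assume "\<exists>i\<in>UNIV. v i \<noteq> 0"
  then have "(\<chi> i. v i) \<noteq> 0" by (auto simp: vec_eq_iff)
  then have "0 < d * (norm (\<chi> i. v i))\<^sup>2" using assms(1) by simp
  also have "\<dots> \<le> (\<Sum>i\<in>UNIV. \<Sum>j\<in>UNIV. v i * v j * A i j)" using assms(2)[of "\<chi> i. v i"] by simp
  finally show "(\<Sum>i\<in>UNIV. \<Sum>j\<in>UNIV. v i * v j * A i j) > 0" .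
qed simp

section \<open>Nonnegative polynomials with nondegenerate zeros\<close>

text \<open>Second-order sufficiency without derivatives. Growth holds in all directions, not only
  tangential ones, and it tolerates third-order changes as well as small second-order ones.\<close>

definition quad_pos :: "real ^ 'n::finite \<Rightarrow> 'n rpoly \<Rightarrow> bool" where
  "quad_pos u p \<longleftrightarrow> (\<exists>d>0. \<exists>r>0. \<forall>x. norm (x - u) < r \<longrightarrow> d * (norm (x - u))\<^sup>2 \<le> eval p x)"

lemma quad_pos_mono:
  assumes "quad_pos u p" "r > 0" "\<And>x. norm (x - u) < r \<Longrightarrow> eval p x \<le> eval q x"
  shows "quad_pos u q"
proof -
  obtain d r' where d: "d > 0" "r' > 0" "\<forall>x. norm (x - u) < r' \<longrightarrow> d * (norm (x - u))\<^sup>2 \<le> eval p x"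
    using assms(1) unfolding quad_pos_def by blast
  then have "\<forall>x. norm (x - u) < min r r' \<longrightarrow> d * (norm (x - u))\<^sup>2 \<le> eval q x"
    using assms(3) by (meson min_less_iff_conj order_trans)
  then show ?thesis unfolding quad_pos_def using d(1,2) assms(2)
    by (intro exI[of _ d] conjI exI[of _ "min r r'"]) auto
qed

lemma quad_pos_add:
  assumes "quad_pos u p" "vanishes u 3 q"
  shows "quad_pos u (p + q)"
proof -
  obtain d r where d: "d > 0" "r > 0" "\<And>x. norm (x - u) < r \<Longrightarrow> d * (norm (x - u))\<^sup>2 \<le> eval p x"
    using assms(1) unfolding quad_pos_def by blast
  obtain B where B: "B > 0" "\<And>x. norm (x - u) \<le> 1 \<Longrightarrow> \<bar>eval q x\<bar> \<le> B * norm (x - u) ^ 3"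
    using vanishesD[OF assms(2)] by blast
  \<comment> \<open>Within radius \<open>d / (2 * B)\<close> the cubic error is at most half of the
    quadratic growth.\<close>
  let ?r = "min r (min 1 (d / (2 * B)))"
  have "d / 2 * (norm (x - u))\<^sup>2 \<le> eval (p + q) x" if x: "norm (x - u) < ?r" for x
  proof -
    have "B * norm (x - u) \<le> d / 2" using x B(1) by (simp add: field_simps)
    then have "(B * norm (x - u)) * (norm (x - u))\<^sup>2 \<le> d / 2 * (norm (x - u))\<^sup>2"
      by (intro mult_right_mono) auto
    moreover have "\<bar>eval q x\<bar> \<le> (B * norm (x - u)) * (norm (x - u))\<^sup>2"
      using B(2)[of x] x by (simp add: power2_eq_square power3_eq_cube mult.assoc)
    ultimately show ?thesis using d(3)[of x] x by (simp add: eval_simps)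
  qed
  then show ?thesis unfolding quad_pos_def using d(1,2) B(1)
    by (intro exI[of _ "d / 2"] conjI exI[of _ ?r]) auto
qed

text \<open>All smaller \<open>e'\<close> are covered so that \<open>finite_uniform_eps\<close> can
  choose one constant for finitely many points.\<close>

lemma quad_pos_diff_small:
  assumes "quad_pos u p" "vanishes u 2 q"
  shows "\<exists>e>0. \<forall>e'. 0 < e' \<longrightarrow> e' \<le> e \<longrightarrow> quad_pos u (p - const e' * q)"
proof -
  obtain d r where d: "d > 0" "r > 0" "\<And>x. norm (x - u) < r \<Longrightarrow> d * (norm (x - u))\<^sup>2 \<le> eval p x"
    using assms(1) unfolding quad_pos_def by blast
  obtain B where B: "B > 0" "\<And>x. norm (x - u) \<le> 1 \<Longrightarrow> \<bar>eval q x\<bar> \<le> B * norm (x - u) ^ 2"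
    using vanishesD[OF assms(2)] by blast
  have "quad_pos u (p - const e' * q)" if e': "0 < e'" "e' \<le> d / (2 * B)" for e'
  proof -
    have "d / 2 * (norm (x - u))\<^sup>2 \<le> eval (p - const e' * q) x" if x: "norm (x - u) < min r 1" for x
    proof -
      have "e' * \<bar>eval q x\<bar> \<le> (d / (2 * B)) * (B * (norm (x - u))\<^sup>2)"
        using e' B(2)[of x] x by (intro mult_mono) auto
      moreover have "e' * eval q x \<le> e' * \<bar>eval q x\<bar>" using e'(1) by (intro mult_left_mono) auto
      ultimately have "e' * eval q x \<le> d / 2 * (norm (x - u))\<^sup>2"
        using B(1) by simp
      then show ?thesis using d(3)[of x] x by (simp add: eval_simps)
    qed
    then show ?thesis unfolding quad_pos_def using d(1,2)
      by (intro exI[of _ "d / 2"] conjI exI[of _ "min r 1"]) auto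
  qed
  then show ?thesis using d(1) B(1) by (intro exI[of _ "d / (2 * B)"]) auto
qed

lemma quad_pos_imp_quad:
  assumes "quad_pos u p" "eval p u = 0"
  shows "\<exists>A. p - quad u A \<in> cubic u \<and> quad u A \<in> sos"
proof -
  obtain d r where d: "d > 0" "r > 0" "\<And>x. norm (x - u) < r \<Longrightarrow> d * (norm (x - u))\<^sup>2 \<le> eval p x"
    using assms(1) unfolding quad_pos_def by blast
  from lower_bound_imp_quad[OF assms(2) d(2,3)] obtain A where
    "p - quad u A \<in> cubic u" "\<And>v. d * (norm v)\<^sup>2 \<le> (\<Sum>i\<in>UNIV. \<Sum>j\<in>UNIV. v $ i * v $ j * A i j)"
    by blast
  with quad_sos[OF d(1)] show ?thesis by blast
qed

section \<open>Interpolation at finitely many points\<close>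

definition bump :: "(real ^ 'n) set \<Rightarrow> real ^ 'n \<Rightarrow> 'n::finite rpoly" where
  "bump Z u = (\<Prod>w\<in>Z - {u}. const (1 / (norm (u - w))\<^sup>2) * (\<Sum>i\<in>UNIV. (shift w i)\<^sup>2))"

lemma eval_sum_shift_squares: "eval (\<Sum>i\<in>UNIV. (shift w i)\<^sup>2) x = (norm (x - w))\<^sup>2"
  by (simp add: eval_simps norm_vec_def L2_set_def sum_nonneg)

lemma eval_bump_self: "eval (bump Z u) u = 1"
  by (auto simp: bump_def eval_prod eval_mult eval_sum_shift_squares intro!: prod.neutral split: if_splits)

lemma vanishes_bump:
  assumes "finite Z" "w \<in> Z" "w \<noteq> u"
  shows "vanishes w 2 (bump Z u)"
proof -
  have "vanishes w (1 + 1) (\<Sum>i\<in>UNIV. shift w i * shift w i)"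
    by (intro vanishes_sum vanishes_mult vanishes_shift)
  then have "vanishes w 2 (\<Sum>i\<in>UNIV. (shift w i)\<^sup>2)"
    by (simp add: numeral_2_eq_2 power2_eq_square)
  with assms show ?thesis
    unfolding bump_def by (subst prod.remove[of _ w]) (simp_all add: vanishes_mult_right vanishes_mult_left)
qed

text \<open>Equal to \<open>1 - (1 - b)\<^sup>2\<close> for \<open>b = bump Z u\<close>: the value 1
  at \<open>u\<close> is now attained to second order, and the second-order zeros at the other
  points are kept.\<close>

definition flat_bump :: "(real ^ 'n) set \<Rightarrow> real ^ 'n \<Rightarrow> 'n::finite rpoly" where
  "flat_bump Z u = bump Z u * (2 - bump Z u)"

lemma vanishes_flat_bump: "finite Z \<Longrightarrow> w \<in> Z \<Longrightarrow> w \<noteq> u \<Longrightarrow> vanishes w 2 (flat_bump Z u)"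
  unfolding flat_bump_def by (intro vanishes_mult_right vanishes_bump)

lemma vanishes_1_diff_flat_bump: "vanishes u 2 (flat_bump Z u - 1)"
proof -
  have "vanishes u 1 (1 - bump Z u)"
    unfolding vanishes_1_iff by (simp add: eval_simps eval_bump_self)
  then have "vanishes u (1 + 1) ((1 - bump Z u) * (1 - bump Z u))" by (intro vanishes_mult)
  then have "vanishes u 2 (- ((1 - bump Z u) * (1 - bump Z u)))"
    by (intro vanishes_uminus) (simp add: numeral_2_eq_2)
  also have "- ((1 - bump Z u) * (1 - bump Z u)) = flat_bump Z u - 1"
    by (simp add: flat_bump_def algebra_simps)
  finally show ?thesis .
qed

lemma interpolation:
  assumes Z: "finite Z"
  shows "\<exists>P. \<forall>u\<in>Z. vanishes u 2 (P - p u)"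
proof (intro exI ballI)
  fix u assume u: "u \<in> Z"
  have "(\<Sum>w\<in>Z. p w * flat_bump Z w) - p u = p u * (flat_bump Z u - 1) + (\<Sum>w\<in>Z - {u}. p w * flat_bump Z w)"
    using Z u by (simp add: sum.remove[of _ u] algebra_simps)
  also have "vanishes u 2 \<dots>"
    using Z u by (intro vanishes_add vanishes_sum vanishes_mult_left vanishes_1_diff_flat_bump vanishes_flat_bump) auto
  finally show "vanishes u 2 ((\<Sum>w\<in>Z. p w * flat_bump Z w) - p u)" .
qed

text \<open>The weights are squares of \<open>flat_bump\<close>, so the interpolant stays a sum of
  squares. They vanish to fourth order at the other points, and at \<open>u\<close> both
  \<open>?f u - 1\<close> and the quadratic form have order 2.\<close>

lemma interpolation_quad:
  assumes Z: "finite Z" and A: "\<And>u. u \<in> Z \<Longrightarrow> quad u (A u) \<in> sos"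
  shows "\<exists>Q\<in>sos. \<forall>u\<in>Z. vanishes u 3 (Q - quad u (A u))"
proof (intro bexI ballI)
  let ?f = "\<lambda>u. flat_bump Z u * flat_bump Z u"
  have "?f u \<in> sos" for u using sos_square[of "flat_bump Z u"] by (simp add: power2_eq_square)
  then show "(\<Sum>u\<in>Z. ?f u * quad u (A u)) \<in> sos"
    by (rule sos_sum[OF sos_mult[OF _ A]])
  fix u assume u: "u \<in> Z"
  have f: "vanishes u 2 (?f u - 1)"
  proof -
    have "vanishes u 2 ((flat_bump Z u - 1) * (flat_bump Z u + 1))"
      by (intro vanishes_mult_right vanishes_1_diff_flat_bump)
    then show ?thesis by (simp add: algebra_simps)
  qed
  have "vanishes u (2 + 2) (?f w)" if "w \<in> Z - {u}" for w
    using that Z u by (intro vanishes_mult vanishes_flat_bump) auto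
  moreover have "vanishes u (2 + 2) ((?f u - 1) * quad u (A u))"
    by (intro vanishes_mult f vanishes_quad)
  ultimately have "vanishes u (2 + 2) ((?f u - 1) * quad u (A u) + (\<Sum>w\<in>Z - {u}. ?f w * quad w (A w)))"
    by (intro vanishes_add vanishes_sum vanishes_mult_right[of u _ "?f _"])
  also have "(?f u - 1) * quad u (A u) + (\<Sum>w\<in>Z - {u}. ?f w * quad w (A w)) =
      (\<Sum>u\<in>Z. ?f u * quad u (A u)) - quad u (A u)"
    using Z u by (simp add: sum.remove[of _ u] algebra_simps)
  finally show "vanishes u 3 ((\<Sum>u\<in>Z. ?f u * quad u (A u)) - quad u (A u))"
    by (rule vanishes_mono) simp
qed

text \<open>Every term of the binomial expansion contains \<open>a ^ k\<close> or
  \<open>b ^ m\<close>. The purpose is that elements with sum 1, each having a power in an ideal,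
  force 1 into the ideal.\<close>

lemma radical_add:
  fixes a b :: "'a::comm_ring_1"
  assumes add: "\<And>p q. p \<in> J \<Longrightarrow> q \<in> J \<Longrightarrow> p + q \<in> J" and mult: "\<And>p q. p \<in> J \<Longrightarrow> q * p \<in> J"
    and a: "a ^ k \<in> J" and b: "b ^ m \<in> J"
  shows "(a + b) ^ (k + m) \<in> J"
proof -
  have zero: "0 \<in> J" using mult[OF a, of 0] by simp
  have sum: "sum f A \<in> J" if "\<And>i. i \<in> A \<Longrightarrow> f i \<in> J" for f and A :: "nat set"
    using that by (induction A rule: infinite_finite_induct) (auto intro: zero add)
  have "of_nat (k + m choose i) * a ^ i * b ^ (k + m - i) \<in> J" if "i \<le> k + m" for i
  proof (cases "k \<le> i")
    case True
    then have "a ^ i = a ^ (i - k) * a ^ k" by (simp flip: power_add)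
    then have "of_nat (k + m choose i) * a ^ i * b ^ (k + m - i) =
        (of_nat (k + m choose i) * a ^ (i - k) * b ^ (k + m - i)) * a ^ k" by (simp add: algebra_simps)
    then show ?thesis using mult[OF a] by simp
  next
    case False
    then have "b ^ (k + m - i) = b ^ (k - i) * b ^ m" by (simp flip: power_add)
    then have "of_nat (k + m choose i) * a ^ i * b ^ (k + m - i) =
        (of_nat (k + m choose i) * a ^ i * b ^ (k - i)) * b ^ m" by (simp add: algebra_simps)
    then show ?thesis using mult[OF b] by simp
  qed
  then show ?thesis unfolding binomial_ring by (intro sum) auto
qed

lemma radical_sum:
  fixes f :: "'b \<Rightarrow> 'a::comm_ring_1"
  assumes add: "\<And>p q. p \<in> J \<Longrightarrow> q \<in> J \<Longrightarrow> p + q \<in> J" and mult: "\<And>p q. p \<in> J \<Longrightarrow> q * p \<in> J"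
    and "finite A" "0 \<in> J" "\<And>a. a \<in> A \<Longrightarrow> \<exists>k. f a ^ k \<in> J"
  shows "\<exists>k. (sum f A) ^ k \<in> J"
  using assms(3-)
proof (induction A rule: finite_induct)
  case empty
  then show ?case by (intro exI[of _ 1]) simp
next
  case (insert a A)
  then obtain k m where "f a ^ k \<in> J" "(sum f A) ^ m \<in> J" by blast
  then have "(f a + sum f A) ^ (k + m) \<in> J" by (intro radical_add add mult)
  then show ?case using insert.hyps by auto
qed

text \<open>The ideal \<open>J\<close> of multipliers into the cube of the vanishing ideal contains the cubes of the
  functions \<open>bump Z u\<close> and of \<open>1 - \<Sum> bump Z u\<close>, whose sum is \<open>1\<close>. Polarization turns products into squares.\<close>

lemma vanishing_ideal_cube:
  fixes Z :: "(real ^ 'n::finite) set"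
  assumes Z: "finite Z"
  shows "\<exists>(L :: ('n rpoly \<times> 'n rpoly \<times> bool) set) v. finite L \<and>
    (\<forall>x. x \<in> Z \<longleftrightarrow> (\<forall>l\<in>L. eval (v l) x = 0)) \<and>
    (\<forall>R. (\<forall>u\<in>Z. vanishes u 3 R) \<longrightarrow>
      (\<exists>r. R = (\<Sum>l\<in>L. (v l)\<^sup>2 * r l) \<and> (\<forall>l\<in>L. \<forall>u\<in>Z. eval (r l) u = 0)))"
proof -
  define \<nu> where "\<nu> = 1 - (\<Sum>u\<in>Z. bump Z u)"
  define W where "W = insert \<nu> ((\<lambda>(u, i). bump Z u * shift u i) ` (Z \<times> UNIV))"
  \<comment> \<open>The Boolean selects the sum or the difference of two elements of
    \<open>W\<close>, as needed for
    \<open>4 * a * b = (a + b)\<^sup>2 - (a - b)\<^sup>2\<close>.\<close>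
  define L :: "('n rpoly \<times> 'n rpoly \<times> bool) set" where "L = W \<times> W \<times> UNIV"
  define v :: "'n rpoly \<times> 'n rpoly \<times> bool \<Rightarrow> 'n rpoly" where
    "v = (\<lambda>(a, b, s). if s then a + b else a - b)"
  have "finite W" using Z by (simp add: W_def)
  then have L: "finite L" by (simp add: L_def)
  have bump_other: "eval (bump Z u) w = 0" if "w \<in> Z" "w \<noteq> u" for u w
    using vanishes_imp_zero[OF vanishes_bump[OF Z that]] by simp
  have \<nu>_zero: "eval \<nu> u = 0" if "u \<in> Z" for u
  proof -
    have "(\<Sum>w\<in>Z - {u}. eval (bump Z w) u) = 0" by (intro sum.neutral ballI bump_other[OF that]) auto
    then show ?thesis using Z that by (simp add: \<nu>_def eval_simps sum.remove[of _ u] eval_bump_self)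
  qed
  have bump_shift_zero: "eval (bump Z u * shift u i) w = 0" if "w \<in> Z" for u w i
    using bump_other[OF that, of u] by (cases "w = u") (simp_all add: eval_simps)
  have W_zero: "eval w u = 0" if "w \<in> W" "u \<in> Z" for w u
    using that \<nu>_zero bump_shift_zero by (auto simp: W_def)
  have zeros: "x \<in> Z \<longleftrightarrow> (\<forall>l\<in>L. eval (v l) x = 0)" for x
  proof
    assume "x \<in> Z"
    then show "\<forall>l\<in>L. eval (v l) x = 0" using W_zero by (auto simp: L_def v_def eval_simps)
  next
    \<comment> \<open>If \<open>\<nu>\<close> vanishes at \<open>x\<close>, some
      \<open>bump Z u\<close> does not, and then the products \<open>bump Z u * shift u i\<close>
      force \<open>x = u\<close>.\<close>
    assume *: "\<forall>l\<in>L. eval (v l) x = 0"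
    have W0: "eval w x = 0" if "w \<in> W" for w
      using *[rule_format, of "(w, w, True)"] that by (simp add: L_def v_def eval_simps)
    from W0[of \<nu>] have "(\<Sum>u\<in>Z. eval (bump Z u) x) = 1" by (simp add: W_def \<nu>_def eval_simps)
    then have "\<not> (\<forall>u\<in>Z. eval (bump Z u) x = 0)" using sum.neutral[of Z "\<lambda>u. eval (bump Z u) x"] by fastforce
    then obtain u where u: "u \<in> Z" "eval (bump Z u) x \<noteq> 0" by blast
    have "x $ i = u $ i" for i
    proof -
      have "bump Z u * shift u i \<in> W" using u(1) by (auto simp: W_def intro!: image_eqI[of _ _ "(u, i)"])
      from W0[OF this] show ?thesis using u(2) by (simp add: eval_simps)
    qed
    then have "x = u" by (simp add: vec_eq_iff)
    then show "x \<in> Z" using u(1) by simp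
  qed
  define N where "N = {\<Sum>l\<in>L. (v l)\<^sup>2 * r l | r. \<forall>l\<in>L. \<forall>u\<in>Z. eval (r l) u = 0}"
  have N_add: "p + q \<in> N" if "p \<in> N" "q \<in> N" for p q
  proof -
    obtain r r' where "p = (\<Sum>l\<in>L. (v l)\<^sup>2 * r l)" "q = (\<Sum>l\<in>L. (v l)\<^sup>2 * r' l)"
      "\<forall>l\<in>L. \<forall>u\<in>Z. eval (r l) u = 0" "\<forall>l\<in>L. \<forall>u\<in>Z. eval (r' l) u = 0"
      using \<open>p \<in> N\<close> \<open>q \<in> N\<close> unfolding N_def by blast
    then show ?thesis unfolding N_def
      by (intro CollectI exI[of _ "\<lambda>l. r l + r' l"]) (simp add: sum.distrib distrib_left eval_simps)
  qed
  have N_mult: "q * p \<in> N" if "p \<in> N" for p q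
  proof -
    obtain r where "p = (\<Sum>l\<in>L. (v l)\<^sup>2 * r l)" "\<forall>l\<in>L. \<forall>u\<in>Z. eval (r l) u = 0"
      using \<open>p \<in> N\<close> unfolding N_def by blast
    then show ?thesis unfolding N_def
      by (intro CollectI exI[of _ "\<lambda>l. q * r l"]) (simp add: sum_distrib_left eval_simps algebra_simps)
  qed
  have N_0: "0 \<in> N" unfolding N_def by (intro CollectI exI[of _ "\<lambda>_. 0"]) simp
  have N_sum: "sum f A \<in> N" if "\<And>i. i \<in> A \<Longrightarrow> f i \<in> N" for f and A :: "'n set"
    using that by (induction A rule: infinite_finite_induct) (auto intro: N_0 N_add)
  have N_square: "(v l)\<^sup>2 * z \<in> N" if "l \<in> L" "\<forall>u\<in>Z. eval z u = 0" for l z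
  proof -
    have "(\<Sum>l'\<in>L. (v l')\<^sup>2 * (if l' = l then z else 0)) = (\<Sum>l'\<in>L. if l' = l then (v l')\<^sup>2 * z else 0)"
      by (intro sum.cong) auto
    also have "\<dots> = (v l)\<^sup>2 * z" using L that(1) by simp
    finally show ?thesis unfolding N_def using that(2)
      by (intro CollectI exI[of _ "\<lambda>l'. if l' = l then z else 0"]) auto
  qed
  have N_prod: "a * b * z \<in> N" if "a \<in> W" "b \<in> W" "\<forall>u\<in>Z. eval z u = 0" for a b z
  proof -
    have "(v (a, b, True))\<^sup>2 * (const (1/4) * z) + (- 1) * ((v (a, b, False))\<^sup>2 * (const (1/4) * z)) \<in> N"
      using that by (intro N_add N_mult N_square) (auto simp: L_def eval_simps)
    also have "(v (a, b, True))\<^sup>2 * (const (1/4) * z) + (- 1) * ((v (a, b, False))\<^sup>2 * (const (1/4) * z)) =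
        (const (1/4) + const (1/4) + const (1/4) + const (1/4)) * (a * b * z)"
      by (simp add: v_def power2_eq_square algebra_simps)
    also have "\<dots> = a * b * z" by (simp flip: const_add)
    finally show ?thesis .
  qed
  have "\<exists>r. R = (\<Sum>l\<in>L. (v l)\<^sup>2 * r l) \<and> (\<forall>l\<in>L. \<forall>u\<in>Z. eval (r l) u = 0)"
    if R: "\<forall>u\<in>Z. vanishes u 3 R" for R
  proof -
    define J where "J = {e. e * R \<in> N}"
    have J_add: "p + q \<in> J" if "p \<in> J" "q \<in> J" for p q
      using that N_add by (simp add: J_def distrib_right)
    have J_mult: "q * p \<in> J" if "p \<in> J" for p q
      using that N_mult[of "p * R" q] by (simp add: J_def mult.assoc)
    have "\<nu> * \<nu> * (\<nu> * R) \<in> N" using \<nu>_zero by (intro N_prod) (auto simp: W_def eval_simps)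
    then have \<nu>: "\<nu> ^ 3 \<in> J" by (simp add: J_def power3_eq_cube mult.assoc)
    have bump: "(bump Z u) ^ 3 \<in> J" if u: "u \<in> Z" for u
    proof -
      obtain D where D: "R = (\<Sum>i\<in>UNIV. \<Sum>j\<in>UNIV. \<Sum>k\<in>UNIV. shift u i * shift u j * shift u k * D i j k)"
        using vanishes_3_imp_cubic[OF R[rule_format, OF u]] unfolding cubic_def by blast
      \<comment> \<open>The three factors \<open>bump Z u\<close> are shared out among the three
        shifts: two of the resulting factors are elements of \<open>W\<close>, and the third
        vanishes on \<open>Z\<close>, as \<open>N_prod\<close> demands.\<close>
      have "(\<Sum>i\<in>UNIV. \<Sum>j\<in>UNIV. \<Sum>k\<in>UNIV.
          (bump Z u * shift u i) * (bump Z u * shift u j) * (bump Z u * shift u k * D i j k)) \<in> N"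
      proof (intro N_sum N_prod)
        show "\<forall>w\<in>Z. eval (bump Z u * shift u k * D i j k) w = 0" for i j k
          using bump_shift_zero by (metis eval_mult mult_zero_left)
      qed (use u in \<open>auto simp: W_def\<close>)
      also have "(\<Sum>i\<in>UNIV. \<Sum>j\<in>UNIV. \<Sum>k\<in>UNIV.
          (bump Z u * shift u i) * (bump Z u * shift u j) * (bump Z u * shift u k * D i j k)) = bump Z u ^ 3 * R"
        unfolding D by (simp add: sum_distrib_left power3_eq_cube algebra_simps)
      finally show ?thesis by (simp add: J_def)
    qed
    have "\<exists>k. (sum (bump Z) Z) ^ k \<in> J"
      by (rule radical_sum[of J, OF J_add J_mult Z]) (use bump N_0 in \<open>auto simp: J_def\<close>)
    then obtain k where "(sum (bump Z) Z) ^ k \<in> J" ..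
    with \<nu> have "(\<nu> + sum (bump Z) Z) ^ (3 + k) \<in> J" by (intro radical_add[of J] J_add J_mult)
    then have "R \<in> N" by (simp add: \<nu>_def J_def)
    then show ?thesis unfolding N_def by blast
  qed
  with L zeros show ?thesis by blast
qed

lemma compact_isolated_finite:
  fixes S :: "'a::real_normed_vector set"
  assumes "compact S" and iso: "\<And>u. u \<in> S \<Longrightarrow> \<exists>r>0. \<forall>x\<in>S. norm (x - u) < r \<longrightarrow> x = u"
  shows "finite S"
proof -
  have "\<forall>u\<in>S. \<exists>r>0. \<forall>x\<in>S. norm (x - u) < r \<longrightarrow> x = u" using iso by blast
  from bchoice[OF this] obtain r where r: "\<forall>u\<in>S. r u > 0 \<and> (\<forall>x\<in>S. norm (x - u) < r u \<longrightarrow> x = u)" ..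
  have "S \<subseteq> (\<Union>u\<in>S. ball u (r u))" using r by force
  then obtain D where D: "D \<subseteq> S" "finite D" "S \<subseteq> (\<Union>u\<in>D. ball u (r u))"
    using compactE_image[OF assms(1), of S "\<lambda>u. ball u (r u)"] by blast
  have "S \<subseteq> D"
  proof
    fix x assume x: "x \<in> S"
    then obtain u where u: "u \<in> D" "x \<in> ball u (r u)" using D(3) by blast
    then have "norm (x - u) < r u" by (simp add: dist_norm norm_minus_commute)
    with r D(1) u(1) x have "x = u" by blast
    with u(1) show "x \<in> D" by simp
  qed
  with D(2) show ?thesis by (rule rev_finite_subset)
qed

section \<open>Nondegenerate zeros\<close>

context sphere_problem
begin

definition active :: "real ^ 'm \<Rightarrow> 'j set" where
  "active u = {j \<in> I. eval (g j) u = 0}"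

text \<open>The quadratic penalty makes up for the directions transversal to the active constraints,
  in which the Lagrangian itself may decrease.\<close>

definition aug_lagrangian :: "'m rpoly \<Rightarrow> ('j \<Rightarrow> real) \<Rightarrow> real \<Rightarrow> real ^ 'm \<Rightarrow> 'm rpoly" where
  "aug_lagrangian F lam C u = F - (\<Sum>j\<in>E. const (lam j) * g j) - (\<Sum>j\<in>active u. const (lam j) * g j)
     + const C * ((\<Sum>j\<in>E. (g j)\<^sup>2) + (\<Sum>j\<in>active u. (g j)\<^sup>2))"

definition nondegenerate :: "'m rpoly \<Rightarrow> real ^ 'm \<Rightarrow> bool" where
  "nondegenerate F u \<longleftrightarrow> (\<exists>lam C. (\<forall>j\<in>active u. lam j > 0) \<and> quad_pos u (aug_lagrangian F lam C u))"

lemma finite_active: "finite (active u)"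
  using finite_I by (simp add: active_def)

text \<open>On \<open>feas\<close> the equality terms vanish, and each active term is
  \<open>g * (lam - C * g)\<close>, nonnegative near \<open>u\<close> because \<open>lam\<close> is
  positive. Hence \<open>F\<close> dominates the augmented Lagrangian there.\<close>

lemma nondegenerate_isolated:
  assumes u: "u \<in> feas" and nd: "nondegenerate F u"
  shows "\<exists>r>0. \<forall>x\<in>feas. norm (x - u) < r \<longrightarrow> x \<noteq> u \<longrightarrow> eval F x > 0"
proof -
  obtain lam C where lam: "\<forall>j\<in>active u. lam j > 0" and qp: "quad_pos u (aug_lagrangian F lam C u)"
    using nd unfolding nondegenerate_def by blast
  obtain d r where d: "d > 0" "r > 0"
    "\<And>x. norm (x - u) < r \<Longrightarrow> d * (norm (x - u))\<^sup>2 \<le> eval (aug_lagrangian F lam C u) x"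
    using qp unfolding quad_pos_def by blast
  have "\<exists>e>0. \<forall>j\<in>active u. \<forall>x. norm (x - u) < e \<longrightarrow> C * eval (g j) x \<le> lam j"
  proof (rule finite_uniform_eps[OF finite_active])
    fix j assume j: "j \<in> active u"
    then have "vanishes u 1 (const C * g j)"
      unfolding vanishes_1_iff by (simp add: active_def eval_simps)
    from vanishesD[OF this] obtain B where
      B: "B > 0" "\<And>x. norm (x - u) \<le> 1 \<Longrightarrow> \<bar>C * eval (g j) x\<bar> \<le> B * norm (x - u)"
      by (auto simp: eval_simps)
    have "C * eval (g j) x \<le> lam j" if x: "norm (x - u) < min 1 (lam j / B)" for x
    proof -
      have "B * norm (x - u) \<le> lam j" using x B(1) by (simp add: field_simps)
      then show ?thesis using B(2)[of x] x by simp
    qed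
    then show "\<exists>e>0. \<forall>x. norm (x - u) < e \<longrightarrow> C * eval (g j) x \<le> lam j"
      using lam j B(1) by (intro exI[of _ "min 1 (lam j / B)"]) auto
  qed auto
  then obtain e where e: "e > 0" "\<And>j x. j \<in> active u \<Longrightarrow> norm (x - u) < e \<Longrightarrow> C * eval (g j) x \<le> lam j"
    by blast
  have "eval F x > 0" if x: "x \<in> feas" "norm (x - u) < min r e" "x \<noteq> u" for x
  proof -
    have E0: "eval (g j) x = 0" if "j \<in> E" for j using x(1) that by (auto simp: feas_def feasible_set_def)
    have I0: "eval (g j) x \<ge> 0" if "j \<in> I" for j using x(1) that by (auto simp: feas_def feasible_set_def)
    have "0 < d * (norm (x - u))\<^sup>2" using d(1) x(3) by simp
    also have "\<dots> \<le> eval (aug_lagrangian F lam C u) x" using d(3) x(2) by simp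
    also have "\<dots> = eval F x - (\<Sum>j\<in>active u. eval (g j) x * (lam j - C * eval (g j) x))"
      by (simp add: aug_lagrangian_def eval_simps E0 sum_distrib_left sum_subtractf power2_eq_square algebra_simps)
    finally have "0 < eval F x - (\<Sum>j\<in>active u. eval (g j) x * (lam j - C * eval (g j) x))" .
    moreover have "(\<Sum>j\<in>active u. eval (g j) x * (lam j - C * eval (g j) x)) \<ge> 0"
      using e(2) x(2) I0 by (intro sum_nonneg mult_nonneg_nonneg) (auto simp: active_def)
    ultimately show ?thesis by linarith
  qed
  then show ?thesis using d(2) e(1) by (intro exI[of _ "min r e"]) auto
qed

text \<open>Prescribing first-order jets of the multipliers at all zeros at once produces one module
  element \<open>a\<close> for which \<open>F - a\<close> agrees with an augmented Lagrangian up to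
  third order at every zero. The rest splits into a sum of squares with the right Hessians and a
  polynomial to which \<open>vanishing_ideal_cube\<close> applies.\<close>

theorem nondegenerate_zeros_imp_qm:
  assumes nonneg: "\<And>x. x \<in> feas \<Longrightarrow> eval F x \<ge> 0"
    and nd: "\<And>u. u \<in> feas \<Longrightarrow> eval F u = 0 \<Longrightarrow> nondegenerate F u"
  shows "F \<in> qm"
proof -
  define Z where "Z = feas \<inter> {x. eval F x = 0}"
  have Z_feas: "u \<in> feas" and Z_zero: "eval F u = 0" if "u \<in> Z" for u
    using that by (auto simp: Z_def)
  have "compact Z"
    unfolding Z_def by (intro compact_Int_closed compact_feas closed_Collect_eq continuous_intros)
  then have Z: "finite Z"
  proof (rule compact_isolated_finite)
    fix u assume u: "u \<in> Z"
    from nondegenerate_isolated[OF Z_feas[OF u] nd[OF Z_feas[OF u] Z_zero[OF u]]]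
    show "\<exists>r>0. \<forall>x\<in>Z. norm (x - u) < r \<longrightarrow> x = u"
      using Z_feas Z_zero by (metis less_irrefl)
  qed
  have "\<forall>u. \<exists>lam C. u \<in> Z \<longrightarrow> (\<forall>j\<in>active u. lam j > 0) \<and> quad_pos u (aug_lagrangian F lam C u)"
    using nd Z_feas Z_zero unfolding nondegenerate_def by blast
  from choice[OF this] obtain lam where
    "\<forall>u. \<exists>C. u \<in> Z \<longrightarrow> (\<forall>j\<in>active u. lam u j > 0) \<and> quad_pos u (aug_lagrangian F (lam u) C u)" ..
  from choice[OF this] obtain C where
    lam: "\<And>u j. u \<in> Z \<Longrightarrow> j \<in> active u \<Longrightarrow> lam u j > 0" and
    qp: "\<And>u. u \<in> Z \<Longrightarrow> quad_pos u (aug_lagrangian F (lam u) (C u) u)" by blast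
  have g_vanishes: "vanishes u 1 (g j)" if "u \<in> Z" "j \<in> E \<or> j \<in> active u" for u j
    using Z_feas[OF that(1)] that(2) unfolding vanishes_1_iff
    by (auto simp: active_def feas_def feasible_set_def)

  text \<open>The square of \<open>sqrt \<lambda> - (C / (2 sqrt \<lambda>)) g\<close> times \<open>g\<close> is \<open>\<lambda> g - C g\<^sup>2\<close> up to third order.\<close>
  define ps where "ps j u = (if j \<in> active u
      then const (sqrt (lam u j)) - const (\<bar>C u\<bar> / (2 * sqrt (lam u j))) * g j else 0)" for j u
  define pq where "pq j u = const (lam u j) - const \<bar>C u\<bar> * g j" for j u
  have "\<forall>j. \<exists>s. \<forall>u\<in>Z. vanishes u 2 (s - ps j u)" using interpolation[OF Z] by blast
  from choice[OF this] obtain s where s: "\<And>j u. u \<in> Z \<Longrightarrow> vanishes u 2 (s j - ps j u)" by blast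
  have "\<forall>j. \<exists>q. \<forall>u\<in>Z. vanishes u 2 (q - pq j u)" using interpolation[OF Z] by blast
  from choice[OF this] obtain q where q: "\<And>j u. u \<in> Z \<Longrightarrow> vanishes u 2 (q j - pq j u)" by blast
  define a where "a = (\<Sum>j\<in>I. (s j)\<^sup>2 * g j) + (\<Sum>j\<in>E. g j * q j)"
  have a_qm: "a \<in> qm"
    unfolding a_def
    by (intro qm_add qm_sum qm_mult ineq_imp_qm eq_mult_imp_qm sos_imp_sos_on sos_square)
  define t where "t j u = (if j \<in> active u then const (lam u j) * g j - const \<bar>C u\<bar> * (g j)\<^sup>2 else 0)" for j u
  have s_t: "vanishes u 3 ((s j)\<^sup>2 * g j - t j u)" if u: "u \<in> Z" for j u
  proof (cases "j \<in> active u")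
    case True
    note l = lam[OF u True]
    have 1: "vanishes u (2 + 1) ((s j - ps j u) * ((s j + ps j u) * g j))"
      using u True by (intro vanishes_mult vanishes_mult_left s g_vanishes) auto
    define K where "K = \<bar>C u\<bar> / (2 * sqrt (lam u j))"
    have 2: "vanishes u (1 + 1 + 1) (const (K * K) * (g j * g j * g j))"
      using u True by (intro vanishes_mult_left vanishes_mult g_vanishes) auto
    have "sqrt (lam u j) * sqrt (lam u j) = lam u j" "sqrt (lam u j) \<noteq> 0" using l by auto
    then have c: "const (sqrt (lam u j)) * const (sqrt (lam u j)) = (const (lam u j) :: 'm rpoly)"
      "const (sqrt (lam u j)) * const K + const (sqrt (lam u j)) * const K
        = (const \<bar>C u\<bar> :: 'm rpoly)"
      by (simp_all add: K_def flip: const_mult const_add)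
    have "(ps j u)\<^sup>2 * g j = (const (sqrt (lam u j)) * const (sqrt (lam u j))) * g j
       - (const (sqrt (lam u j)) * const K + const (sqrt (lam u j)) * const K) * (g j)\<^sup>2
       + const (K * K) * (g j * g j * g j)"
      using True by (simp add: ps_def K_def[symmetric] power2_eq_square const_mult algebra_simps)
    then have 3: "(ps j u)\<^sup>2 * g j = t j u + const (K * K) * (g j * g j * g j)"
      unfolding c using True by (simp add: t_def)
    have "(s j)\<^sup>2 * g j - t j u = (s j - ps j u) * ((s j + ps j u) * g j) + ((ps j u)\<^sup>2 * g j - t j u)"
      by (simp add: power2_eq_square algebra_simps)
    also have "\<dots> = (s j - ps j u) * ((s j + ps j u) * g j) +
        const (K * K) * (g j * g j * g j)"
      unfolding 3 by simp
    finally show ?thesis using vanishes_add[of u 3] 1 2 by (simp add: numeral_3_eq_3)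
  next
    case False
    \<comment> \<open>At a zero where \<open>j\<close> is inactive, \<open>s j\<close> interpolates
      0, so its square vanishes to fourth order.\<close>
    then have "vanishes u (2 + 2) (s j * s j * g j)"
      using s[OF u, of j] by (intro vanishes_mult_right vanishes_mult) (auto simp: ps_def)
    then show ?thesis using False by (auto simp: t_def power2_eq_square intro: vanishes_mono)
  qed
  have q_t: "vanishes u 3 (g j * q j - (const (lam u j) * g j - const \<bar>C u\<bar> * (g j)\<^sup>2))"
    if "u \<in> Z" "j \<in> E" for j u
  proof -
    have "vanishes u (2 + 1) ((q j - pq j u) * g j)"
      using that by (intro vanishes_mult q g_vanishes) auto
    then have "vanishes u 3 ((q j - pq j u) * g j)" by (rule vanishes_mono) simp
    then show ?thesis by (simp add: pq_def power2_eq_square algebra_simps)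
  qed
  have F1: "quad_pos u (F - a)" if u: "u \<in> Z" for u
  proof -
    let ?D = "(\<Sum>j\<in>I. (s j)\<^sup>2 * g j - t j u) + (\<Sum>j\<in>E. g j * q j - (const (lam u j) * g j - const \<bar>C u\<bar> * (g j)\<^sup>2))"
    have "quad_pos u (aug_lagrangian F (lam u) \<bar>C u\<bar> u)"
    proof (rule quad_pos_mono[OF qp[OF u] zero_less_one])
      fix x
      have "C u * ((\<Sum>j\<in>E. (eval (g j) x)\<^sup>2) + (\<Sum>j\<in>active u. (eval (g j) x)\<^sup>2)) \<le>
          \<bar>C u\<bar> * ((\<Sum>j\<in>E. (eval (g j) x)\<^sup>2) + (\<Sum>j\<in>active u. (eval (g j) x)\<^sup>2))"
        by (intro mult_right_mono add_nonneg_nonneg sum_nonneg) auto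
      then show "eval (aug_lagrangian F (lam u) (C u) u) x \<le> eval (aug_lagrangian F (lam u) \<bar>C u\<bar> u) x"
        by (simp add: aug_lagrangian_def eval_simps)
    qed
    moreover have "vanishes u 3 ?D" using u by (intro vanishes_add vanishes_sum s_t q_t)
    ultimately have "quad_pos u (aug_lagrangian F (lam u) \<bar>C u\<bar> u + (- ?D))" by (intro quad_pos_add vanishes_uminus)
    also have "(\<Sum>j\<in>I. t j u) = (\<Sum>j\<in>active u. const (lam u j) * g j - const \<bar>C u\<bar> * (g j)\<^sup>2)"
      unfolding t_def active_def using finite_I by (simp add: sum.inter_filter)
    then have "aug_lagrangian F (lam u) \<bar>C u\<bar> u + (- ?D) = F - a"
      by (simp add: aug_lagrangian_def a_def sum_subtractf sum.distrib sum_distrib_left algebra_simps)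
    finally show ?thesis .
  qed
  from vanishing_ideal_cube[OF Z] obtain L :: "('m rpoly \<times> 'm rpoly \<times> bool) set" and v where
    L: "finite L" and zeros: "\<And>x. x \<in> Z \<longleftrightarrow> (\<forall>l\<in>L. eval (v l) x = 0)" and
    cube: "\<And>R. \<forall>u\<in>Z. vanishes u 3 R \<Longrightarrow> \<exists>r. R = (\<Sum>l\<in>L. (v l)\<^sup>2 * r l) \<and> (\<forall>l\<in>L. \<forall>u\<in>Z. eval (r l) u = 0)"
    by blast
  define V where "V = (\<Sum>l\<in>L. (v l)\<^sup>2)"
  have V: "vanishes u 2 V" if "u \<in> Z" for u
  proof -
    have "vanishes u 1 (v l)" if "l \<in> L" for l
      using zeros[of u] \<open>u \<in> Z\<close> that unfolding vanishes_1_iff by blast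
    then have "vanishes u (1 + 1) V"
      unfolding V_def power2_eq_square by (intro vanishes_sum vanishes_mult)
    then show ?thesis by (simp add: numeral_2_eq_2)
  qed
  \<comment> \<open>The part \<open>e * V\<close> of the growth is set aside. It later supplies the
    constant in the coefficients \<open>r l + const e\<close>, whose first summand vanishes on
    \<open>Z\<close>.\<close>
  have "\<exists>e>0. \<forall>u\<in>Z. \<forall>e'. 0 < e' \<longrightarrow> e' \<le> e \<longrightarrow> quad_pos u (F - a - const e' * V)"
    by (rule finite_uniform_eps[OF Z quad_pos_diff_small[OF F1 V]]) auto
  then obtain e where e: "e > 0" "\<And>u. u \<in> Z \<Longrightarrow> quad_pos u (F - a - const e * V)" by blast
  \<comment> \<open>Growth gives a nonnegative value at \<open>u\<close>. Conversely
    \<open>F\<close> and \<open>V\<close> vanish there and \<open>a\<close> is nonnegative, so the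
    value is not positive.\<close>
  have F2_zero: "eval (F - a - const e * V) u = 0" if u: "u \<in> Z" for u
  proof -
    obtain d r where d: "d > 0" "r > 0" "\<And>x. norm (x - u) < r \<Longrightarrow> d * (norm (x - u))\<^sup>2 \<le> eval (F - a - const e * V) x"
      using e(2)[OF u] unfolding quad_pos_def by blast
    have "eval (F - a - const e * V) u \<ge> 0" using d(2) d(3)[of u] by simp
    moreover have "eval a u \<ge> 0" by (rule qm_nonneg[OF a_qm Z_feas[OF u]])
    moreover have "eval V u = 0" using vanishes_imp_zero[OF V[OF u]] by simp
    ultimately show ?thesis using Z_zero[OF u] by (simp add: eval_simps)
  qed
  have "\<forall>u\<in>Z. \<exists>A. (F - a - const e * V) - quad u A \<in> cubic u \<and> quad u A \<in> sos"
    using quad_pos_imp_quad e(2) F2_zero by blast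
  from bchoice[OF this] obtain A where
    A: "\<And>u. u \<in> Z \<Longrightarrow> (F - a - const e * V) - quad u (A u) \<in> cubic u" "\<And>u. u \<in> Z \<Longrightarrow> quad u (A u) \<in> sos"
    by blast
  obtain Q where Q: "Q \<in> sos" "\<And>u. u \<in> Z \<Longrightarrow> vanishes u 3 (Q - quad u (A u))"
    using interpolation_quad[OF Z A(2)] by blast
  have "vanishes u 3 (F - a - const e * V - Q)" if u: "u \<in> Z" for u
  proof -
    have "vanishes u 3 (((F - a - const e * V) - quad u (A u)) - (Q - quad u (A u)))"
      using u by (intro vanishes_diff vanishes_cubic A Q)
    then show ?thesis by (simp add: algebra_simps)
  qed
  with cube[of "F - a - const e * V - Q"] obtain r where
    r: "F - a - const e * V - Q = (\<Sum>l\<in>L. (v l)\<^sup>2 * r l)" "\<And>l u. l \<in> L \<Longrightarrow> u \<in> Z \<Longrightarrow> eval (r l) u = 0"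
    by blast
  show ?thesis
  proof (rule local_global_qm[OF L])
    have "(\<Sum>l\<in>L. (v l)\<^sup>2 * (r l + const e)) = (\<Sum>l\<in>L. (v l)\<^sup>2 * r l) + const e * V"
      by (simp only: V_def distrib_left sum.distrib sum_distrib_left mult.commute[of "const e"])
    also have "\<dots> = (F - a - const e * V - Q) + const e * V" by (simp only: r(1))
    finally show "F = (a + Q) + (\<Sum>l\<in>L. (v l)\<^sup>2 * (r l + const e))" by simp
    show "a + Q \<in> qm" by (intro qm_add a_qm sos_on_imp_qm sos_imp_sos_on Q(1))
  next
    fix x l assume "x \<in> feas" "\<forall>l\<in>L. eval (v l) x = 0" "l \<in> L"
    then show "eval (r l + const e) x > 0" using zeros r(2) e(1) by (simp add: eval_simps)
  next
    fix x l assume x: "x \<in> feas" "l \<in> L" "eval (v l) x \<noteq> 0"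
    then have "x \<notin> Z" using zeros by blast
    then show "eval F x > 0" using nonneg[OF x(1)] x(1) by (simp add: Z_def)
  qed
qed

end

section \<open>Derivatives of polynomials\<close>

lemma eval_has_derivative:
  fixes p :: "'n::finite rpoly"
  shows "\<exists>D :: 'n \<Rightarrow> 'n rpoly. \<forall>x. (eval p has_derivative (\<lambda>h. \<Sum>i\<in>UNIV. h $ i * eval (D i) x)) (at x)"
proof (induction p rule: rpoly_induct)
  case (const a)
  have "eval (const a :: 'n rpoly) = (\<lambda>_. a)" by auto
  then show ?case by (intro exI[of _ "\<lambda>_. 0"]) simp
next
  case (var i)
  have "(\<Sum>j\<in>UNIV. h $ j * eval (if j = i then 1 else 0) x) = h $ i" for h x :: "real ^ 'n"
  proof -
    have "(\<Sum>j\<in>UNIV. h $ j * eval (if j = i then 1 else 0) x) = (\<Sum>j\<in>UNIV. if j = i then h $ j else 0)"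
      by (intro sum.cong) auto
    then show ?thesis by simp
  qed
  moreover have "eval (var i :: 'n rpoly) = (\<lambda>x. x $ i)" by auto
  ultimately have "\<forall>x. (eval (var i :: 'n rpoly) has_derivative
      (\<lambda>h. \<Sum>j\<in>UNIV. h $ j * eval (if j = i then 1 else 0) x)) (at x)"
    by (auto intro!: bounded_linear_imp_has_derivative bounded_linear_vec_nth)
  then show ?case by (intro exI[of _ "\<lambda>j. if j = i then 1 else 0"])
next
  case (add p q)
  then obtain D D' where
    "\<forall>x. (eval p has_derivative (\<lambda>h. \<Sum>i\<in>UNIV. h $ i * eval (D i) x)) (at x)"
    "\<forall>x. (eval q has_derivative (\<lambda>h. \<Sum>i\<in>UNIV. h $ i * eval (D' i) x)) (at x)" by blast
  then have "\<forall>x. ((\<lambda>x. eval p x + eval q x) has_derivative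
      (\<lambda>h. (\<Sum>i\<in>UNIV. h $ i * eval (D i) x) + (\<Sum>i\<in>UNIV. h $ i * eval (D' i) x))) (at x)"
    by (auto intro: has_derivative_add)
  moreover have "eval (p + q) = (\<lambda>x. eval p x + eval q x)" by (auto simp: eval_simps)
  ultimately show ?case
    by (intro exI[of _ "\<lambda>i. D i + D' i"]) (simp add: eval_simps distrib_left sum.distrib)
next
  case (mult p q)
  then obtain D D' where D:
    "\<forall>x. (eval p has_derivative (\<lambda>h. \<Sum>i\<in>UNIV. h $ i * eval (D i) x)) (at x)"
    "\<forall>x. (eval q has_derivative (\<lambda>h. \<Sum>i\<in>UNIV. h $ i * eval (D' i) x)) (at x)" by blast
  have "((\<lambda>x. eval p x * eval q x) has_derivative
      (\<lambda>h. \<Sum>i\<in>UNIV. h $ i * eval (p * D' i + D i * q) x)) (at x)" for x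
  proof (rule has_derivative_eq_rhs[OF has_derivative_mult[OF D(1)[rule_format] D(2)[rule_format]]])
    show "(\<lambda>h. eval p x * (\<Sum>i\<in>UNIV. h $ i * eval (D' i) x) + (\<Sum>i\<in>UNIV. h $ i * eval (D i) x) * eval q x) =
        (\<lambda>h. \<Sum>i\<in>UNIV. h $ i * eval (p * D' i + D i * q) x)"
      by (simp add: eval_simps sum_distrib_left sum_distrib_right sum.distrib algebra_simps)
  qed
  moreover have "eval (p * q) = (\<lambda>x. eval p x * eval q x)" by (auto simp: eval_simps)
  ultimately show ?case by (intro exI[of _ "\<lambda>i. p * D' i + D i * q"]) simp
qed

text \<open>The choice is unambiguous: derivatives are unique and \<open>eval\<close> determines the
  polynomial.\<close>

definition pderivs :: "'n::finite rpoly \<Rightarrow> 'n \<Rightarrow> 'n rpoly" where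
  "pderivs p = (SOME D. \<forall>x. (eval p has_derivative (\<lambda>h. \<Sum>i\<in>UNIV. h $ i * eval (D i) x)) (at x))"

lemma has_derivative_eval: "(eval p has_derivative (\<lambda>h. \<Sum>i\<in>UNIV. h $ i * eval (pderivs p i) x)) (at x)"
  using someI_ex[OF eval_has_derivative[of p]] unfolding pderivs_def by blast

lemma gradient_eval: "gradient (eval p) x = (\<chi> i. eval (pderivs p i) x)"
proof -
  have "(\<Sum>j\<in>UNIV. axis i 1 $ j * eval (pderivs p j) x) = eval (pderivs p i) x" for i
  proof -
    have "(\<Sum>j\<in>UNIV. axis i 1 $ j * eval (pderivs p j) x) = (\<Sum>j\<in>UNIV. if j = i then eval (pderivs p j) x else 0)"
      by (intro sum.cong) (auto simp: axis_def)
    then show ?thesis by simp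
  qed
  then show ?thesis
    unfolding gradient_def frechet_derivative_at[OF has_derivative_eval, symmetric] by simp
qed

lemma inner_gradient_eval: "v \<bullet> gradient (eval p) x = (\<Sum>i\<in>UNIV. v $ i * eval (pderivs p i) x)"
  by (simp add: gradient_eval inner_vec_def)

lemma has_derivative_eval_gradient: "(eval p has_derivative (\<lambda>h. h \<bullet> gradient (eval p) x)) (at x)"
  unfolding inner_gradient_eval by (rule has_derivative_eval)

lemma continuous_on_gradient_eval: "continuous_on S (\<lambda>x. gradient (eval p) x)"
  unfolding gradient_eval by (intro continuous_intros)

lemma inner_hessian_eval:
  fixes p :: "'n::finite rpoly"
  shows "v \<bullet> (hessian (eval p) u *v v) = (\<Sum>i\<in>UNIV. \<Sum>j\<in>UNIV. v $ i * v $ j * eval (pderivs (pderivs p i) j) u)"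
proof -
  let ?G = "\<lambda>h. \<chi> i. \<Sum>j\<in>UNIV. h $ j * eval (pderivs (pderivs p i) j) u"
  have "gradient (eval p) = (\<lambda>x. \<chi> i. eval (pderivs p i) x)" by (rule ext) (rule gradient_eval)
  then have D: "(gradient (eval p) has_derivative ?G) (at u)"
    by (simp only:) (subst has_derivative_componentwise_within,
      auto simp: Basis_vec_def inner_axis intro: has_derivative_eval)
  then have "(gradient (eval p) has_derivative (\<lambda>h. jacobian (gradient (eval p)) (at u) *v h)) (at u)"
    by (intro jacobian_works[THEN iffD1]) (auto simp: differentiable_def)
  from has_derivative_unique[OF this D] have "hessian (eval p) u *v v = ?G v"
    unfolding hessian_def by (rule fun_cong)
  then show ?thesis
    by (simp add: inner_vec_def sum_distrib_left algebra_simps)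
qed

lemma gradient_add_eval: "gradient (eval (p + q)) x = gradient (eval p) x + gradient (eval q) x"
proof (rule vector_eq_rdot[THEN iffD1], rule allI)
  fix v
  have "((\<lambda>x. eval p x + eval q x) has_derivative (\<lambda>h. h \<bullet> gradient (eval p) x + h \<bullet> gradient (eval q) x)) (at x)"
    by (intro has_derivative_add has_derivative_eval_gradient)
  moreover have "eval (p + q) = (\<lambda>x. eval p x + eval q x)" by (auto simp: eval_simps)
  ultimately have "(\<lambda>h. h \<bullet> gradient (eval (p + q)) x) = (\<lambda>h. h \<bullet> gradient (eval p) x + h \<bullet> gradient (eval q) x)"
    using has_derivative_unique[OF has_derivative_eval_gradient[of "p + q" x]] by simp
  from fun_cong[OF this] show "gradient (eval (p + q)) x \<bullet> v = (gradient (eval p) x + gradient (eval q) x) \<bullet> v"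
    by (simp add: inner_commute inner_add_right)
qed

lemma gradient_const_mult_eval: "gradient (eval (const a * p)) x = a *\<^sub>R gradient (eval p) x"
proof (rule vector_eq_rdot[THEN iffD1], rule allI)
  fix v
  have "((\<lambda>x. a * eval p x) has_derivative (\<lambda>h. a * (h \<bullet> gradient (eval p) x))) (at x)"
    by (intro has_derivative_mult_right has_derivative_eval_gradient)
  moreover have "eval (const a * p) = (\<lambda>x. a * eval p x)" by (auto simp: eval_simps)
  ultimately have "(\<lambda>h. h \<bullet> gradient (eval (const a * p)) x) = (\<lambda>h. a * (h \<bullet> gradient (eval p) x))"
    using has_derivative_unique[OF has_derivative_eval_gradient[of "const a * p" x]] by simp
  from fun_cong[OF this] show "gradient (eval (const a * p)) x \<bullet> v = (a *\<^sub>R gradient (eval p) x) \<bullet> v"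
    by (simp add: inner_commute)
qed

lemma gradient_0_eval: "gradient (\<lambda>_. 0) (x :: real ^ 'n::finite) = 0"
proof -
  have "eval (0 :: 'n rpoly) = (\<lambda>_. 0)" by (rule ext) simp
  then show ?thesis using gradient_const_mult_eval[of 0 0 x] by simp
qed

lemma gradient_sum_eval: "gradient (eval (sum f A)) x = (\<Sum>a\<in>A. gradient (eval (f a)) x)"
  by (induction A rule: infinite_finite_induct) (simp_all add: gradient_0_eval gradient_add_eval)

lemma gradient_diff_eval: "gradient (eval (p - q)) x = gradient (eval p) x - gradient (eval q) x"
  using gradient_add_eval[of p "const (- 1) * q" x] gradient_const_mult_eval[of "- 1" q x]
  by (simp add: const_uminus)

text \<open>Maclaurin's formula along the segment from \<open>u\<close> to \<open>x\<close>, with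
  third partial derivatives bounded on the unit ball. It ties \<open>vanishes\<close> to the
  gradients and Hessians in the optimality conditions.\<close>

lemma taylor_gradient_hessian:
  fixes p :: "'n::finite rpoly"
  shows "vanishes u 3 (p - (const (eval p u) + (\<Sum>i\<in>UNIV. shift u i * const (eval (pderivs p i) u))
    + quad u (\<lambda>i j. eval (pderivs (pderivs p i) j) u / 2)))"
proof -
  define D1 where "D1 i = pderivs p i" for i
  define D2 where "D2 i j = pderivs (D1 i) j" for i j
  define D3 where "D3 i j k = pderivs (D2 i j) k" for i j k
  have "\<exists>K>0. \<forall>x\<in>cball u 1. \<bar>\<Sum>i\<in>UNIV. \<Sum>j\<in>UNIV. \<Sum>k\<in>UNIV. \<bar>eval (D3 i j k) x\<bar>\<bar> \<le> K"
    by (intro compact_upper_bound compact_cball continuous_intros)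
  then obtain K where K: "K > 0" "\<And>x. x \<in> cball u 1 \<Longrightarrow> (\<Sum>i\<in>UNIV. \<Sum>j\<in>UNIV. \<Sum>k\<in>UNIV. \<bar>eval (D3 i j k) x\<bar>) \<le> K"
    by (meson abs_le_D1)
  show ?thesis
  proof (rule vanishesI[of _ _ K])
    fix x assume x: "norm (x - u) \<le> 1"
    define y where "y = x - u"
    have chain: "DERIV (\<lambda>t. eval q (u + t *\<^sub>R y)) t :> (\<Sum>i\<in>UNIV. y $ i * eval (pderivs q i) (u + t *\<^sub>R y))" for q t
    proof -
      have "((\<lambda>t. u + t *\<^sub>R y) has_derivative (\<lambda>s. s *\<^sub>R y)) (at t)"
        by (auto intro!: derivative_eq_intros)
      from has_derivative_compose[OF this has_derivative_eval[of q]]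
      have "((\<lambda>t. eval q (u + t *\<^sub>R y)) has_derivative
          (\<lambda>s. \<Sum>i\<in>UNIV. (s *\<^sub>R y) $ i * eval (pderivs q i) (u + t *\<^sub>R y))) (at t)" .
      moreover have "(\<lambda>s. \<Sum>i\<in>UNIV. (s *\<^sub>R y) $ i * eval (pderivs q i) (u + t *\<^sub>R y)) =
          (*) (\<Sum>i\<in>UNIV. y $ i * eval (pderivs q i) (u + t *\<^sub>R y))"
        by (auto simp: sum_distrib_left algebra_simps)
      ultimately show ?thesis unfolding has_field_derivative_def by simp
    qed
    define d :: "nat \<Rightarrow> real \<Rightarrow> real" where "d = (\<lambda>m t. if m = 0 then eval p (u + t *\<^sub>R y)
      else if m = 1 then (\<Sum>i\<in>UNIV. y $ i * eval (D1 i) (u + t *\<^sub>R y))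
      else if m = 2 then (\<Sum>i\<in>UNIV. y $ i * (\<Sum>j\<in>UNIV. y $ j * eval (D2 i j) (u + t *\<^sub>R y)))
      else (\<Sum>i\<in>UNIV. y $ i * (\<Sum>j\<in>UNIV. y $ j * (\<Sum>k\<in>UNIV. y $ k * eval (D3 i j k) (u + t *\<^sub>R y)))))"

    have "\<exists>t>0. t < 1 \<and> d 0 1 = (\<Sum>m<3. d m 0 / fact m) + d 3 t / fact 3"
    proof -
      have diff: "\<forall>m t. m < 3 \<and> 0 \<le> t \<and> t \<le> 1 \<longrightarrow> DERIV (d m) t :> d (Suc m) t"
      proof (intro allI impI)
        fix m :: nat and t :: real assume "m < 3 \<and> 0 \<le> t \<and> t \<le> 1"
        then consider "m = 0" | "m = 1" | "m = 2" by linarith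
        then show "DERIV (d m) t :> d (Suc m) t"
        proof cases
          case 1
          then show ?thesis using chain[of p t] by (simp add: d_def D1_def)
        next
          case 2
          have "DERIV (\<lambda>t. \<Sum>i\<in>UNIV. y $ i * eval (D1 i) (u + t *\<^sub>R y)) t :>
              (\<Sum>i\<in>UNIV. y $ i * (\<Sum>j\<in>UNIV. y $ j * eval (D2 i j) (u + t *\<^sub>R y)))"
            unfolding D2_def by (intro DERIV_sum DERIV_cmult chain)
          then show ?thesis using 2 by (simp add: d_def)
        next
          case 3
          have "DERIV (\<lambda>t. \<Sum>i\<in>UNIV. y $ i * (\<Sum>j\<in>UNIV. y $ j * eval (D2 i j) (u + t *\<^sub>R y))) t :>
              (\<Sum>i\<in>UNIV. y $ i * (\<Sum>j\<in>UNIV. y $ j * (\<Sum>k\<in>UNIV. y $ k * eval (D3 i j k) (u + t *\<^sub>R y))))"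
            unfolding D3_def by (intro DERIV_sum DERIV_cmult chain)
          then show ?thesis using 3 by (simp add: d_def)
        qed
      qed
      show ?thesis using Maclaurin[of 1 3 d "d 0", OF _ _ refl diff] by simp
    qed
    then obtain t where t: "0 < t" "t < 1" and
      mac: "d 0 1 = (\<Sum>m<3. d m 0 / fact m) + d 3 t / fact 3" by blast
    have "(\<Sum>m<3. d m 0 / fact m) = d 0 0 + d 1 0 + d 2 0 / 2"
      by (simp add: numeral_3_eq_3 numeral_2_eq_2 lessThan_Suc)
    moreover have "d 0 1 = eval p x" by (simp add: d_def y_def)
    ultimately have "eval p x - (d 0 0 + d 1 0 + d 2 0 / 2) = d 3 t / 6"
      using mac by (simp add: fact_numeral)
    moreover have "eval (p - (const (eval p u) + (\<Sum>i\<in>UNIV. shift u i * const (eval (pderivs p i) u))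
        + quad u (\<lambda>i j. eval (pderivs (pderivs p i) j) u / 2))) x = eval p x - (d 0 0 + d 1 0 + d 2 0 / 2)"
      by (simp add: d_def eval_simps eval_quad D1_def D2_def y_def sum_distrib_left sum_divide_distrib mult.assoc)
    moreover have "\<bar>d 3 t\<bar> \<le> K * norm y ^ 3"
    proof -
      have y: "\<bar>y $ i\<bar> \<le> norm y" for i by (rule component_le_norm_cart)
      have "d 3 t = (\<Sum>i\<in>UNIV. \<Sum>j\<in>UNIV. \<Sum>k\<in>UNIV. (y $ i * y $ j * y $ k) * eval (D3 i j k) (u + t *\<^sub>R y))"
        by (simp add: d_def sum_distrib_left mult.assoc)
      also have "\<bar>\<dots>\<bar> \<le> (\<Sum>i\<in>UNIV. \<Sum>j\<in>UNIV. \<Sum>k\<in>UNIV. \<bar>(y $ i * y $ j * y $ k) * eval (D3 i j k) (u + t *\<^sub>R y)\<bar>)"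
        by (intro order_trans[OF sum_abs] sum_mono order_refl)
      also have "\<dots> \<le> (\<Sum>i\<in>UNIV. \<Sum>j\<in>UNIV. \<Sum>k\<in>UNIV. norm y ^ 3 * \<bar>eval (D3 i j k) (u + t *\<^sub>R y)\<bar>)"
        unfolding abs_mult power3_eq_cube by (intro sum_mono mult_right_mono mult_mono y) auto
      also have "\<dots> = norm y ^ 3 * (\<Sum>i\<in>UNIV. \<Sum>j\<in>UNIV. \<Sum>k\<in>UNIV. \<bar>eval (D3 i j k) (u + t *\<^sub>R y)\<bar>)"
        by (simp add: sum_distrib_left)
      also have "\<dots> \<le> norm y ^ 3 * K"
      proof (intro mult_left_mono K(2))
        have "t * norm y \<le> 1 * 1" using t x by (intro mult_mono) (auto simp: y_def)
        then show "u + t *\<^sub>R y \<in> cball u 1" using t by (simp add: dist_norm)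
      qed simp
      finally show ?thesis by (simp add: mult.commute)
    qed
    moreover have "K * norm y ^ 3 \<ge> 0" using K(1) by simp
    ultimately show "\<bar>eval (p - (const (eval p u) + (\<Sum>i\<in>UNIV. shift u i * const (eval (pderivs p i) u))
        + quad u (\<lambda>i j. eval (pderivs (pderivs p i) j) u / 2))) x\<bar> \<le> K * norm (x - u) ^ 3"
      unfolding y_def by linarith
  qed
qed

lemma taylor_gradient:
  fixes p :: "'n::finite rpoly"
  shows "vanishes u 2 (p - (const (eval p u) + (\<Sum>i\<in>UNIV. shift u i * const (eval (pderivs p i) u))))"
proof -
  have "vanishes u 2 ((p - (const (eval p u) + (\<Sum>i\<in>UNIV. shift u i * const (eval (pderivs p i) u))
    + quad u (\<lambda>i j. eval (pderivs (pderivs p i) j) u / 2))) + quad u (\<lambda>i j. eval (pderivs (pderivs p i) j) u / 2))"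
    by (intro vanishes_add vanishes_quad vanishes_mono[OF taylor_gradient_hessian]) simp
  then show ?thesis by (simp add: algebra_simps)
qed

section \<open>Karush-Kuhn-Tucker conditions\<close>

text \<open>Because the squared negative part is differentiable also at 0, penalties for
  inequalities have ordinary stationary points.\<close>

lemma DERIV_min_0_square: "DERIV (\<lambda>t. (min t 0)\<^sup>2) t :> 2 * min t (0::real)"
proof -
  consider "t < 0" | "t > 0" | "t = 0" by linarith
  then show ?thesis
  proof cases
    case 1
    have "DERIV (\<lambda>t. t\<^sup>2) t :> 2 * t" by (auto intro!: derivative_eq_intros)
    then have "DERIV (\<lambda>t. (min t 0)\<^sup>2) t :> 2 * t"
      by (rule has_field_derivative_transform_within_open[of _ _ _ "{..<0}"]) (use 1 in auto)
    then show ?thesis using 1 by simp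
  next
    case 2
    have "DERIV (\<lambda>_. 0) t :> (0::real)" by simp
    then have "DERIV (\<lambda>t. (min t 0)\<^sup>2) t :> 0"
      by (rule has_field_derivative_transform_within_open[of _ _ _ "{0<..}"]) (use 2 in auto)
    then show ?thesis using 2 by simp
  next
    case 3
    have "((\<lambda>y::real. (min y 0)\<^sup>2 / y) \<longlongrightarrow> 0) (at 0)"
    proof (rule Lim_null_comparison)
      show "\<forall>\<^sub>F y::real in at 0. norm ((min y 0)\<^sup>2 / y) \<le> \<bar>y\<bar>"
        by (rule always_eventually) (auto simp: min_def power2_eq_square)
      show "((\<lambda>y::real. \<bar>y\<bar>) \<longlongrightarrow> 0) (at 0)" by (rule tendsto_rabs_zero) (rule tendsto_ident_at)
    qed
    then show ?thesis using 3 by (simp add: has_field_derivative_iff)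
  qed
qed

text \<open>Minimize \<open>F\<close> plus a proximal term plus a large penalty over a small ball.
  On the boundary this exceeds its value at \<open>u\<close>, so the minimizer is interior and the
  gradient vanishes there. The penalty terms contribute approximate multipliers.\<close>

lemma penalty_stationary_point:
  fixes g :: "'j \<Rightarrow> 'n::finite rpoly"
  assumes fin: "finite E" "finite I" and r: "r > 0"
    and minimizer: "global_minimizer (eval F) (\<lambda>j. eval (g j)) E I u"
  shows "\<exists>N>0. \<exists>x. norm (x - u) < r \<and> gradient (eval F) x + 2 *\<^sub>R (x - u) =
    (\<Sum>j\<in>E. (- 2 * N * eval (g j) x) *\<^sub>R gradient (eval (g j)) x) +
    (\<Sum>j\<in>I. (- 2 * N * min (eval (g j) x) 0) *\<^sub>R gradient (eval (g j)) x)"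
proof -
  define pen where "pen x = (\<Sum>j\<in>E. (eval (g j) x)\<^sup>2) + (\<Sum>j\<in>I. (min (eval (g j) x) 0)\<^sup>2)" for x
  \<comment> \<open>The squared distance turns \<open>u\<close> into a strict minimizer on the
    feasible set, so \<open>p\<close> is positive at the feasible points of the boundary
    sphere.\<close>
  define p where "p x = eval F x - eval F u + (norm (x - u))\<^sup>2" for x
  have cont: "continuous_on X pen" "continuous_on X p" for X
    unfolding pen_def p_def by (intro continuous_intros)+
  have pen_nonneg: "pen x \<ge> 0" for x by (simp add: pen_def sum_nonneg)
  have u: "u \<in> feasible_set (\<lambda>j. eval (g j)) E I" and
    least: "\<And>w. w \<in> feasible_set (\<lambda>j. eval (g j)) E I \<Longrightarrow> eval F u \<le> eval F w"
    using minimizer by (auto simp: global_minimizer_def)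
  have pen_u: "pen u = 0" using u by (auto simp: pen_def feasible_set_def)
  have pos: "p x > 0" if "x \<in> sphere u r" "pen x = 0" for x
  proof -
    have "(\<Sum>j\<in>E. (eval (g j) x)\<^sup>2) = 0" "(\<Sum>j\<in>I. (min (eval (g j) x) 0)\<^sup>2) = 0"
      using that(2) by (auto simp: pen_def sum_nonneg add_nonneg_eq_0_iff)
    then have "\<forall>j\<in>E. eval (g j) x = 0" "\<forall>j\<in>I. min (eval (g j) x) 0 = 0"
      using fin by (auto simp: sum_nonneg_eq_0_iff)
    then have "x \<in> feasible_set (\<lambda>j. eval (g j)) E I"
      by (force simp: feasible_set_def min_def split: if_splits)
    then have "eval F u \<le> eval F x" by (rule least)
    moreover have "norm (x - u) = r" using that(1) by (simp add: dist_norm norm_minus_commute)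
    ultimately show ?thesis using r by (simp add: p_def add_nonneg_pos)
  qed
  have "\<exists>N>0. \<forall>x\<in>sphere u r. p x + N * pen x > 0"
    by (intro compact_penalty compact_sphere cont pen_nonneg pos)
  then obtain N where N: "N > 0" "\<And>x. x \<in> sphere u r \<Longrightarrow> p x + N * pen x > 0" by blast
  define \<Phi> where "\<Phi> x = p x + N * pen x" for x
  have "continuous_on (cball u r) \<Phi>" unfolding \<Phi>_def by (intro continuous_intros cont)
  moreover have "cball u r \<noteq> {}" using r by simp
  ultimately obtain x where x: "x \<in> cball u r" "\<forall>y\<in>cball u r. \<Phi> x \<le> \<Phi> y"
    using continuous_attains_inf[OF compact_cball] by blast
  have "\<Phi> x \<le> \<Phi> u" using x(2) r by simp
  also have "\<Phi> u = 0" by (simp add: \<Phi>_def p_def pen_u)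
  finally have "x \<notin> sphere u r" using N(2)[of x] by (auto simp: \<Phi>_def)
  then have x_ball: "x \<in> ball u r" using x(1) by (auto simp: less_le)
  define D where "D = gradient (eval F) x + 2 *\<^sub>R (x - u) +
    (N *\<^sub>R (\<Sum>j\<in>E. (2 * eval (g j) x) *\<^sub>R gradient (eval (g j)) x) +
     N *\<^sub>R (\<Sum>j\<in>I. (2 * min (eval (g j) x) 0) *\<^sub>R gradient (eval (g j)) x))"
  have norm2: "((\<lambda>x. (norm (x - u))\<^sup>2) has_derivative (\<lambda>h. h \<bullet> (2 *\<^sub>R (x - u)))) (at x)"
    unfolding power2_norm_eq_inner
    by (auto intro!: derivative_eq_intros simp: inner_commute)
  have sq: "((\<lambda>x. (eval (g j) x)\<^sup>2) has_derivative (\<lambda>h. h \<bullet> ((2 * eval (g j) x) *\<^sub>R gradient (eval (g j)) x))) (at x)" for j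
    by (rule has_derivative_eq_rhs[OF has_derivative_power[OF has_derivative_eval_gradient]]) (simp add: fun_eq_iff)
  have minsq: "((\<lambda>x. (min (eval (g j) x) 0)\<^sup>2) has_derivative
      (\<lambda>h. h \<bullet> ((2 * min (eval (g j) x) 0) *\<^sub>R gradient (eval (g j)) x))) (at x)" for j
    by (rule has_derivative_eq_rhs[OF has_derivative_compose[OF has_derivative_eval_gradient
            DERIV_min_0_square[unfolded has_field_derivative_def]]]) (simp add: fun_eq_iff)
  have "(\<Phi> has_derivative (\<lambda>h. h \<bullet> gradient (eval F) x - 0 + h \<bullet> (2 *\<^sub>R (x - u)) +
     N * ((\<Sum>j\<in>E. h \<bullet> ((2 * eval (g j) x) *\<^sub>R gradient (eval (g j)) x)) +
       (\<Sum>j\<in>I. h \<bullet> ((2 * min (eval (g j) x) 0) *\<^sub>R gradient (eval (g j)) x))))) (at x)"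
    unfolding \<Phi>_def p_def pen_def
    by (intro has_derivative_add has_derivative_diff has_derivative_mult_right has_derivative_sum
        has_derivative_eval_gradient has_derivative_const norm2 sq minsq)
  also have "(\<lambda>h. h \<bullet> gradient (eval F) x - 0 + h \<bullet> (2 *\<^sub>R (x - u)) +
     N * ((\<Sum>j\<in>E. h \<bullet> ((2 * eval (g j) x) *\<^sub>R gradient (eval (g j)) x)) +
       (\<Sum>j\<in>I. h \<bullet> ((2 * min (eval (g j) x) 0) *\<^sub>R gradient (eval (g j)) x)))) = (\<lambda>h. h \<bullet> D)"
    by (simp add: D_def inner_add_right inner_sum_right algebra_simps)
  finally have "(\<lambda>h. h \<bullet> D) = (\<lambda>h. 0)"
    by (rule differential_zero_maxmin[OF x_ball open_ball]) (use x in auto)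
  from fun_cong[OF this, of D] have "D = 0" by simp
  then have "gradient (eval F) x + 2 *\<^sub>R (x - u) =
    (\<Sum>j\<in>E. (- 2 * N * eval (g j) x) *\<^sub>R gradient (eval (g j)) x) +
    (\<Sum>j\<in>I. (- 2 * N * min (eval (g j) x) 0) *\<^sub>R gradient (eval (g j)) x)"
    unfolding D_def by (simp add: scaleR_sum_right sum_negf algebra_simps eq_neg_iff_add_eq_0)
  moreover have "norm (x - u) < r" using x_ball by (simp add: dist_norm norm_minus_commute)
  ultimately show ?thesis using N(1) by blast
qed

section \<open>Convergence of approximate multipliers\<close>

lemma dual_functionals:
  fixes b :: "'j \<Rightarrow> 'a::real_vector"
  assumes "inj_on b A" "independent (b ` A)"
  shows "\<exists>\<phi> :: 'j \<Rightarrow> 'a \<Rightarrow> real. \<forall>j. linear (\<phi> j) \<and> (\<forall>i\<in>A. j \<in> A \<longrightarrow> \<phi> j (b i) = (if i = j then 1 else 0))"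
proof -
  have "\<forall>j. \<exists>\<phi> :: 'a \<Rightarrow> real. linear \<phi> \<and> (\<forall>i\<in>A. j \<in> A \<longrightarrow> \<phi> (b i) = (if i = j then 1 else 0))"
  proof
    fix j
    obtain \<phi> :: "'a \<Rightarrow> real" where \<phi>: "linear \<phi>" "\<forall>x\<in>b ` A. \<phi> x = (if x = b j then 1 else 0)"
      using linear_independent_extend[OF assms(2), of "\<lambda>x. if x = b j then 1 else 0"] by blast
    have "\<phi> (b i) = (if i = j then 1 else 0)" if "i \<in> A" "j \<in> A" for i
      using \<phi>(2) that assms(1) by (auto simp: inj_on_def)
    with \<phi>(1) show "\<exists>\<phi> :: 'a \<Rightarrow> real. linear \<phi> \<and> (\<forall>i\<in>A. j \<in> A \<longrightarrow> \<phi> (b i) = (if i = j then 1 else 0))"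
      by blast
  qed
  from choice[OF this] show ?thesis .
qed

text \<open>Functionals dual to the limit vectors recover each coefficient up to a combination of
  all coefficients with small weights \<open>e\<close>. Eventually the total size satisfies
  \<open>L n \<le> W n + L n / 2\<close>, so it is bounded, the error terms tend to 0, and the
  coefficients converge.\<close>

lemma independent_combination_limit:
  fixes G :: "'j \<Rightarrow> nat \<Rightarrow> 'a::euclidean_space"
  assumes A: "finite A" and G: "\<And>j. j \<in> A \<Longrightarrow> G j \<longlonglongrightarrow> b j"
    and indep: "inj_on b A" "independent (b ` A)"
    and w: "w \<longlonglongrightarrow> w'" "\<And>n. w n = (\<Sum>j\<in>A. lam n j *\<^sub>R G j n)"
  shows "\<exists>l. (\<forall>j\<in>A. (\<lambda>n. lam n j) \<longlonglongrightarrow> l j) \<and> w' = (\<Sum>j\<in>A. l j *\<^sub>R b j)"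
proof -
  from dual_functionals[OF indep] obtain \<phi> :: "'j \<Rightarrow> 'a \<Rightarrow> real" where
    *: "\<forall>j. linear (\<phi> j) \<and> (\<forall>i\<in>A. j \<in> A \<longrightarrow> \<phi> j (b i) = (if i = j then 1 else 0))" ..
  then have \<phi>: "\<And>j. linear (\<phi> j)" by blast
  have dual: "\<phi> j (b i) = (if i = j then 1 else 0)" if "i \<in> A" "j \<in> A" for i j
    using * that by blast
  have lim: "(\<lambda>n. \<phi> j (X n)) \<longlonglongrightarrow> \<phi> j x" if "X \<longlonglongrightarrow> x" for X x j
    by (rule bounded_linear.tendsto[OF linear_conv_bounded_linear[THEN iffD1, OF \<phi>] that])
  define e where "e i j n = \<phi> j (G i n - b i)" for i j n
  have e: "e i j \<longlonglongrightarrow> 0" if "i \<in> A" for i j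
  proof -
    have "(\<lambda>n. G i n - b i) \<longlonglongrightarrow> 0" using tendsto_diff[OF G[OF that] tendsto_const[of "b i"]] by simp
    from lim[OF this, of j] show ?thesis by (simp add: e_def[abs_def] linear_0[OF \<phi>])
  qed
  have lam: "lam n j = \<phi> j (w n) - (\<Sum>i\<in>A. lam n i * e i j n)" if j: "j \<in> A" for n j
  proof -
    have "\<phi> j (w n) = (\<Sum>i\<in>A. lam n i * \<phi> j (G i n))"
      by (simp add: w(2) linear_sum[OF \<phi>] linear_cmul[OF \<phi>])
    moreover have "(\<Sum>i\<in>A. lam n i * e i j n) = (\<Sum>i\<in>A. lam n i * \<phi> j (G i n)) - (\<Sum>i\<in>A. lam n i * \<phi> j (b i))"
      by (simp add: e_def linear_diff[OF \<phi>] right_diff_distrib sum_subtractf)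
    moreover have "(\<Sum>i\<in>A. lam n i * \<phi> j (b i)) = (\<Sum>i\<in>A. if i = j then lam n i else 0)"
      by (intro sum.cong) (auto simp: dual j)
    ultimately show ?thesis using A j by simp
  qed
  define L where "L n = (\<Sum>i\<in>A. \<bar>lam n i\<bar>)" for n
  define W where "W n = (\<Sum>j\<in>A. \<bar>\<phi> j (w n)\<bar>)" for n
  define \<eta> where "\<eta> n = (\<Sum>j\<in>A. \<Sum>i\<in>A. \<bar>e i j n\<bar>)" for n
  have L_le: "L n \<le> W n + L n * \<eta> n" for n
  proof -
    have le: "\<bar>lam n i\<bar> \<le> L n" if "i \<in> A" for i
      unfolding L_def using A that by (intro member_le_sum) auto
    have "\<bar>lam n j\<bar> \<le> \<bar>\<phi> j (w n)\<bar> + L n * (\<Sum>i\<in>A. \<bar>e i j n\<bar>)" if "j \<in> A" for j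
    proof -
      have "\<bar>lam n j\<bar> \<le> \<bar>\<phi> j (w n)\<bar> + \<bar>\<Sum>i\<in>A. lam n i * e i j n\<bar>" unfolding lam[OF that, of n] by linarith
      also have "\<bar>\<Sum>i\<in>A. lam n i * e i j n\<bar> \<le> (\<Sum>i\<in>A. \<bar>lam n i\<bar> * \<bar>e i j n\<bar>)"
        by (intro order_trans[OF sum_abs]) (simp add: abs_mult)
      also have "\<dots> \<le> (\<Sum>i\<in>A. L n * \<bar>e i j n\<bar>)" by (intro sum_mono mult_right_mono le) auto
      finally show ?thesis by (simp add: sum_distrib_left)
    qed
    then have "(\<Sum>j\<in>A. \<bar>lam n j\<bar>) \<le> (\<Sum>j\<in>A. \<bar>\<phi> j (w n)\<bar> + L n * (\<Sum>i\<in>A. \<bar>e i j n\<bar>))" by (rule sum_mono)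
    then show ?thesis by (simp add: L_def[symmetric] W_def \<eta>_def sum.distrib sum_distrib_left)
  qed
  have "\<eta> \<longlonglongrightarrow> (\<Sum>j\<in>A. \<Sum>i\<in>A. \<bar>0\<bar>)"
    unfolding \<eta>_def[abs_def] by (intro tendsto_sum tendsto_rabs e)
  then have \<eta>: "eventually (\<lambda>n. \<eta> n < 1/2) sequentially"
    by (rule order_tendstoD) simp
  have "W \<longlonglongrightarrow> (\<Sum>j\<in>A. \<bar>\<phi> j w'\<bar>)"
    unfolding W_def[abs_def] by (intro tendsto_sum tendsto_rabs lim w)
  then have W: "eventually (\<lambda>n. W n < (\<Sum>j\<in>A. \<bar>\<phi> j w'\<bar>) + 1) sequentially"
    by (rule order_tendstoD) simp
  define K where "K = 2 * ((\<Sum>j\<in>A. \<bar>\<phi> j w'\<bar>) + 1)"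
  have L_bound: "eventually (\<lambda>n. L n \<le> K) sequentially"
    using \<eta> W
  proof eventually_elim
    case (elim n)
    have "L n \<ge> 0" by (simp add: L_def sum_nonneg)
    then have "L n * \<eta> n \<le> L n * (1/2)" using elim by (intro mult_left_mono) auto
    then show "L n \<le> K" using L_le[of n] elim by (simp add: K_def)
  qed
  have "(\<lambda>n. lam n i * e i j n) \<longlonglongrightarrow> 0" if "i \<in> A" for i j
  proof (rule Lim_null_comparison)
    show "eventually (\<lambda>n. norm (lam n i * e i j n) \<le> K * \<bar>e i j n\<bar>) sequentially"
      using L_bound
    proof eventually_elim
      case (elim n)
      have "\<bar>lam n i\<bar> \<le> L n" unfolding L_def using A that by (intro member_le_sum) auto
      then have "\<bar>lam n i\<bar> * \<bar>e i j n\<bar> \<le> K * \<bar>e i j n\<bar>" using elim by (intro mult_right_mono) auto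
      then show ?case by (simp add: abs_mult)
    qed
    show "(\<lambda>n. K * \<bar>e i j n\<bar>) \<longlonglongrightarrow> 0"
      by (intro tendsto_mult_right_zero tendsto_rabs_zero e that)
  qed
  then have diff_lim: "(\<lambda>n. \<phi> j (w n) - (\<Sum>i\<in>A. lam n i * e i j n)) \<longlonglongrightarrow> \<phi> j w' - (\<Sum>i\<in>A. 0)" for j
    by (intro tendsto_diff lim w tendsto_sum)
  have lam_lim: "(\<lambda>n. lam n j) \<longlonglongrightarrow> \<phi> j w'" if "j \<in> A" for j
  proof -
    have "(\<lambda>n. \<phi> j (w n) - (\<Sum>i\<in>A. lam n i * e i j n)) = (\<lambda>n. lam n j)"
      by (rule ext) (rule lam[OF that, symmetric])
    with diff_lim[of j] show ?thesis by simp
  qed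
  have "(\<lambda>n. \<Sum>j\<in>A. lam n j *\<^sub>R G j n) \<longlonglongrightarrow> (\<Sum>j\<in>A. \<phi> j w' *\<^sub>R b j)"
    by (intro tendsto_sum tendsto_scaleR lam_lim G)
  then have "w \<longlonglongrightarrow> (\<Sum>j\<in>A. \<phi> j w' *\<^sub>R b j)" unfolding w(2)[symmetric] .
  then have "w' = (\<Sum>j\<in>A. \<phi> j w' *\<^sub>R b j)" by (rule LIMSEQ_unique[OF w(1)])
  then show ?thesis using lam_lim by (intro exI[of _ "\<lambda>j. \<phi> j w'"] conjI ballI)
qed

text \<open>SCC and SOSC range over all multipliers and would be vacuous without this. Stationary
  points of penalty functions approach \<open>u\<close>, and LICQC makes their approximate
  multipliers converge.\<close>

theorem lagrange_multipliers_exist: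
  fixes g :: "'j \<Rightarrow> 'n::finite rpoly"
  assumes fin: "finite E" "finite I" and disj: "E \<inter> I = {}"
    and minimizer: "global_minimizer (eval F) (\<lambda>j. eval (g j)) E I u"
    and licqc: "LICQC (\<lambda>j. eval (g j)) E I u"
  shows "\<exists>lam. lagrange_multipliers (eval F) (\<lambda>j. eval (g j)) E I u lam"
proof -
  define A where "A = active_set (\<lambda>j. eval (g j)) E I u"
  have A_fin: "finite A" using fin by (simp add: A_def active_set_def)
  have u: "\<And>j. j \<in> E \<Longrightarrow> eval (g j) u = 0" "\<And>j. j \<in> I \<Longrightarrow> eval (g j) u \<ge> 0"
    using minimizer by (auto simp: global_minimizer_def feasible_set_def)
  have A_eq: "A = E \<union> (A \<inter> I)" "A \<subseteq> E \<union> I" using u by (auto simp: A_def active_set_def)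
  \<comment> \<open>Within this radius the inactive constraints stay positive, so the negative part
    in their penalty multiplier is 0 and only active gradients contribute.\<close>
  have "\<exists>r>0. \<forall>j\<in>I - A. \<forall>x. norm (x - u) < r \<longrightarrow> eval (g j) x > 0"
  proof (rule finite_uniform_eps)
    fix j assume j: "j \<in> I - A"
    then have pos: "eval (g j) u > 0" using u(2)[of j] by (auto simp: A_def active_set_def)
    have "vanishes u 1 (g j - const (eval (g j) u))" unfolding vanishes_1_iff by (simp add: eval_simps)
    from vanishesD[OF this] obtain B where
      B: "B > 0" "\<And>x. norm (x - u) \<le> 1 \<Longrightarrow> \<bar>eval (g j) x - eval (g j) u\<bar> \<le> B * norm (x - u)"
      by (auto simp: eval_simps)
    have "eval (g j) x > 0" if x: "norm (x - u) < min 1 (eval (g j) u / B)" for x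
    proof -
      have "B * norm (x - u) < eval (g j) u" using x B(1) by (simp add: field_simps)
      then show ?thesis using B(2)[of x] x by simp
    qed
    then show "\<exists>r>0. \<forall>x. norm (x - u) < r \<longrightarrow> eval (g j) x > 0"
      using pos B(1) by (intro exI[of _ "min 1 (eval (g j) u / B)"]) auto
  qed (use fin in auto)
  then obtain r where r: "r > 0" "\<And>j x. j \<in> I - A \<Longrightarrow> norm (x - u) < r \<Longrightarrow> eval (g j) x > 0" by blast
  have "\<forall>n::nat. \<exists>N x. N > 0 \<and> norm (x - u) < r / Suc n \<and> gradient (eval F) x + 2 *\<^sub>R (x - u) =
    (\<Sum>j\<in>E. (- 2 * N * eval (g j) x) *\<^sub>R gradient (eval (g j)) x) +
    (\<Sum>j\<in>I. (- 2 * N * min (eval (g j) x) 0) *\<^sub>R gradient (eval (g j)) x)"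
  proof
    fix n :: nat
    have "r / Suc n > 0" using r by simp
    from penalty_stationary_point[OF fin this minimizer]
    show "\<exists>N x. N > 0 \<and> norm (x - u) < r / Suc n \<and> gradient (eval F) x + 2 *\<^sub>R (x - u) =
      (\<Sum>j\<in>E. (- 2 * N * eval (g j) x) *\<^sub>R gradient (eval (g j)) x) +
      (\<Sum>j\<in>I. (- 2 * N * min (eval (g j) x) 0) *\<^sub>R gradient (eval (g j)) x)" by blast
  qed
  from choice[OF this] obtain N where "\<forall>n. \<exists>x. N n > 0 \<and> norm (x - u) < r / Suc n \<and>
    gradient (eval F) x + 2 *\<^sub>R (x - u) =
    (\<Sum>j\<in>E. (- 2 * N n * eval (g j) x) *\<^sub>R gradient (eval (g j)) x) +
    (\<Sum>j\<in>I. (- 2 * N n * min (eval (g j) x) 0) *\<^sub>R gradient (eval (g j)) x)" ..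
  from choice[OF this] obtain x where Nx: "\<And>n::nat. N n > 0" "\<And>n. norm (x n - u) < r / Suc n"
    "\<And>n. gradient (eval F) (x n) + 2 *\<^sub>R (x n - u) =
    (\<Sum>j\<in>E. (- 2 * N n * eval (g j) (x n)) *\<^sub>R gradient (eval (g j)) (x n)) +
    (\<Sum>j\<in>I. (- 2 * N n * min (eval (g j) (x n)) 0) *\<^sub>R gradient (eval (g j)) (x n))"
    by blast
  define lam where "lam n j = (if j \<in> E then - 2 * N n * eval (g j) (x n)
      else - 2 * N n * min (eval (g j) (x n)) 0)" for n j
  define w where "w n = gradient (eval F) (x n) + 2 *\<^sub>R (x n - u)" for n
  have x_lim: "x \<longlonglongrightarrow> u"
  proof -
    have "(\<lambda>n. x n - u) \<longlonglongrightarrow> 0"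
    proof (rule Lim_null_comparison)
      show "eventually (\<lambda>n. norm (x n - u) \<le> r * (1 / Suc n)) sequentially"
        using Nx(2) by (intro always_eventually) (auto simp: less_imp_le)
      show "(\<lambda>n. r * (1 / Suc n)) \<longlonglongrightarrow> 0"
        by (intro tendsto_mult_right_zero LIMSEQ_Suc[OF lim_1_over_n])
    qed
    then show ?thesis by (simp add: LIM_zero_iff)
  qed
  have grad_lim: "(\<lambda>n. gradient (eval p) (x n)) \<longlonglongrightarrow> gradient (eval p) u" for p
    using continuous_on_tendsto_compose[OF continuous_on_gradient_eval[of UNIV p] x_lim] by simp
  have w_lim: "w \<longlonglongrightarrow> gradient (eval F) u"
  proof -
    have "w \<longlonglongrightarrow> gradient (eval F) u + 2 *\<^sub>R (u - u)"
      unfolding w_def[abs_def] by (intro tendsto_intros grad_lim x_lim)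
    then show ?thesis by simp
  qed
  have near: "norm (x n - u) < r" for n
  proof -
    have "r / Suc n \<le> r / 1" using r(1) by (intro divide_left_mono) auto
    then show ?thesis using Nx(2)[of n] by simp
  qed
  have lam_nonneg: "lam n j \<ge> 0" if "j \<in> I" for n j
  proof -
    have "N n * min (eval (g j) (x n)) 0 \<le> 0" using Nx(1)[of n] by (intro mult_nonneg_nonpos) auto
    then show ?thesis using that disj by (auto simp: lam_def)
  qed
  have w_eq: "w n = (\<Sum>j\<in>A. lam n j *\<^sub>R gradient (eval (g j)) (x n))" for n
  proof -
    have "w n = (\<Sum>j\<in>E. lam n j *\<^sub>R gradient (eval (g j)) (x n)) + (\<Sum>j\<in>I. lam n j *\<^sub>R gradient (eval (g j)) (x n))"
      unfolding w_def Nx(3)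
      by (intro arg_cong2[of _ _ _ _ "(+)"] sum.cong refl) (use disj in \<open>auto simp: lam_def\<close>)
    also have "(\<Sum>j\<in>I. lam n j *\<^sub>R gradient (eval (g j)) (x n)) = (\<Sum>j\<in>A \<inter> I. lam n j *\<^sub>R gradient (eval (g j)) (x n))"
    proof (rule sum.mono_neutral_right)
      show "\<forall>j\<in>I - A \<inter> I. lam n j *\<^sub>R gradient (eval (g j)) (x n) = 0"
      proof
        fix j assume j: "j \<in> I - A \<inter> I"
        then have "eval (g j) (x n) > 0" using r(2)[OF _ near[of n]] by blast
        then show "lam n j *\<^sub>R gradient (eval (g j)) (x n) = 0" using j disj by (auto simp: lam_def)
      qed
    qed (use fin in auto)
    also have "(\<Sum>j\<in>E. lam n j *\<^sub>R gradient (eval (g j)) (x n)) + \<dots> = (\<Sum>j\<in>E \<union> (A \<inter> I). lam n j *\<^sub>R gradient (eval (g j)) (x n))"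
      by (rule sum.union_disjoint[symmetric]) (use fin disj in auto)
    finally show ?thesis using A_eq(1) by simp
  qed
  have "\<exists>l. (\<forall>j\<in>A. (\<lambda>n. lam n j) \<longlonglongrightarrow> l j) \<and> gradient (eval F) u = (\<Sum>j\<in>A. l j *\<^sub>R gradient (eval (g j)) u)"
  proof (rule independent_combination_limit[OF A_fin _ _ _ w_lim w_eq])
    show "inj_on (\<lambda>j. gradient (eval (g j)) u) A" "independent ((\<lambda>j. gradient (eval (g j)) u) ` A)"
      using licqc unfolding LICQC_def A_def by auto
  qed (rule grad_lim)
  then obtain l where l: "\<And>j. j \<in> A \<Longrightarrow> (\<lambda>n. lam n j) \<longlonglongrightarrow> l j"
    "gradient (eval F) u = (\<Sum>j\<in>A. l j *\<^sub>R gradient (eval (g j)) u)" by blast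
  have l_nonneg: "l j \<ge> 0" if "j \<in> A" "j \<in> I" for j
    using LIMSEQ_le_const[OF l(1)[OF that(1)], of 0] lam_nonneg[OF that(2)] by blast
  define l' where "l' j = (if j \<in> A then l j else 0)" for j
  have "(\<Sum>j\<in>E \<union> I. l' j *\<^sub>R gradient (eval (g j)) u) = (\<Sum>j\<in>A. l' j *\<^sub>R gradient (eval (g j)) u)"
    by (rule sum.mono_neutral_right) (use fin A_eq in \<open>auto simp: l'_def\<close>)
  also have "\<dots> = gradient (eval F) u" unfolding l(2) by (intro sum.cong) (auto simp: l'_def)
  finally have "lagrange_multipliers (eval F) (\<lambda>j. eval (g j)) E I u l'"
    unfolding lagrange_multipliers_def using l_nonneg
    by (auto simp: l'_def A_def active_set_def)
  then show ?thesis by blast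
qed

context sphere_problem
begin

text \<open>Finsler's lemma: a form positive on the common kernel of the active gradients becomes
  positive definite after adding a large multiple of the squares of these gradients. Up to third
  order the augmented Lagrangian is such a form.\<close>

theorem optimality_conditions_imp_nondegenerate:
  assumes disj: "E \<inter> I = {}" and F0: "eval F u = 0"
    and minimizer: "global_minimizer (eval F) (\<lambda>j. eval (g j)) E I u"
    and licqc: "LICQC (\<lambda>j. eval (g j)) E I u"
    and scc: "SCC (eval F) (\<lambda>j. eval (g j)) E I u"
    and sosc: "SOSC (eval F) (\<lambda>j. eval (g j)) E I u"
  shows "nondegenerate F u"
proof -
  obtain lam where lam: "lagrange_multipliers (eval F) (\<lambda>j. eval (g j)) E I u lam"
    using lagrange_multipliers_exist[OF finite_E finite_I disj minimizer licqc] by blast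
  have E0: "\<And>j. j \<in> E \<Longrightarrow> eval (g j) u = 0"
    using minimizer by (auto simp: global_minimizer_def feasible_set_def)
  have act: "active_set (\<lambda>j. eval (g j)) E I u = E \<union> active u"
    using E0 by (auto simp: active_set_def active_def)
  have lam_pos: "lam j > 0" if "j \<in> active u" for j
  proof -
    have "j \<in> I" using that by (simp add: active_def)
    with scc[unfolded SCC_def, THEN spec, THEN mp, OF lam] have "lam j + eval (g j) u > 0" by blast
    then show ?thesis using that by (simp add: active_def)
  qed
  have lam_zero: "lam j = 0" if "j \<in> I - active u" for j
    using lam that by (auto simp: lagrange_multipliers_def active_def)
  define L where "L = F - (\<Sum>j\<in>E \<union> I. const (lam j) * g j)"
  have "(\<Sum>j\<in>E \<union> I. const (lam j) * g j) = (\<Sum>j\<in>E. const (lam j) * g j) + (\<Sum>j\<in>I. const (lam j) * g j)"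
    by (rule sum.union_disjoint[OF finite_E finite_I disj])
  also have "(\<Sum>j\<in>I. const (lam j) * g j) = (\<Sum>j\<in>active u. const (lam j) * g j)"
    by (rule sum.mono_neutral_right) (use finite_I lam_zero in \<open>auto simp: active_def\<close>)
  finally have L_eq: "L = F - (\<Sum>j\<in>E. const (lam j) * g j) - (\<Sum>j\<in>active u. const (lam j) * g j)"
    by (simp add: L_def algebra_simps)
  have L0: "eval L u = 0" using E0 F0 by (simp add: L_eq eval_simps active_def)
  have "gradient (eval L) u = 0"
    using lam by (simp add: L_def gradient_diff_eval gradient_sum_eval gradient_const_mult_eval lagrange_multipliers_def)
  then have L1: "eval (pderivs L i) u = 0" for i by (simp add: gradient_eval vec_eq_iff)
  define H where "H v = v \<bullet> (hessian (eval L) u *v v)" for v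
  have H_pos: "H v > 0" if "v \<noteq> 0" "\<forall>j\<in>E \<union> active u. v \<bullet> gradient (eval (g j)) u = 0" for v
  proof -
    have "eval L = (\<lambda>w. eval F w - (\<Sum>j\<in>E \<union> I. lam j * eval (g j) w))"
      by (auto simp: L_def eval_simps)
    then show ?thesis
      using sosc[unfolded SOSC_def act, THEN spec, THEN mp, OF lam, THEN spec, THEN mp, of v] that
      unfolding H_def by simp
  qed
  define A where "A i j = eval (pderivs (pderivs L i) j) u / 2" for i j
  have H_eq: "H v = 2 * (\<Sum>i\<in>UNIV. \<Sum>j\<in>UNIV. v $ i * v $ j * A i j)" for v
    unfolding H_def inner_hessian_eval A_def by (simp add: sum_distrib_left)
  define q where "q v = (\<Sum>j\<in>E. (v \<bullet> gradient (eval (g j)) u)\<^sup>2) + (\<Sum>j\<in>active u. (v \<bullet> gradient (eval (g j)) u)\<^sup>2)" for v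
  have cont: "continuous_on X H" "continuous_on X q" for X
    unfolding H_eq q_def by (intro continuous_intros)+
  have q_nonneg: "q v \<ge> 0" for v by (simp add: q_def sum_nonneg)
  have "\<exists>C>0. \<forall>v\<in>sphere 0 1. H v + C * q v > 0"
  proof (intro compact_penalty compact_sphere cont q_nonneg)
    fix v :: "real ^ 'm" assume v: "v \<in> sphere 0 1" "q v = 0"
    have "(\<Sum>j\<in>E. (v \<bullet> gradient (eval (g j)) u)\<^sup>2) = 0" "(\<Sum>j\<in>active u. (v \<bullet> gradient (eval (g j)) u)\<^sup>2) = 0"
      using v(2) by (auto simp: q_def sum_nonneg add_nonneg_eq_0_iff)
    then have "\<forall>j\<in>E \<union> active u. v \<bullet> gradient (eval (g j)) u = 0"
      using finite_E finite_active by (auto simp: sum_nonneg_eq_0_iff)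
    then show "H v > 0" using v(1) by (intro H_pos) auto
  qed
  then obtain C where C: "\<And>v. v \<in> sphere 0 1 \<Longrightarrow> H v + C * q v > 0" by blast
  have "\<exists>d>0. \<forall>v\<in>sphere 0 1. d \<le> H v + C * q v"
    by (intro compact_pos_lower_bound compact_sphere continuous_intros cont C)
  then obtain d where d: "d > 0" "\<And>v. v \<in> sphere 0 1 \<Longrightarrow> d \<le> H v + C * q v" by blast
  have lower: "d * (norm v)\<^sup>2 \<le> H v + C * q v" for v
  proof (cases "v = 0")
    case False
    have scale: "H (t *\<^sub>R v) = t\<^sup>2 * H v" "q (t *\<^sub>R v) = t\<^sup>2 * q v" for t v
      by (simp_all add: H_eq q_def sum_distrib_left power2_eq_square algebra_simps)
    have "(norm v)\<^sup>2 * d \<le> (norm v)\<^sup>2 * (H (v /\<^sub>R norm v) + C * q (v /\<^sub>R norm v))"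
      using False by (intro mult_left_mono d) auto
    also have "\<dots> = H (norm v *\<^sub>R (v /\<^sub>R norm v)) + C * q (norm v *\<^sub>R (v /\<^sub>R norm v))"
      unfolding scale by (simp only: distrib_left mult.left_commute)
    also have "norm v *\<^sub>R (v /\<^sub>R norm v) = v" using False by simp
    finally show ?thesis by (simp add: mult.commute)
  qed (simp add: H_eq q_def)
  define lin where "lin j = (\<Sum>i\<in>UNIV. shift u i * const (eval (pderivs (g j) i) u))" for j
  have eval_lin: "eval (lin j) x = (x - u) \<bullet> gradient (eval (g j)) u" for j x
    by (simp add: lin_def eval_simps inner_gradient_eval)
  \<comment> \<open>The factor is \<open>C / 2\<close> because the quadratic Taylor term of
    \<open>L\<close> is half of \<open>H\<close>.\<close>
  define T where "T = quad u A + const (C / 2) * ((\<Sum>j\<in>E. (lin j)\<^sup>2) + (\<Sum>j\<in>active u. (lin j)\<^sup>2))"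
  have "eval T x = (H (x - u) + C * q (x - u)) / 2" for x
    by (simp add: T_def eval_simps eval_quad H_eq q_def eval_lin)
  then have "quad_pos u T"
    unfolding quad_pos_def using d(1) lower
    by (intro exI[of _ "d / 2"] conjI exI[of _ 1]) (auto simp: field_simps)
  moreover have "vanishes u 3 (aug_lagrangian F lam (C / 2) u - T)"
  proof -
    have sq: "vanishes u 3 ((g j)\<^sup>2 - (lin j)\<^sup>2)" if "j \<in> E \<union> active u" for j
    proof -
      have g0: "eval (g j) u = 0" using that E0 by (auto simp: active_def)
      have "vanishes u 2 (g j - lin j)" using taylor_gradient[of u "g j"] g0 by (simp add: lin_def)
      moreover have "vanishes u 1 (g j + lin j)"
        unfolding vanishes_1_iff by (simp add: eval_simps g0 eval_lin)
      ultimately have "vanishes u (2 + 1) ((g j - lin j) * (g j + lin j))" by (rule vanishes_mult)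
      then have "vanishes u 3 ((g j - lin j) * (g j + lin j))" by (rule vanishes_mono) simp
      then show ?thesis by (simp add: power2_eq_square algebra_simps)
    qed
    have "vanishes u 3 (L - quad u A)"
      using taylor_gradient_hessian[of u L] by (simp add: L0 L1 A_def[abs_def])
    then have "vanishes u 3 ((L - quad u A) + const (C / 2) *
        ((\<Sum>j\<in>E. (g j)\<^sup>2 - (lin j)\<^sup>2) + (\<Sum>j\<in>active u. (g j)\<^sup>2 - (lin j)\<^sup>2)))"
      by (intro vanishes_add vanishes_mult_left vanishes_sum sq) auto
    also have "(L - quad u A) + const (C / 2) *
        ((\<Sum>j\<in>E. (g j)\<^sup>2 - (lin j)\<^sup>2) + (\<Sum>j\<in>active u. (g j)\<^sup>2 - (lin j)\<^sup>2)) = aug_lagrangian F lam (C / 2) u - T"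
      by (simp add: aug_lagrangian_def T_def L_eq sum_subtractf algebra_simps)
    finally show ?thesis .
  qed
  ultimately have "quad_pos u (T + (aug_lagrangian F lam (C / 2) u - T))" by (rule quad_pos_add)
  then have "quad_pos u (aug_lagrangian F lam (C / 2) u)" by simp
  then show ?thesis unfolding nondegenerate_def using lam_pos by blast
qed

end

section \<open>Homogenization\<close>

lemma prod_UNIV_option: "(\<Prod>i\<in>UNIV. h i) = h None * (\<Prod>i\<in>UNIV. h (Some i))"
  for h :: "'n::finite option \<Rightarrow> real"
  by (simp add: UNIV_option_conv prod.reindex)

lemma sum_UNIV_option: "(\<Sum>i\<in>UNIV. h i) = h None + (\<Sum>i\<in>UNIV. h (Some i))"
  for h :: "'n::finite option \<Rightarrow> real"
  by (simp add: UNIV_option_conv sum.reindex)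

text \<open>Holds also for x0 = 0, where the identity that divides by x0 gives no
  information.\<close>

lemma eval_homogenize_explicit:
  fixes p :: "'n::finite rpoly"
  shows "eval (homogenize p) u = (\<Sum>m\<in>Poly_Mapping.keys p. Poly_Mapping.lookup p m *
    ((u $ None) ^ (tdeg p - mdeg m) * (\<Prod>i\<in>UNIV. (u $ Some i) ^ Poly_Mapping.lookup m i)))"
  unfolding homogenize_def eval_sum eval_single prod_UNIV_option
  by (intro sum.cong refl) (simp add: lookup_add lookup_sum lookup_single when_def sum.delta)

lemma eval_homogenize_scale: "eval (homogenize p) (t *\<^sub>R u) = t ^ tdeg p * eval (homogenize p) u"
proof -
  have deg: "t ^ tdeg p = t ^ (tdeg p - mdeg m) * (\<Prod>i\<in>UNIV. t ^ Poly_Mapping.lookup m i)"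
    if "m \<in> Poly_Mapping.keys p" for m
  proof -
    have "t ^ tdeg p = t ^ (tdeg p - mdeg m) * t ^ mdeg m"
      using mdeg_le_tdeg[OF that] by (simp flip: power_add)
    then show ?thesis by (simp add: mdeg_def power_sum)
  qed
  show ?thesis
    unfolding eval_homogenize_explicit sum_distrib_left
  proof (intro sum.cong refl)
    fix m assume m: "m \<in> Poly_Mapping.keys p"
    show "Poly_Mapping.lookup p m * (((t *\<^sub>R u) $ None) ^ (tdeg p - mdeg m) *
        (\<Prod>i\<in>UNIV. ((t *\<^sub>R u) $ Some i) ^ Poly_Mapping.lookup m i)) =
      t ^ tdeg p * (Poly_Mapping.lookup p m * ((u $ None) ^ (tdeg p - mdeg m) *
        (\<Prod>i\<in>UNIV. (u $ Some i) ^ Poly_Mapping.lookup m i)))"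
      unfolding deg[OF m] by (simp add: power_mult_distrib prod.distrib)
  qed
qed

lemma eval_homogenize_uminus: "eval (homogenize p) (- u) = (- 1) ^ tdeg p * eval (homogenize p) u"
  using eval_homogenize_scale[of p "- 1" u] by simp

lemma eval_homogenize_infinity:
  fixes p :: "'n::finite rpoly"
  assumes "u $ None = 0"
  shows "eval (homogenize p) u = eval (leading_form p) (\<chi> i. u $ Some i)"
proof -
  have "eval (homogenize p) u = (\<Sum>m\<in>Poly_Mapping.keys p. if mdeg m = tdeg p
      then Poly_Mapping.lookup p m * (\<Prod>i\<in>UNIV. (u $ Some i) ^ Poly_Mapping.lookup m i) else 0)"
    unfolding eval_homogenize_explicit
  proof (intro sum.cong refl)
    fix m assume "m \<in> Poly_Mapping.keys p"
    from mdeg_le_tdeg[OF this] show "Poly_Mapping.lookup p m *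
        ((u $ None) ^ (tdeg p - mdeg m) * (\<Prod>i\<in>UNIV. (u $ Some i) ^ Poly_Mapping.lookup m i)) =
        (if mdeg m = tdeg p then Poly_Mapping.lookup p m * (\<Prod>i\<in>UNIV. (u $ Some i) ^ Poly_Mapping.lookup m i) else 0)"
      by (simp add: assms power_0_left)
  qed
  then show ?thesis
    unfolding leading_form_def eval_sum eval_single by (simp add: sum.inter_filter)
qed

definition hom_poly :: "('i \<Rightarrow> 'n::finite rpoly) \<Rightarrow> 'i hom_index \<Rightarrow> 'n option rpoly" where
  "hom_poly c j = (case j of Orig i \<Rightarrow> homogenize (c i) | Sphere \<Rightarrow> (\<Sum>i\<in>UNIV. (var i)\<^sup>2) - 1 | X0 \<Rightarrow> var None)"

lemma hom_poly_simps [simp]: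
  "hom_poly c (Orig i) = homogenize (c i)"
  "hom_poly c X0 = var None"
  by (simp_all add: hom_poly_def)

lemma eval_hom_poly_Sphere [simp]: "eval (hom_poly c Sphere) u = (norm u)\<^sup>2 - 1"
  by (simp add: hom_poly_def eval_simps norm_vec_def L2_set_def sum_nonneg)

lemma hom_constraint_eq: "hom_constraint c = (\<lambda>j. eval (hom_poly c j))"
proof (intro ext)
  show "hom_constraint c j u = eval (hom_poly c j) u" for j u
    by (cases j) (simp_all del: eval_var, simp)
qed

definition hom_objective_poly :: "'n::finite rpoly \<Rightarrow> real \<Rightarrow> 'n option rpoly" where
  "hom_objective_poly f a = homogenize f - const a * var None ^ tdeg f"

lemma hom_objective_eq: "hom_objective f a = eval (hom_objective_poly f a)"
  by (rule ext) (simp add: hom_objective_def hom_objective_poly_def eval_simps)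

text \<open>Odd inequality constraints are multiplied by \<open>x\<^sub>0\<close>. This does not change the feasible points with \<open>x\<^sub>0 > 0\<close>
  and makes the problem invariant under \<open>x \<mapsto> - x\<close>.\<close>

definition even_constraint :: "('i \<Rightarrow> 'n::finite rpoly) \<Rightarrow> 'i set \<Rightarrow> 'i hom_index \<Rightarrow> 'n option rpoly" where
  "even_constraint c I j =
    (if j \<in> Orig ` {i \<in> I. odd (tdeg (c i))} then var None * hom_poly c j else hom_poly c j)"

text \<open>The signs \<open>s j\<close> of the equality constraints pass to their multipliers,
  which are free in sign. Inequality constraints are invariant, so their multipliers stay
  positive.\<close>

lemma (in sphere_problem) nondegenerate_reflect:
  assumes nd: "nondegenerate F u" and disj: "E \<inter> I = {}"
    and F: "\<And>x. eval F (- x) = eval F x"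
    and gI: "\<And>j x. j \<in> I \<Longrightarrow> eval (g j) (- x) = eval (g j) x"
    and gE: "\<And>j x. j \<in> E \<Longrightarrow> eval (g j) (- x) = s j * eval (g j) x" and s: "\<And>j. s j * s j = (1::real)"
  shows "nondegenerate F (- u)"
proof -
  obtain lam C where lam: "\<forall>j\<in>active u. lam j > 0" and qp: "quad_pos u (aug_lagrangian F lam C u)"
    using nd unfolding nondegenerate_def by blast
  have act: "active (- u) = active u" using gI by (auto simp: active_def)
  define lam' where "lam' j = (if j \<in> E then s j * lam j else lam j)" for j
  have eq: "eval (aug_lagrangian F lam' C (- u)) x = eval (aug_lagrangian F lam C u) (- x)" for x
  proof -
    have "(\<Sum>j\<in>E. lam' j * eval (g j) x) = (\<Sum>j\<in>E. lam j * eval (g j) (- x))"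
      by (intro sum.cong refl) (simp add: lam'_def gE)
    moreover have "(\<Sum>j\<in>active u. lam' j * eval (g j) x) = (\<Sum>j\<in>active u. lam j * eval (g j) (- x))"
      using disj by (intro sum.cong refl) (auto simp: lam'_def gI active_def)
    moreover have "(\<Sum>j\<in>E. (eval (g j) x)\<^sup>2) = (\<Sum>j\<in>E. (eval (g j) (- x))\<^sup>2)"
    proof (intro sum.cong refl)
      fix j assume "j \<in> E"
      then have "(eval (g j) (- x))\<^sup>2 = (s j * s j) * (eval (g j) x)\<^sup>2"
        by (simp only: gE power2_eq_square mult_ac)
      then show "(eval (g j) x)\<^sup>2 = (eval (g j) (- x))\<^sup>2" by (simp add: s)
    qed
    moreover have "(\<Sum>j\<in>active u. (eval (g j) x)\<^sup>2) = (\<Sum>j\<in>active u. (eval (g j) (- x))\<^sup>2)"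
      by (intro sum.cong refl) (auto simp: gI active_def)
    ultimately show ?thesis by (simp add: aug_lagrangian_def act eval_simps F)
  qed
  obtain d r where d: "d > 0" "r > 0" "\<forall>x. norm (x - u) < r \<longrightarrow> d * (norm (x - u))\<^sup>2 \<le> eval (aug_lagrangian F lam C u) x"
    using qp unfolding quad_pos_def by blast
  have "d * (norm (x - (- u)))\<^sup>2 \<le> eval (aug_lagrangian F lam' C (- u)) x" if "norm (x - (- u)) < r" for x
  proof -
    have "norm (- x - u) = norm (x - (- u))" by (metis add.commute diff_minus_eq_add minus_add_distrib norm_minus_cancel uminus_add_conv_diff)
    then show ?thesis using d(3)[rule_format, of "- x"] that by (simp add: eq)
  qed
  then have "quad_pos (- u) (aug_lagrangian F lam' C (- u))" unfolding quad_pos_def using d(1,2) by blast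
  moreover have "\<forall>j\<in>active (- u). lam' j > 0" using lam disj unfolding act by (auto simp: lam'_def active_def)
  ultimately show ?thesis unfolding nondegenerate_def by blast
qed

text \<open>Multiplying constraints by a function \<open>q\<close> that is positive at \<open>u\<close> rescales the multipliers; the error
  \<open>lam g (q / q u - 1)\<close> is absorbed by a larger penalty parameter.\<close>

lemma (in sphere_problem) nondegenerate_mult:
  assumes nd: "nondegenerate F u" and disj: "E \<inter> I = {}" and q: "eval q u > 0" and J: "J \<subseteq> I"
  shows "sphere_problem.nondegenerate (\<lambda>j. if j \<in> J then q * g j else g j) E I F u"
proof -
  define g' where "g' j = (if j \<in> J then q * g j else g j)" for j
  interpret P': sphere_problem g' E I
    by unfold_locales (rule finite_E finite_I)+
  obtain lam C where lam: "\<forall>j\<in>active u. lam j > 0" and qp: "quad_pos u (aug_lagrangian F lam C u)"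
    using nd unfolding nondegenerate_def by blast
  define k where "k = eval q u"
  have k: "k > 0" using q by (simp add: k_def)
  have act: "P'.active u = active u"
    using q by (auto simp: P'.active_def active_def g'_def eval_simps split: if_splits)
  define D where "D = q - const k"
  have D1: "vanishes u 1 D" unfolding vanishes_1_iff D_def k_def by (simp add: eval_simps)
  \<comment> \<open>A multiple \<open>e\<close> of the squares of \<open>D\<close> is reserved from
    the growth; it completes the square with the cross term \<open>a j * g j * D\<close> further
    down.\<close>
  have "vanishes u (1 + 1) (\<Sum>j\<in>active u. D * D)" by (intro vanishes_sum vanishes_mult D1)
  then have "vanishes u 2 (\<Sum>j\<in>active u. D * D)" by (rule vanishes_mono) simp
  from quad_pos_diff_small[OF qp this] obtain e where
    e: "e > 0" "quad_pos u (aug_lagrangian F lam C u - const e * (\<Sum>j\<in>active u. D * D))" by blast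
  define a where "a j = lam j / k" for j
  define M where "M = (\<Sum>j\<in>active u. (a j)\<^sup>2 / (4 * e))"
  have M: "(a j)\<^sup>2 / (4 * e) \<le> M" if "j \<in> active u" for j
    unfolding M_def using finite_active e(1) that by (intro member_le_sum) auto
  have M_nonneg: "M \<ge> 0" unfolding M_def using e(1) by (intro sum_nonneg) auto
  \<comment> \<open>Large enough for two purposes: \<open>C' \<ge> \<bar>C\<bar> + M\<close> serves
    the unchanged constraints, and \<open>C' * (k\<^sup>2 / 4) \<ge> \<bar>C\<bar> + M\<close> the
    multiplied ones, since \<open>q \<ge> k / 2\<close> near \<open>u\<close>.\<close>
  define C' where "C' = (\<bar>C\<bar> + M) * (1 + 4 / k\<^sup>2)"
  have C'_1: "\<bar>C\<bar> + M \<le> C'"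
  proof -
    have "(\<bar>C\<bar> + M) * 1 \<le> C'" unfolding C'_def using M_nonneg by (intro mult_left_mono) auto
    then show ?thesis by simp
  qed
  have C'_2: "\<bar>C\<bar> + M \<le> C' * (k\<^sup>2 / 4)"
  proof -
    have "C' * (k\<^sup>2 / 4) = (\<bar>C\<bar> + M) * (k\<^sup>2 / 4 + 1)" using k by (simp add: C'_def field_simps)
    also have "\<dots> \<ge> (\<bar>C\<bar> + M) * 1" using M_nonneg by (intro mult_left_mono) auto
    finally show ?thesis by simp
  qed
  define lam' where "lam' j = (if j \<in> J then a j else lam j)" for j
  from vanishesD[OF D1] obtain B where
    B: "B > 0" "\<And>x. norm (x - u) \<le> 1 \<Longrightarrow> \<bar>eval q x - k\<bar> \<le> B * norm (x - u)"
    by (auto simp: D_def eval_simps)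
  have near: "eval q x \<ge> k / 2" if x: "norm (x - u) < min 1 (k / (2 * B))" for x
  proof -
    have "B * norm (x - u) \<le> k / 2" using x B(1) by (simp add: field_simps)
    then show ?thesis using B(2)[of x] x by (simp add: abs_le_iff)
  qed
  have "quad_pos u (P'.aug_lagrangian F lam' C' u)"
  proof (rule quad_pos_mono[OF e(2)])
    show "min 1 (k / (2 * B)) > 0" using k B(1) by simp
    fix x assume x: "norm (x - u) < min 1 (k / (2 * B))"
    have E_le: "C * (\<Sum>j\<in>E. (eval (g j) x)\<^sup>2) \<le> C' * (\<Sum>j\<in>E. (eval (g j) x)\<^sup>2)"
      using C'_1 M_nonneg by (intro mult_right_mono sum_nonneg) auto
    have g'_E: "g' j = g j" "lam' j = lam j" if "j \<in> E" for j
      using that disj J by (auto simp: g'_def lam'_def)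
    have term_le: "- lam j * eval (g j) x + C * (eval (g j) x)\<^sup>2 - e * (eval D x)\<^sup>2 \<le>
        - lam' j * eval (g' j) x + C' * (eval (g' j) x)\<^sup>2" if j: "j \<in> active u" for j
    proof (cases "j \<in> J")
      case True
      let ?q = "eval q x" and ?G = "eval (g j) x"
      have "(k / 2)\<^sup>2 \<le> ?q\<^sup>2" using near[OF x] k by (intro power_mono) auto
      then have "C' * (k\<^sup>2 / 4) \<le> C' * ?q\<^sup>2"
        using C'_1 M_nonneg by (intro mult_left_mono) (auto simp: power_divide)
      then have "(C + (a j)\<^sup>2 / (4 * e)) * ?G\<^sup>2 \<le> (C' * ?q\<^sup>2) * ?G\<^sup>2"
        using C'_2 M[OF j] by (intro mult_right_mono) auto
      then have "C * ?G\<^sup>2 + (a j)\<^sup>2 / (4 * e) * ?G\<^sup>2 \<le> C' * (?q\<^sup>2 * ?G\<^sup>2)"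
        by (simp only: distrib_right mult.assoc)
      moreover have "a j * (?q * ?G) = lam j * ?G + a j * ?G * (?q - k)"
        using k by (simp add: a_def field_simps)
      moreover have "0 \<le> e * ((?q - k) - a j * ?G / (2 * e))\<^sup>2" using e(1) by simp
      moreover have "e * ((?q - k) - a j * ?G / (2 * e))\<^sup>2 =
          e * (?q - k)\<^sup>2 - a j * ?G * (?q - k) + (a j)\<^sup>2 / (4 * e) * ?G\<^sup>2"
        using e(1) by (simp add: power2_eq_square field_simps)
      ultimately have "- lam j * ?G + C * ?G\<^sup>2 - e * (?q - k)\<^sup>2 \<le> - a j * (?q * ?G) + C' * (?q\<^sup>2 * ?G\<^sup>2)"
        by linarith
      then show ?thesis using True by (simp add: lam'_def g'_def D_def eval_simps power_mult_distrib)
    next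
      case False
      have "C * (eval (g j) x)\<^sup>2 \<le> C' * (eval (g j) x)\<^sup>2"
        using C'_1 M_nonneg by (intro mult_right_mono) auto
      moreover have "0 \<le> e * (eval D x)\<^sup>2" using e(1) by simp
      ultimately show ?thesis using False by (simp add: lam'_def g'_def)
    qed
    have sum_le: "(\<Sum>j\<in>active u. - lam j * eval (g j) x + C * (eval (g j) x)\<^sup>2 - e * (eval D x)\<^sup>2) \<le>
        (\<Sum>j\<in>active u. - lam' j * eval (g' j) x + C' * (eval (g' j) x)\<^sup>2)"
      by (rule sum_mono) (rule term_le)
    have "eval (aug_lagrangian F lam C u - const e * (\<Sum>j\<in>active u. D * D)) x =
        eval F x - (\<Sum>j\<in>E. lam j * eval (g j) x) + C * (\<Sum>j\<in>E. (eval (g j) x)\<^sup>2) +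
        (\<Sum>j\<in>active u. - lam j * eval (g j) x + C * (eval (g j) x)\<^sup>2 - e * (eval D x)\<^sup>2)"
      by (simp add: aug_lagrangian_def eval_simps sum_subtractf sum.distrib sum_negf sum_distrib_left power2_eq_square algebra_simps)
    also have "\<dots> \<le> eval F x - (\<Sum>j\<in>E. lam j * eval (g j) x) + C' * (\<Sum>j\<in>E. (eval (g j) x)\<^sup>2) +
        (\<Sum>j\<in>active u. - lam' j * eval (g' j) x + C' * (eval (g' j) x)\<^sup>2)"
      using E_le sum_le by linarith
    also have "\<dots> = eval (P'.aug_lagrangian F lam' C' u) x"
      by (simp add: P'.aug_lagrangian_def act eval_simps g'_E sum_subtractf sum.distrib sum_negf sum_distrib_left algebra_simps)
    finally show "eval (aug_lagrangian F lam C u - const e * (\<Sum>j\<in>active u. D * D)) x \<le> eval (P'.aug_lagrangian F lam' C' u) x" .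
  qed
  moreover have "\<forall>j\<in>P'.active u. lam' j > 0" using lam k by (auto simp: act lam'_def a_def)
  ultimately have "P'.nondegenerate F u" unfolding P'.nondegenerate_def by blast
  then show ?thesis unfolding g'_def[abs_def] .
qed

text \<open>Boundedness from below makes the real infimum \<open>f_min\<close> a true lower bound.
  Positive degree makes the power of x0 vanish at infinity, so that \<open>F\<close> equals there
  the leading form of \<open>f\<close>.\<close>

locale homogenized_problem =
  fixes f :: "'n::finite rpoly" and c :: "'i \<Rightarrow> 'n rpoly" and E I :: "'i set"
  assumes fin: "finite E" "finite I" and disj: "E \<inter> I = {}"
    and even_deg: "even (tdeg f)" and pos_deg: "tdeg f > 0"
    and bdd: "bdd_below (eval f ` semialg_set c E I)"
begin

abbreviation "K \<equiv> semialg_set c E I"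

definition F :: "'n option rpoly" where "F = hom_objective_poly f (f_min f K)"

definition Eh :: "'i hom_index set" where "Eh = insert Sphere (Orig ` E)"
definition Ih :: "'i hom_index set" where "Ih = Orig ` I"

sublocale sphere_problem "even_constraint c I" Eh Ih
  by unfold_locales (simp_all add: Eh_def Ih_def fin)

lemma eval_F: "eval F u = eval (homogenize f) u - f_min f K * (u $ None) ^ tdeg f"
  by (simp add: F_def hom_objective_poly_def eval_simps)

lemma F_uminus: "eval F (- u) = eval F u"
  using even_deg by (simp add: eval_F eval_homogenize_uminus)

lemma F_nonneg_affine:
  assumes "u $ None > 0" "\<And>j. j \<in> E \<Longrightarrow> eval (homogenize (c j)) u = 0" "\<And>j. j \<in> I \<Longrightarrow> eval (homogenize (c j)) u \<ge> 0"
  shows "eval F u \<ge> 0"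
proof -
  define y where "y = (\<chi> i. u $ Some i / u $ None)"
  have hom: "eval (homogenize p) u = (u $ None) ^ tdeg p * eval p y" for p
    unfolding y_def using assms(1) by (intro eval_homogenize) simp
  have "\<not> (u $ None) ^ k \<le> 0" for k using assms(1) by (simp add: not_le)
  then have "y \<in> K"
    using assms by (auto simp: semialg_set_def feasible_set_def hom zero_le_mult_iff)
  then have "f_min f K \<le> eval f y" unfolding f_min_def using bdd by (intro cINF_lower)
  then have "0 \<le> (u $ None) ^ tdeg f * (eval f y - f_min f K)" using assms(1) by simp
  then show ?thesis by (simp add: eval_F hom algebra_simps)
qed

lemma even_constraint_nonneg:
  assumes "eval (even_constraint c I (Orig j)) u \<ge> 0" "u $ None > 0"
  shows "eval (homogenize (c j)) u \<ge> 0"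
  using assms by (auto simp: even_constraint_def eval_simps zero_le_mult_iff split: if_splits)

lemma even_constraint_E: "j \<in> Eh \<Longrightarrow> even_constraint c I j = hom_poly c j"
  using disj by (auto simp: even_constraint_def Eh_def)

lemma even_constraint_uminus:
  assumes "j \<in> Ih"
  shows "eval (even_constraint c I j) (- u) = eval (even_constraint c I j) u"
proof -
  obtain i where "j = Orig i" "i \<in> I" using assms by (auto simp: Ih_def)
  then show ?thesis by (auto simp: even_constraint_def eval_simps eval_homogenize_uminus image_iff)
qed

lemma even_constraint_E_uminus:
  assumes "j \<in> Eh"
  shows "eval (even_constraint c I j) (- u) =
    (case j of Orig i \<Rightarrow> (- 1) ^ tdeg (c i) | _ \<Rightarrow> 1) * eval (even_constraint c I j) u"
  unfolding even_constraint_E[OF assms]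
  using assms by (cases j) (auto simp: Eh_def eval_homogenize_uminus)

lemma feas_uminus: "u \<in> feas \<Longrightarrow> - u \<in> feas"
  by (auto simp: feas_def feasible_set_def even_constraint_uminus even_constraint_E_uminus)

lemma feas_affine:
  assumes "u \<in> feas" "u $ None > 0"
  shows "j \<in> E \<Longrightarrow> eval (homogenize (c j)) u = 0" "j \<in> I \<Longrightarrow> eval (homogenize (c j)) u \<ge> 0"
proof -
  show "eval (homogenize (c j)) u = 0" if "j \<in> E"
  proof -
    have "Orig j \<in> Eh" using that by (simp add: Eh_def)
    then have "eval (even_constraint c I (Orig j)) u = 0" using assms(1) by (simp add: feas_def feasible_set_def)
    with even_constraint_E[OF \<open>Orig j \<in> Eh\<close>] show ?thesis by simp
  qed
  show "eval (homogenize (c j)) u \<ge> 0" if "j \<in> I"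
  proof (rule even_constraint_nonneg[OF _ assms(2)])
    have "Orig j \<in> Ih" using that by (simp add: Ih_def)
    then show "eval (even_constraint c I (Orig j)) u \<ge> 0" using assms(1) by (simp add: feas_def feasible_set_def)
  qed
qed

lemma F_nonneg:
  assumes u: "u \<in> feas" and infinity: "u $ None = 0 \<longrightarrow> eval (homogenize f) u > 0"
  shows "eval F u \<ge> 0"
proof -
  consider "u $ None > 0" | "u $ None = 0" | "(- u) $ None > 0" by fastforce
  then show ?thesis
  proof cases
    case 1
    show ?thesis by (rule F_nonneg_affine[OF 1 feas_affine[OF u 1]])
  next
    case 2
    then show ?thesis using infinity pos_deg by (simp add: eval_F power_0_left)
  next
    case 3
    have "eval F (- u) \<ge> 0" by (rule F_nonneg_affine[OF 3 feas_affine[OF feas_uminus[OF u] 3]])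
    then show ?thesis by (simp add: F_uminus)
  qed
qed

text \<open>Zeros at infinity are excluded, and those with x0 < 0 are reflections of zeros with x0 >
  0. So nondegeneracy is required only where multiplying a constraint by x0 is harmless.\<close>

theorem F_in_qm:
  assumes infinity: "\<And>u. u \<in> feas \<Longrightarrow> u $ None = 0 \<Longrightarrow> eval (homogenize f) u > 0"
    and nd: "\<And>u. u \<in> feas \<Longrightarrow> u $ None > 0 \<Longrightarrow> eval F u = 0 \<Longrightarrow> nondegenerate F u"
  shows "F \<in> qm"
proof (rule nondegenerate_zeros_imp_qm)
  have at_infinity: "eval F u > 0" if "u \<in> feas" "u $ None = 0" for u
    using infinity[OF that] that(2) pos_deg by (simp add: eval_F power_0_left)
  show "eval F u \<ge> 0" if "u \<in> feas" for u
    by (rule F_nonneg[OF that]) (use infinity[OF that] in blast)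
  show "nondegenerate F u" if u: "u \<in> feas" "eval F u = 0" for u
  proof -
    consider "u $ None > 0" | "u $ None = 0" | "(- u) $ None > 0" by fastforce
    then show ?thesis
    proof cases
      case 3
      have "nondegenerate F (- (- u))"
      proof (rule nondegenerate_reflect)
        show "nondegenerate F (- u)" using nd[OF feas_uminus[OF u(1)] 3] u(2) by (simp add: F_uminus)
        show "Eh \<inter> Ih = {}" using disj by (auto simp: Eh_def Ih_def)
        show "(case j of Orig i \<Rightarrow> (- 1) ^ tdeg (c i) | _ \<Rightarrow> 1) * (case j of Orig i \<Rightarrow> (- 1) ^ tdeg (c i) | _ \<Rightarrow> 1) = (1::real)"
          for j :: "'i hom_index"
          by (cases j) (simp_all flip: power_mult_distrib)
      qed (rule F_uminus even_constraint_uminus even_constraint_E_uminus; assumption)+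
      then show ?thesis by simp
    qed (use nd u at_infinity[OF u(1)] in auto)
  qed
qed

end

section \<open>Dehomogenization\<close>

text \<open>Central projection of the affine chart x0 = 1 onto the open upper half of the
  sphere.\<close>

definition lift_sphere :: "real ^ 'n \<Rightarrow> real ^ 'n::finite option" where
  "lift_sphere y = (\<chi> j. (case j of None \<Rightarrow> 1 | Some i \<Rightarrow> y $ i) / sqrt (eval theta y))"

lemma theta_pos: "eval theta y > 0"
  by (simp add: eval_theta add_pos_nonneg)

lemma lift_sphere_nth [simp]:
  "lift_sphere y $ None = 1 / sqrt (eval theta y)" "lift_sphere y $ Some i = y $ i / sqrt (eval theta y)"
  by (simp_all add: lift_sphere_def)

lemma lift_sphere_in_sphere: "lift_sphere y \<in> sphere 0 1"
proof -
  have "(\<Sum>j\<in>UNIV. (lift_sphere y $ j)\<^sup>2) = (1 + (\<Sum>i\<in>UNIV. (y $ i)\<^sup>2)) / eval theta y"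
    using theta_pos[of y] unfolding sum_UNIV_option
    by (simp add: power_divide add_divide_distrib less_imp_le flip: sum_divide_distrib)
  also have "1 + (\<Sum>i\<in>UNIV. (y $ i)\<^sup>2) = eval theta y" by (simp add: theta_def eval_simps)
  finally show ?thesis using theta_pos[of y] by (simp add: norm_eq_1_iff_sum_squares)
qed

lemma eval_homogenize_lift: "eval (homogenize p) (lift_sphere y) = eval p y / sqrt (eval theta y) ^ tdeg p"
proof -
  have pos: "sqrt (eval theta y) > 0" using theta_pos[of y] by simp
  then have "(\<chi> i. lift_sphere y $ Some i / lift_sphere y $ None) = y" by (simp add: vec_eq_iff)
  with pos show ?thesis by (simp add: eval_homogenize power_divide)
qed

text \<open>On the lifted point a polynomial becomes \<open>A / \<theta>^N + B / (\<theta>^N sqrt \<theta>)\<close>, where the second term comes from the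
  odd part.\<close>

definition dehom :: "'n::finite option rpoly \<Rightarrow> nat \<Rightarrow> 'n rpoly \<Rightarrow> 'n rpoly \<Rightarrow> bool" where
  "dehom p N A B \<longleftrightarrow> tdeg A \<le> 2 * N \<and> tdeg B \<le> 2 * N + 1 \<and>
    (\<forall>y. eval p (lift_sphere y) * (eval theta y ^ N * sqrt (eval theta y)) = sqrt (eval theta y) * eval A y + eval B y \<and>
      eval p (- lift_sphere y) * (eval theta y ^ N * sqrt (eval theta y)) = sqrt (eval theta y) * eval A y - eval B y)"

lemma tdeg_theta_power_le: "tdeg (theta ^ k) \<le> 2 * k"
  using tdeg_power_le[OF tdeg_theta_le, of k] by (simp add: mult.commute)

lemma dehom_raise:
  assumes "dehom p N A B" "N \<le> M"
  shows "dehom p M (theta ^ (M - N) * A) (theta ^ (M - N) * B)"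
  unfolding dehom_def
proof (intro conjI allI)
  show "tdeg (theta ^ (M - N) * A) \<le> 2 * M"
    using tdeg_mult_le[OF tdeg_theta_power_le, of A "2 * N" "M - N"] assms by (simp add: dehom_def)
  show "tdeg (theta ^ (M - N) * B) \<le> 2 * M + 1"
    using tdeg_mult_le[OF tdeg_theta_power_le, of B "2 * N + 1" "M - N"] assms by (simp add: dehom_def)
  fix y :: "real ^ 'a"
  have pw: "eval theta y ^ M = eval theta y ^ (M - N) * eval theta y ^ N"
    using assms(2) by (simp flip: power_add)
  have "eval p (lift_sphere y) * (eval theta y ^ M * sqrt (eval theta y)) =
      eval theta y ^ (M - N) * (eval p (lift_sphere y) * (eval theta y ^ N * sqrt (eval theta y)))"
    unfolding pw by (simp only: mult_ac)
  also have "\<dots> = eval theta y ^ (M - N) * (sqrt (eval theta y) * eval A y + eval B y)"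
    using assms(1) by (simp add: dehom_def)
  finally show "eval p (lift_sphere y) * (eval theta y ^ M * sqrt (eval theta y)) =
      sqrt (eval theta y) * eval (theta ^ (M - N) * A) y + eval (theta ^ (M - N) * B) y"
    by (simp add: eval_simps algebra_simps)
  have "eval p (- lift_sphere y) * (eval theta y ^ M * sqrt (eval theta y)) =
      eval theta y ^ (M - N) * (eval p (- lift_sphere y) * (eval theta y ^ N * sqrt (eval theta y)))"
    unfolding pw by (simp only: mult_ac)
  also have "\<dots> = eval theta y ^ (M - N) * (sqrt (eval theta y) * eval A y - eval B y)"
    using assms(1) by (simp add: dehom_def)
  finally show "eval p (- lift_sphere y) * (eval theta y ^ M * sqrt (eval theta y)) =
      sqrt (eval theta y) * eval (theta ^ (M - N) * A) y - eval (theta ^ (M - N) * B) y"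
    by (simp add: eval_simps algebra_simps)
qed

text \<open>Values at a lift lie in the quadratic extension by the square root \<open>r\<close> of
  theta, and passing to the antipode is conjugation. In a product, \<open>r\<^sup>2\<close> is
  replaced by theta, which accounts for the exponent \<open>N + N' + 1\<close>.\<close>

lemma dehom_exists:
  fixes p :: "'n::finite option rpoly"
  shows "\<exists>N A B. dehom p N A B"
proof (induction p rule: rpoly_induct)
  case (const a)
  have "dehom (const a) 0 (const a) (const 0 :: 'n rpoly)"
    unfolding dehom_def by (simp add: tdeg_le_iff)
  then show ?case by blast
next
  case (var i)
  have r: "sqrt (eval theta y) \<noteq> 0" for y :: "real ^ 'n" using theta_pos[of y] by simp
  show ?case
  proof (cases i)
    case None
    have "dehom (var i) 0 0 (1 :: 'n rpoly)"
      unfolding dehom_def None using r by simp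
    then show ?thesis by blast
  next
    case (Some k)
    have "dehom (var i) 0 0 (var k :: 'n rpoly)"
      unfolding dehom_def Some using r tdeg_var_le[of k] by simp
    then show ?thesis by blast
  qed
next
  case (add p q)
  then obtain N A0 B0 N' A0' B0' where 0: "dehom p N A0 B0" "dehom q N' A0' B0'" by blast
  obtain A B where 1: "dehom p (max N N') A B" using dehom_raise[OF 0(1), of "max N N'"] by auto
  obtain A' B' where 2: "dehom q (max N N') A' B'" using dehom_raise[OF 0(2), of "max N N'"] by auto
  have "dehom (p + q) (max N N') (A + A') (B + B')"
    using 1 2 unfolding dehom_def by (simp add: eval_add distrib_left distrib_right tdeg_add_le)
  then show ?case by blast
next
  case (mult p q)
  then obtain N A B N' A' B' where h: "dehom p N A B" "dehom q N' A' B'" by blast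
  have deg: "tdeg A \<le> 2 * N" "tdeg B \<le> 2 * N + 1" "tdeg A' \<le> 2 * N'" "tdeg B' \<le> 2 * N' + 1"
    using h by (auto simp: dehom_def)
  have "dehom (p * q) (N + N' + 1) (theta * (A * A') + B * B') (theta * (A * B' + B * A'))"
    unfolding dehom_def
  proof (intro conjI allI)
    show "tdeg (theta * (A * A') + B * B') \<le> 2 * (N + N' + 1)"
      using tdeg_mult_le[OF tdeg_theta_le tdeg_mult_le[OF deg(1,3)]] tdeg_mult_le[OF deg(2,4)]
      by (intro tdeg_add_le) auto
    have "tdeg (A * B' + B * A') \<le> 2 * (N + N') + 1"
      using tdeg_mult_le[OF deg(1,4)] tdeg_mult_le[OF deg(2,3)] by (intro tdeg_add_le) auto
    from tdeg_mult_le[OF tdeg_theta_le this]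
    show "tdeg (theta * (A * B' + B * A')) \<le> 2 * (N + N' + 1) + 1" by simp
    fix y :: "real ^ 'n"
    define r where "r = sqrt (eval theta y)"
    have r: "r * r = eval theta y" using theta_pos[of y] by (simp add: r_def)
    have comb: "a * a' * (eval theta y ^ (N + N' + 1) * r) = r * (eval theta y * (X * X') + Y * Y') + eval theta y * (X * Y' + Y * X')"
      if "a * (eval theta y ^ N * r) = r * X + Y" "a' * (eval theta y ^ N' * r) = r * X' + Y'" for a a' X Y X' Y'
    proof -
      have "a * a' * (eval theta y ^ (N + N' + 1) * r) = (a * (eval theta y ^ N * r)) * (a' * (eval theta y ^ N' * r)) * r"
        unfolding power_add r[symmetric] by (simp add: algebra_simps)
      also have "\<dots> = (r * X + Y) * (r * X' + Y') * r" unfolding that ..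
      also have "\<dots> = r * (r * r * (X * X') + Y * Y') + r * r * (X * Y' + Y * X')" by (simp add: algebra_simps)
      finally show ?thesis unfolding r .
    qed
    have 1: "eval p (lift_sphere y) * (eval theta y ^ N * r) = r * eval A y + eval B y"
      "eval q (lift_sphere y) * (eval theta y ^ N' * r) = r * eval A' y + eval B' y"
      "eval p (- lift_sphere y) * (eval theta y ^ N * r) = r * eval A y + (- eval B y)"
      "eval q (- lift_sphere y) * (eval theta y ^ N' * r) = r * eval A' y + (- eval B' y)"
      using h by (simp_all add: dehom_def r_def)
    show "eval (p * q) (lift_sphere y) * (eval theta y ^ (N + N' + 1) * sqrt (eval theta y)) =
        sqrt (eval theta y) * eval (theta * (A * A') + B * B') y + eval (theta * (A * B' + B * A')) y"
      using comb[OF 1(1,2)] by (simp add: eval_simps r_def)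
    show "eval (p * q) (- lift_sphere y) * (eval theta y ^ (N + N' + 1) * sqrt (eval theta y)) =
        sqrt (eval theta y) * eval (theta * (A * A') + B * B') y - eval (theta * (A * B' + B * A')) y"
      using comb[OF 1(3,4)] by (simp add: eval_simps r_def algebra_simps)
  qed
  then show ?case by blast
qed

text \<open>The combination selects the even or the odd part of \<open>q\<close> by the parity of
  \<open>e\<close>. The power of \<open>sqrt (eval theta y)\<close> that remains cancels the
  denominator of a homogenized equality constraint of degree \<open>e\<close>, and the cofactor
  loses \<open>e\<close> in its degree bound.\<close>

lemma dehom_parity:
  fixes q :: "'n::finite option rpoly"
  shows "\<exists>N. \<forall>M\<ge>N. \<exists>\<tau>. tdeg \<tau> + e \<le> 2 * M \<and> (\<forall>y. (eval q (lift_sphere y) + (- 1) ^ e * eval q (- lift_sphere y)) / 2 *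
    eval theta y ^ M = eval \<tau> y * sqrt (eval theta y) ^ e)"
proof -
  obtain N A B where h: "dehom q N A B" using dehom_exists by blast
  define m where "m = e div 2"
  show ?thesis
  proof (rule exI[of _ "N + m + 1"], intro allI impI)
    fix M assume M: "N + m + 1 \<le> M"
    show "\<exists>\<tau>. tdeg \<tau> + e \<le> 2 * M \<and> (\<forall>y. (eval q (lift_sphere y) + (- 1) ^ e * eval q (- lift_sphere y)) / 2 *
      eval theta y ^ M = eval \<tau> y * sqrt (eval theta y) ^ e)"
    proof (cases "even e")
      case True
      then have e: "e = 2 * m" by (simp add: m_def)
      have h': "dehom q (M - m) (theta ^ (M - m - N) * A) (theta ^ (M - m - N) * B)"
        using M by (intro dehom_raise h) simp
      have "(eval q (lift_sphere y) + (- 1) ^ e * eval q (- lift_sphere y)) / 2 * eval theta y ^ M =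
          eval (theta ^ (M - m - N) * A) y * sqrt (eval theta y) ^ e" for y
      proof -
        let ?r = "sqrt (eval theta y)"
        have r: "?r > 0" "?r ^ e = eval theta y ^ m" using theta_pos[of y] by (simp_all add: e power_mult)
        have cancel: "a / 2 * b = x" if "a * (b * ?r) = 2 * (?r * x)" for a b x
        proof -
          have "?r * (a * b) = ?r * (2 * x)" using that by (simp only: mult_ac)
          then have "a * b = 2 * x" using r(1) by (simp only: mult_cancel_left) auto
          then show ?thesis by simp
        qed
        have "(eval q (lift_sphere y) + eval q (- lift_sphere y)) * (eval theta y ^ (M - m) * ?r) =
            2 * (?r * eval (theta ^ (M - m - N) * A) y)"
          using h' by (simp add: dehom_def distrib_right)
        then have "(eval q (lift_sphere y) + eval q (- lift_sphere y)) / 2 * eval theta y ^ (M - m) =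
            eval (theta ^ (M - m - N) * A) y"
          by (rule cancel)
        moreover have "eval theta y ^ M = eval theta y ^ (M - m) * eval theta y ^ m"
          using M by (simp flip: power_add)
        ultimately show ?thesis using True by (simp add: r(2))
      qed
      moreover have "tdeg (theta ^ (M - m - N) * A) \<le> 2 * (M - m)"
        using h' unfolding dehom_def by blast
      then have "tdeg (theta ^ (M - m - N) * A) + e \<le> 2 * M" using M e by arith
      ultimately show ?thesis by blast
    next
      case False
      then have e: "e = 2 * m + 1" by (simp add: m_def)
      have h': "dehom q (M - m - 1) (theta ^ (M - m - 1 - N) * A) (theta ^ (M - m - 1 - N) * B)"
        using M by (intro dehom_raise h) simp
      have "(eval q (lift_sphere y) + (- 1) ^ e * eval q (- lift_sphere y)) / 2 * eval theta y ^ M =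
          eval (theta ^ (M - m - 1 - N) * B) y * sqrt (eval theta y) ^ e" for y
      proof -
        let ?r = "sqrt (eval theta y)"
        have r: "?r * ?r = eval theta y" "?r ^ e = eval theta y ^ m * ?r"
          using theta_pos[of y] by (simp_all add: e power_mult)
        have "(eval q (lift_sphere y) - eval q (- lift_sphere y)) * (eval theta y ^ (M - m - 1) * ?r) =
            2 * eval (theta ^ (M - m - 1 - N) * B) y"
          using h' by (simp add: dehom_def left_diff_distrib)
        then have *: "(eval q (lift_sphere y) - eval q (- lift_sphere y)) / 2 * (eval theta y ^ (M - m - 1) * ?r) =
            eval (theta ^ (M - m - 1 - N) * B) y" by simp
        have "M = (M - m - 1) + m + 1" using M by simp
        then have "eval theta y ^ M = eval theta y ^ (M - m - 1) * eval theta y ^ m * (?r * ?r)"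
          unfolding r by (metis power_add power_one_right)
        then show ?thesis using False unfolding *[symmetric] r(2) by (simp add: mult_ac)
      qed
      moreover have "tdeg (theta ^ (M - m - 1 - N) * B) \<le> 2 * (M - m - 1) + 1"
        using h' unfolding dehom_def by blast
      then have "tdeg (theta ^ (M - m - 1 - N) * B) + e \<le> 2 * M" using M e by arith
      ultimately show ?thesis by blast
    qed
  qed
qed

lemma theta_sos: "theta \<in> sos"
  using sos_square[of 1] unfolding theta_def by (intro sos_add sos_sum sos_square) simp

lemma theta_power_sos: "theta ^ k \<in> sos"
  using sos_square[of 1] by (induction k) (auto intro: sos_mult theta_sos)

text \<open>For a single square the cross term \<open>2 * r * A * B\<close> cancels in the mean over
  the two lifts, and \<open>theta * A\<^sup>2 + B\<^sup>2\<close> remains: a sum of squares without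
  roots.\<close>

lemma dehom_sos:
  fixes s :: "'n::finite option rpoly"
  assumes "s \<in> sos"
  shows "\<exists>N. \<forall>M\<ge>N. \<exists>\<sigma>\<in>sos. tdeg \<sigma> \<le> 2 * M \<and>
    (\<forall>y. (eval s (lift_sphere y) + eval s (- lift_sphere y)) / 2 * eval theta y ^ M = eval \<sigma> y)"
proof -
  let ?P = "\<lambda>s N \<sigma>. \<sigma> \<in> sos \<and> tdeg \<sigma> \<le> 2 * N \<and>
    (\<forall>y :: real ^ 'n. (eval s (lift_sphere y) + eval s (- lift_sphere y)) / 2 * eval theta y ^ N = eval \<sigma> y)"
  have raise: "?P s M (theta ^ (M - N) * \<sigma>)" if "?P s N \<sigma>" "N \<le> M" for s M N and \<sigma> :: "'n rpoly"
  proof (intro conjI allI)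
    show "theta ^ (M - N) * \<sigma> \<in> sos" using that by (intro sos_mult theta_power_sos) simp
    show "tdeg (theta ^ (M - N) * \<sigma>) \<le> 2 * M"
      using tdeg_mult_le[OF tdeg_theta_power_le, of \<sigma> "2 * N" "M - N"] that by simp
    fix y :: "real ^ 'n"
    have "eval theta y ^ M = eval theta y ^ (M - N) * eval theta y ^ N" using that(2) by (simp flip: power_add)
    then have "(eval s (lift_sphere y) + eval s (- lift_sphere y)) / 2 * eval theta y ^ M =
      eval theta y ^ (M - N) * ((eval s (lift_sphere y) + eval s (- lift_sphere y)) / 2 * eval theta y ^ N)"
      by (simp only: mult_ac)
    also have "(eval s (lift_sphere y) + eval s (- lift_sphere y)) / 2 * eval theta y ^ N = eval \<sigma> y"
      using that(1) by blast
    finally show "(eval s (lift_sphere y) + eval s (- lift_sphere y)) / 2 * eval theta y ^ M = eval (theta ^ (M - N) * \<sigma>) y"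
      by (simp only: eval_mult eval_power)
  qed
  have square: "\<exists>N \<sigma>. ?P (q\<^sup>2) N \<sigma>" for q :: "'n option rpoly"
  proof -
    obtain N A B where h: "dehom q N A B" using dehom_exists by blast
    have "?P (q\<^sup>2) (2 * N + 1) (theta * A\<^sup>2 + B\<^sup>2)"
    proof (intro conjI allI)
      show "theta * A\<^sup>2 + B\<^sup>2 \<in> sos" by (intro sos_add sos_mult theta_sos sos_square)
      have "tdeg A \<le> 2 * N" "tdeg B \<le> 2 * N + 1" using h by (auto simp: dehom_def)
      from tdeg_mult_le[OF tdeg_theta_le tdeg_power_le[OF this(1), of 2]] tdeg_power_le[OF this(2), of 2]
      show "tdeg (theta * A\<^sup>2 + B\<^sup>2) \<le> 2 * (2 * N + 1)" by (intro tdeg_add_le) auto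
      fix y :: "real ^ 'n"
      define r where "r = sqrt (eval theta y)"
      have r: "r * r = eval theta y" using theta_pos[of y] by (simp add: r_def)
      have "(eval theta y ^ N * r) * (eval theta y ^ N * r) = (eval theta y ^ N * eval theta y ^ N) * (r * r)"
        by (simp only: mult_ac)
      also have "\<dots> = eval theta y ^ (2 * N + 1)" unfolding r by (simp add: mult_2 power_add)
      finally have "eval theta y ^ (2 * N + 1) = (eval theta y ^ N * r) * (eval theta y ^ N * r)" ..
      then have "((eval q (lift_sphere y))\<^sup>2 + (eval q (- lift_sphere y))\<^sup>2) / 2 * eval theta y ^ (2 * N + 1) =
          ((eval q (lift_sphere y) * (eval theta y ^ N * r))\<^sup>2 + (eval q (- lift_sphere y) * (eval theta y ^ N * r))\<^sup>2) / 2"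
        by (simp add: power2_eq_square algebra_simps)
      also have "\<dots> = ((r * eval A y + eval B y)\<^sup>2 + (r * eval A y - eval B y)\<^sup>2) / 2"
        using h by (simp add: dehom_def r_def)
      also have "\<dots> = (r * r) * (eval A y)\<^sup>2 + (eval B y)\<^sup>2" by (simp add: power2_eq_square field_simps)
      finally show "(eval (q\<^sup>2) (lift_sphere y) + eval (q\<^sup>2) (- lift_sphere y)) / 2 * eval theta y ^ (2 * N + 1) =
          eval (theta * A\<^sup>2 + B\<^sup>2) y"
        by (simp add: eval_simps r)
    qed
    then show ?thesis by blast
  qed
  obtain l :: nat and q where s: "s = (\<Sum>i<l. (q i)\<^sup>2)" using assms by (auto simp: sos_def)
  have "\<exists>N \<sigma>. ?P (\<Sum>i<k. (q i)\<^sup>2) N \<sigma>" for k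
  proof (induction k)
    case 0
    have "?P (\<Sum>i<0. (q i)\<^sup>2) 0 0" by simp
    then show ?case by blast
  next
    case (Suc k)
    then obtain N \<sigma> where 1: "?P (\<Sum>i<k. (q i)\<^sup>2) N \<sigma>" by blast
    obtain N' \<sigma>' where 2: "?P ((q k)\<^sup>2) N' \<sigma>'" using square by blast
    have "?P (\<Sum>i<Suc k. (q i)\<^sup>2) (max N N') (theta ^ (max N N' - N) * \<sigma> + theta ^ (max N N' - N') * \<sigma>')"
      using raise[OF 1, of "max N N'"] raise[OF 2, of "max N N'"]
      by (auto simp: eval_add algebra_simps add_divide_distrib intro: sos_add tdeg_add_le)
    then show ?case by blast
  qed
  then obtain N \<sigma> where "?P s N \<sigma>" unfolding s by blast
  from raise[OF this] show ?thesis by blast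
qed

lemma finite_uniform_nat:
  assumes "finite A" "\<And>i. i \<in> A \<Longrightarrow> \<exists>N::nat. \<forall>M\<ge>N. P i M"
  shows "\<exists>N. \<forall>M\<ge>N. \<forall>i\<in>A. P i M"
proof -
  have "\<forall>i\<in>A. \<forall>\<^sub>F M in sequentially. P i M" using assms(2) by (simp add: eventually_sequentially)
  then have "\<forall>\<^sub>F M in sequentially. \<forall>i\<in>A. P i M" using assms(1) by (simp add: eventually_ball_finite_distrib)
  then show ?thesis by (simp add: eventually_sequentially)
qed

section \<open>Certificates with denominators\<close>

context homogenized_problem
begin

theorem F_in_qm_imp_certificate:
  assumes "F \<in> qm"
  shows "\<exists>k0. \<forall>k\<ge>k0. theta ^ k * (f - const (f_min f K)) \<in>
    ideal_trunc c E (int (2 * k + tdeg f)) + qmodule_trunc c I (int (2 * k + tdeg f))"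
proof -
  obtain s0 s q where s0: "s0 \<in> sos" and s: "\<And>j. j \<in> Ih \<Longrightarrow> s j \<in> sos" and
    F_eq: "\<And>x. x \<in> sphere 0 1 \<Longrightarrow> eval F x = eval s0 x +
      (\<Sum>j\<in>Ih. eval (even_constraint c I j) x * eval (s j) x) + (\<Sum>j\<in>Eh. eval (even_constraint c I j) x * eval (q j) x)"
    using assms unfolding qm_def by blast
  define \<delta> where "\<delta> = tdeg f div 2"
  have d: "tdeg f = 2 * \<delta>" using even_deg by (simp add: \<delta>_def)
  \<comment> \<open>Rounded up, because inequalities of odd degree were multiplied by x0 and so
    carry one more factor \<open>1 / sqrt (eval theta y)\<close>.\<close>
  define e where "e i = (tdeg (c i) + 1) div 2" for i
  have e: "tdeg (c i) \<le> 2 * e i" for i by (simp add: e_def)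
  define avg where "avg p y = (eval p (lift_sphere y) + eval p (- lift_sphere y)) / 2" for p :: "'n option rpoly" and y
  obtain N0 where N0: "\<And>M. M \<ge> N0 \<Longrightarrow> \<exists>\<sigma>\<in>sos. tdeg \<sigma> \<le> 2 * M \<and> (\<forall>y. avg s0 y * eval theta y ^ M = eval \<sigma> y)"
    using dehom_sos[OF s0] unfolding avg_def by blast
  have "\<exists>N. \<forall>M\<ge>N. \<forall>i\<in>I. \<exists>\<sigma>\<in>sos. tdeg \<sigma> \<le> 2 * M \<and> (\<forall>y. avg (s (Orig i)) y * eval theta y ^ M = eval \<sigma> y)"
    unfolding avg_def by (rule finite_uniform_nat[OF fin(2) dehom_sos]) (simp add: s Ih_def)
  then obtain N1 where N1: "\<And>M i. M \<ge> N1 \<Longrightarrow> i \<in> I \<Longrightarrow>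
      \<exists>\<sigma>\<in>sos. tdeg \<sigma> \<le> 2 * M \<and> (\<forall>y. avg (s (Orig i)) y * eval theta y ^ M = eval \<sigma> y)" by blast
  define odd_avg where "odd_avg i y = (eval (q (Orig i)) (lift_sphere y) + (- 1) ^ tdeg (c i) * eval (q (Orig i)) (- lift_sphere y)) / 2" for i y
  have "\<exists>N. \<forall>M\<ge>N. \<forall>i\<in>E. \<exists>\<tau>. tdeg \<tau> + tdeg (c i) \<le> 2 * M \<and>
      (\<forall>y. odd_avg i y * eval theta y ^ M = eval \<tau> y * sqrt (eval theta y) ^ tdeg (c i))"
    unfolding odd_avg_def by (rule finite_uniform_nat[OF fin(1) dehom_parity])
  then obtain N2 where N2: "\<And>M i. M \<ge> N2 \<Longrightarrow> i \<in> E \<Longrightarrow> \<exists>\<tau>. tdeg \<tau> + tdeg (c i) \<le> 2 * M \<and>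
      (\<forall>y. odd_avg i y * eval theta y ^ M = eval \<tau> y * sqrt (eval theta y) ^ tdeg (c i))" by blast
  \<comment> \<open>The sum over all \<open>e i\<close> keeps every exponent
    \<open>k + \<delta> - e i\<close> at least \<open>N1\<close>.\<close>
  define k0 where "k0 = N0 + N1 + N2 + (\<Sum>i\<in>I. e i)"
  show ?thesis
  proof (intro exI allI impI)
    fix k assume k: "k0 \<le> k"
    have e_le: "e i + N1 \<le> k" if "i \<in> I" for i
      using member_le_sum[of i I e] that fin(2) k by (simp add: k0_def)
    obtain \<sigma>0 where \<sigma>0: "\<sigma>0 \<in> sos" "tdeg \<sigma>0 \<le> 2 * (k + \<delta>)" "\<And>y. avg s0 y * eval theta y ^ (k + \<delta>) = eval \<sigma>0 y"
      using N0[of "k + \<delta>"] k by (auto simp: k0_def)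
    have "\<forall>i\<in>I. \<exists>\<sigma>. \<sigma> \<in> sos \<and> tdeg \<sigma> \<le> 2 * (k + \<delta> - e i) \<and>
        (\<forall>y. avg (s (Orig i)) y * eval theta y ^ (k + \<delta> - e i) = eval \<sigma> y)"
    proof
      fix i assume i: "i \<in> I"
      then have "k + \<delta> - e i \<ge> N1" using e_le[OF i] by simp
      from N1[OF this i] show "\<exists>\<sigma>. \<sigma> \<in> sos \<and> tdeg \<sigma> \<le> 2 * (k + \<delta> - e i) \<and>
        (\<forall>y. avg (s (Orig i)) y * eval theta y ^ (k + \<delta> - e i) = eval \<sigma> y)" by blast
    qed
    from bchoice[OF this] obtain \<sigma> where \<sigma>: "\<And>i. i \<in> I \<Longrightarrow> \<sigma> i \<in> sos" "\<And>i. i \<in> I \<Longrightarrow> tdeg (\<sigma> i) \<le> 2 * (k + \<delta> - e i)"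
      "\<And>i y. i \<in> I \<Longrightarrow> avg (s (Orig i)) y * eval theta y ^ (k + \<delta> - e i) = eval (\<sigma> i) y" by blast
    have "\<forall>i\<in>E. \<exists>\<tau>. tdeg \<tau> + tdeg (c i) \<le> 2 * (k + \<delta>) \<and>
      (\<forall>y. odd_avg i y * eval theta y ^ (k + \<delta>) = eval \<tau> y * sqrt (eval theta y) ^ tdeg (c i))"
      using N2[of "k + \<delta>"] k by (auto simp: k0_def)
    from bchoice[OF this] obtain \<tau> where \<tau>: "\<And>i. i \<in> E \<Longrightarrow> tdeg (\<tau> i) + tdeg (c i) \<le> 2 * (k + \<delta>)"
      "\<And>i y. i \<in> E \<Longrightarrow> odd_avg i y * eval theta y ^ (k + \<delta>) = eval (\<tau> i) y * sqrt (eval theta y) ^ tdeg (c i)" by blast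
    have "eval (theta ^ k * (f - const (f_min f K))) y =
        eval ((\<Sum>i\<in>E. c i * \<tau> i) + (\<sigma>0 + (\<Sum>i\<in>I. c i * \<sigma> i))) y" for y
    proof -
      define z where "z = lift_sphere y"
      define r where "r = sqrt (eval theta y)"
      have r: "r > 0" "r\<^sup>2 = eval theta y" using theta_pos[of y] by (simp_all add: r_def)
      have z: "z \<in> sphere 0 1" "- z \<in> sphere 0 1" using lift_sphere_in_sphere[of y] by (simp_all add: z_def)
      have hom_z: "eval (homogenize p) z = eval p y / r ^ tdeg p" for p
        unfolding z_def r_def by (rule eval_homogenize_lift)
      have Fz: "eval F z * eval theta y ^ (k + \<delta>) = eval theta y ^ k * (eval f y - f_min f K)"
      proof -
        have "r ^ tdeg f = eval theta y ^ \<delta>" by (simp add: d power_mult r(2))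
        moreover have "z $ None = 1 / r" by (simp add: z_def r_def)
        ultimately have "eval F z = (eval f y - f_min f K) / eval theta y ^ \<delta>"
          by (simp add: eval_F hom_z power_divide diff_divide_distrib)
        then show ?thesis using theta_pos[of y] by (simp add: power_add)
      qed
      have G_I: "eval (even_constraint c I (Orig i)) z * eval theta y ^ (k + \<delta>) = eval (c i) y * eval theta y ^ (k + \<delta> - e i)"
        if i: "i \<in> I" for i
      proof -
        have "eval (even_constraint c I (Orig i)) z = eval (c i) y / r ^ (2 * e i)"
        proof (cases "even (tdeg (c i))")
          case True
          then have "2 * e i = tdeg (c i)" by (auto simp: e_def elim!: evenE)
          then show ?thesis using True by (auto simp: even_constraint_def hom_z image_iff)
        next
          case False
          then have "2 * e i = Suc (tdeg (c i))" by (auto simp: e_def elim!: oddE)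
          moreover have "z $ None = 1 / r" by (simp add: z_def r_def)
          ultimately show ?thesis using False i by (auto simp: even_constraint_def hom_z eval_simps image_iff)
        qed
        also have "r ^ (2 * e i) = eval theta y ^ e i" by (simp add: power_mult r(2))
        finally have *: "eval (even_constraint c I (Orig i)) z = eval (c i) y / eval theta y ^ e i" .
        have "eval theta y ^ (k + \<delta>) = eval theta y ^ (k + \<delta> - e i) * eval theta y ^ e i"
          using e_le[OF i] by (simp flip: power_add)
        then show ?thesis unfolding * using theta_pos[of y] by simp
      qed
      have sum_I: "(\<Sum>j\<in>Ih. eval (even_constraint c I j) x * h j) = (\<Sum>i\<in>I. eval (even_constraint c I (Orig i)) x * h (Orig i))"
        for x and h :: "'i hom_index \<Rightarrow> real"
        unfolding Ih_def by (subst sum.reindex) (auto simp: inj_on_def)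
      have sum_E: "(\<Sum>j\<in>Eh. eval (even_constraint c I j) x * h j) = (\<Sum>i\<in>E. eval (homogenize (c i)) x * h (Orig i))"
        if "x \<in> sphere 0 1" for x and h :: "'i hom_index \<Rightarrow> real"
      proof -
        have "(\<Sum>j\<in>Eh. eval (even_constraint c I j) x * h j) = (\<Sum>j\<in>Eh. eval (hom_poly c j) x * h j)"
          by (intro sum.cong refl) (simp add: even_constraint_E)
        \<comment> \<open>The term of the sphere equation drops out, since its value on the sphere
          is 0.\<close>
        also have "\<dots> = (\<Sum>j\<in>Orig ` E. eval (hom_poly c j) x * h j)"
          unfolding Eh_def using that fin(1) by (subst sum.insert) auto
        also have "\<dots> = (\<Sum>i\<in>E. eval (homogenize (c i)) x * h (Orig i))"
          by (subst sum.reindex) (auto simp: inj_on_def)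
        finally show ?thesis .
      qed
      \<comment> \<open>In the mean over the antipodal points the invariant inequality constraints
        factor out, while each equality passes its sign to its cofactor, which leads to
        \<open>odd_avg\<close>.\<close>
      have "eval F z = (eval F z + eval F (- z)) / 2" by (simp add: F_uminus)
      also have "\<dots> = avg s0 y + (\<Sum>i\<in>I. eval (even_constraint c I (Orig i)) z * avg (s (Orig i)) y) +
          (\<Sum>i\<in>E. eval (homogenize (c i)) z * odd_avg i y)"
      proof -
        have I_uminus: "(\<Sum>i\<in>I. eval (even_constraint c I (Orig i)) (- z) * eval (s (Orig i)) (- z)) =
            (\<Sum>i\<in>I. eval (even_constraint c I (Orig i)) z * eval (s (Orig i)) (- z))"
          by (intro sum.cong refl) (simp add: even_constraint_uminus Ih_def)
        have E_uminus: "(\<Sum>i\<in>E. eval (homogenize (c i)) (- z) * eval (q (Orig i)) (- z)) =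
            (\<Sum>i\<in>E. eval (homogenize (c i)) z * ((- 1) ^ tdeg (c i) * eval (q (Orig i)) (- z)))"
          by (intro sum.cong refl) (simp add: eval_homogenize_uminus)
        have 1: "(\<Sum>i\<in>I. eval (even_constraint c I (Orig i)) z * avg (s (Orig i)) y) =
            ((\<Sum>i\<in>I. eval (even_constraint c I (Orig i)) z * eval (s (Orig i)) z) +
             (\<Sum>i\<in>I. eval (even_constraint c I (Orig i)) z * eval (s (Orig i)) (- z))) / 2"
          unfolding avg_def z_def by (simp add: sum_divide_distrib distrib_left sum.distrib add_divide_distrib)
        have 2: "(\<Sum>i\<in>E. eval (homogenize (c i)) z * odd_avg i y) =
            ((\<Sum>i\<in>E. eval (homogenize (c i)) z * eval (q (Orig i)) z) +
             (\<Sum>i\<in>E. eval (homogenize (c i)) z * ((- 1) ^ tdeg (c i) * eval (q (Orig i)) (- z)))) / 2"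
          unfolding odd_avg_def z_def by (simp add: sum_divide_distrib distrib_left sum.distrib add_divide_distrib)
        have 3: "avg s0 y = (eval s0 z + eval s0 (- z)) / 2" by (simp add: avg_def z_def)
        show ?thesis
          unfolding F_eq[OF z(1)] F_eq[OF z(2)] sum_I sum_E[OF z(1)] sum_E[OF z(2)] I_uminus E_uminus 1 2 3
          by (simp add: add_divide_distrib)
      qed
      finally have F_avg: "eval F z = avg s0 y + (\<Sum>i\<in>I. eval (even_constraint c I (Orig i)) z * avg (s (Orig i)) y) +
          (\<Sum>i\<in>E. eval (homogenize (c i)) z * odd_avg i y)" .
      have "eval F z * eval theta y ^ (k + \<delta>) = avg s0 y * eval theta y ^ (k + \<delta>) +
          (\<Sum>i\<in>I. (eval (even_constraint c I (Orig i)) z * eval theta y ^ (k + \<delta>)) * avg (s (Orig i)) y) +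
          (\<Sum>i\<in>E. eval (homogenize (c i)) z * (odd_avg i y * eval theta y ^ (k + \<delta>)))"
        unfolding F_avg distrib_right sum_distrib_right by (simp only: mult_ac)
      also have "avg s0 y * eval theta y ^ (k + \<delta>) = eval \<sigma>0 y" by (rule \<sigma>0(3))
      also have "(\<Sum>i\<in>I. (eval (even_constraint c I (Orig i)) z * eval theta y ^ (k + \<delta>)) * avg (s (Orig i)) y) =
          (\<Sum>i\<in>I. eval (c i) y * eval (\<sigma> i) y)"
        by (intro sum.cong refl) (simp add: G_I mult_ac flip: \<sigma>(3))
      also have "(\<Sum>i\<in>E. eval (homogenize (c i)) z * (odd_avg i y * eval theta y ^ (k + \<delta>))) = (\<Sum>i\<in>E. eval (c i) y * eval (\<tau> i) y)"
        using r(1) by (intro sum.cong refl) (simp add: \<tau>(2) hom_z r_def[symmetric])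
      finally show ?thesis unfolding Fz by (simp add: eval_simps algebra_simps)
    qed
    then have eq: "theta ^ k * (f - const (f_min f K)) = (\<Sum>i\<in>E. c i * \<tau> i) + (\<sigma>0 + (\<Sum>i\<in>I. c i * \<sigma> i))"
      by (rule eval_inject)
    have 1: "(\<Sum>i\<in>E. c i * \<tau> i) \<in> ideal_trunc c E (int (2 * k + tdeg f))"
      unfolding ideal_trunc_def
    proof (intro CollectI exI conjI ballI)
      fix i assume "i \<in> E"
      from \<tau>(1)[OF this] show "\<tau> i \<in> polys_le (int (2 * k + tdeg f) - int (tdeg (c i)))"
        by (simp add: polys_le_def d)
    qed simp
    have 2: "\<sigma>0 + (\<Sum>i\<in>I. c i * \<sigma> i) \<in> qmodule_trunc c I (int (2 * k + tdeg f))"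
      unfolding qmodule_trunc_def
    proof (intro CollectI exI conjI ballI)
      show "\<sigma>0 \<in> sos \<inter> polys_le (int (2 * k + tdeg f))" using \<sigma>0(1,2) by (simp add: polys_le_def d)
      fix i assume i: "i \<in> I"
      have "2 * (k + \<delta> - e i) + tdeg (c i) \<le> 2 * k + tdeg f" using e[of i] e_le[OF i] by (simp add: d)
      then show "\<sigma> i \<in> sos \<inter> polys_le (int (2 * k + tdeg f) - int (tdeg (c i)))"
        using \<sigma>(1,2)[OF i] by (simp add: polys_le_def)
    qed simp
    show "theta ^ k * (f - const (f_min f K)) \<in>
      ideal_trunc c E (int (2 * k + tdeg f)) + qmodule_trunc c I (int (2 * k + tdeg f))"
      unfolding eq by (rule set_plus_intro[OF 1 2])
  qed
qed

end

section \<open>Finite convergence of the hierarchy\<close>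

lemma certificate_nonneg:
  assumes "p \<in> ideal_trunc c E k + qmodule_trunc c I k" "x \<in> semialg_set c E I"
  shows "eval p x \<ge> 0"
proof -
  obtain a b where p: "p = a + b" "a \<in> ideal_trunc c E k" "b \<in> qmodule_trunc c I k"
    using assms(1) by (rule set_plus_elim)
  obtain q where a: "a = (\<Sum>j\<in>E. c j * q j)" using p(2) unfolding ideal_trunc_def by blast
  obtain s t where b: "b = s + (\<Sum>j\<in>I. c j * t j)" "s \<in> sos" "\<forall>j\<in>I. t j \<in> sos"
    using p(3) unfolding qmodule_trunc_def by blast
  have x: "\<And>j. j \<in> E \<Longrightarrow> eval (c j) x = 0" "\<And>j. j \<in> I \<Longrightarrow> eval (c j) x \<ge> 0"
    using assms(2) by (auto simp: semialg_set_def feasible_set_def)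
  have "eval a x = 0" by (simp add: a eval_simps x)
  moreover have t: "eval (t j) x \<ge> 0" if "j \<in> I" for j using b(3) that sos_eval_nonneg by blast
  have "eval b x \<ge> 0"
    unfolding b(1) eval_add eval_sum eval_mult
    by (intro add_nonneg_nonneg sum_nonneg mult_nonneg_nonneg t x(2) sos_eval_nonneg[OF b(2)])
  ultimately show ?thesis by (simp add: p(1) eval_add)
qed

lemma f_den_eqI:
  assumes ne: "semialg_set c E I \<noteq> {}"
    and cert: "theta ^ k * (f - const (f_min f (semialg_set c E I)))
      \<in> ideal_trunc c E (int (2 * k + tdeg f)) + qmodule_trunc c I (int (2 * k + tdeg f))"
  shows "f_den f c E I k = ereal (f_min f (semialg_set c E I))"
proof (rule antisym)
  show "f_den f c E I k \<le> ereal (f_min f (semialg_set c E I))"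
    unfolding f_den_def
  proof (rule Sup_least, clarsimp)
    fix \<gamma>
    assume \<gamma>: "theta ^ k * (f - const \<gamma>) \<in>
      ideal_trunc c E (2 * int k + int (tdeg f)) + qmodule_trunc c I (2 * int k + int (tdeg f))"
    have "\<gamma> \<le> eval f x" if "x \<in> semialg_set c E I" for x
    proof -
      have "0 \<le> eval theta x ^ k * (eval f x - \<gamma>)"
        using certificate_nonneg[OF \<gamma> that] by (simp add: eval_simps)
      moreover have "eval theta x ^ k > 0" using theta_pos[of x] by simp
      ultimately show ?thesis by (simp add: zero_le_mult_iff not_le)
    qed
    then show "\<gamma> \<le> f_min f (semialg_set c E I)" unfolding f_min_def by (intro cINF_greatest ne)
  qed
  show "ereal (f_min f (semialg_set c E I)) \<le> f_den f c E I k"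
    unfolding f_den_def by (rule Sup_upper) (use cert in blast)
qed

lemma zero_in_truncations: "0 \<in> ideal_trunc c E k + qmodule_trunc c I k"
proof -
  have "0 \<in> ideal_trunc c E k"
    unfolding ideal_trunc_def by (intro CollectI exI[of _ "\<lambda>_. 0"]) (simp add: polys_le_def)
  moreover have "0 \<in> qmodule_trunc c I k"
    unfolding qmodule_trunc_def by (intro CollectI exI[of _ 0] exI[of _ "\<lambda>_. 0"]) (simp add: polys_le_def)
  ultimately have "0 + 0 \<in> ideal_trunc c E k + qmodule_trunc c I k" by (rule set_plus_intro)
  then show ?thesis by simp
qed

lemma tdeg_0_imp_const:
  fixes f :: "'n::finite rpoly"
  assumes "tdeg f = 0"
  shows "f = const (Poly_Mapping.lookup f 0)"
proof (rule poly_mapping_eqI)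
  fix m
  show "Poly_Mapping.lookup f m = Poly_Mapping.lookup (const (Poly_Mapping.lookup f 0)) m"
  proof (cases "m = 0")
    case False
    have "Poly_Mapping.lookup f m = 0"
    proof (rule ccontr)
      assume "Poly_Mapping.lookup f m \<noteq> 0"
      then have "mdeg m = 0" using mdeg_le_tdeg[of m f] assms by (simp add: in_keys_iff)
      then have "Poly_Mapping.lookup m i = 0" for i by (simp add: mdeg_def)
      then have "m = 0" by (intro poly_mapping_eqI) simp
      with False show False ..
    qed
    with False show ?thesis by (simp add: const_def lookup_single when_def)
  qed (simp add: const_def)
qed

text \<open>Constant \<open>f\<close> is treated apart: \<open>f - const (f_min f K)\<close> is zero
  and certified by 0, whereas the homogenized argument assumes positive degree.\<close>

lemma f_den_degree_0:
  assumes ne: "semialg_set c E I \<noteq> {}" and deg: "tdeg f = 0"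
  shows "f_den f c E I k = ereal (f_min f (semialg_set c E I))"
proof (rule f_den_eqI[OF ne])
  define a where "a = Poly_Mapping.lookup f 0"
  have f: "f = const a" unfolding a_def by (rule tdeg_0_imp_const[OF deg])
  have "f_min f (semialg_set c E I) = a" using ne by (simp add: f_min_def f)
  then show "theta ^ k * (f - const (f_min f (semialg_set c E I))) \<in>
      ideal_trunc c E (int (2 * k + tdeg f)) + qmodule_trunc c I (int (2 * k + tdeg f))"
    by (simp add: f zero_in_truncations)
qed

lemma lookup_const_mult: "Poly_Mapping.lookup (const a * p) m = a * Poly_Mapping.lookup p m"
proof -
  have "const a * p = (\<Sum>k\<in>Poly_Mapping.keys p. Poly_Mapping.single k (a * Poly_Mapping.lookup p k))"
    by (subst rpoly_sum_single[of p]) (simp add: sum_distrib_left const_def mult_single)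
  then show ?thesis
    by (auto simp: lookup_sum lookup_single when_def sum.delta in_keys_iff)
qed

text \<open>Since \<open>\<theta>^(d/2)\<close> has degree \<open>d\<close>, an interior point of the cone dominates a small multiple of it, and \<open>\<theta>\<close>
  homogenizes to the squared norm.\<close>

lemma interior_nonneg_polys_lower_bound:
  fixes f :: "'n::finite rpoly"
  assumes "f - const a \<in> poly_topology (int d) interior_of nonneg_polys (int d) K" and d: "d = 2 * \<delta>"
  shows "\<exists>e>0. \<forall>y\<in>K. a + e * eval theta y ^ \<delta> \<le> eval f y"
proof -
  obtain e where e: "e > 0" and f: "f - const a \<in> polys_le (int d)" and
    nn: "\<And>q. q \<in> polys_le (int d) \<Longrightarrow> (\<forall>m. \<bar>Poly_Mapping.lookup q m - Poly_Mapping.lookup (f - const a) m\<bar> < e)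
      \<Longrightarrow> q \<in> nonneg_polys (int d) K"
    using assms(1) unfolding interior_nonneg_polys_iff by blast
  define t :: "'n rpoly" where "t = theta ^ \<delta>"
  \<comment> \<open>Strictly above the absolute value of every coefficient of \<open>t\<close>, so
    that subtracting \<open>e / B\<close> times \<open>t\<close> moves each coefficient by less than
    \<open>e\<close>.\<close>
  define B where "B = 1 + (\<Sum>m\<in>Poly_Mapping.keys t. \<bar>Poly_Mapping.lookup t m\<bar>)"
  have B: "\<bar>Poly_Mapping.lookup t m\<bar> < B" "B > 0" for m
  proof -
    have nonneg: "(\<Sum>m\<in>Poly_Mapping.keys t. \<bar>Poly_Mapping.lookup t m\<bar>) \<ge> 0" by (simp add: sum_nonneg)
    then show "B > 0" unfolding B_def by linarith
    show "\<bar>Poly_Mapping.lookup t m\<bar> < B"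
    proof (cases "m \<in> Poly_Mapping.keys t")
      case True
      then have "\<bar>Poly_Mapping.lookup t m\<bar> \<le> (\<Sum>m\<in>Poly_Mapping.keys t. \<bar>Poly_Mapping.lookup t m\<bar>)"
        by (intro member_le_sum) auto
      then show ?thesis by (simp add: B_def)
    next
      case False
      then have "\<bar>Poly_Mapping.lookup t m\<bar> = 0" by (simp add: in_keys_iff)
      then show ?thesis using nonneg unfolding B_def by linarith
    qed
  qed
  define q where "q = (f - const a) - const (e / B) * t"
  have t_deg: "tdeg t \<le> d" using tdeg_theta_power_le[of \<delta>] by (simp add: t_def d)
  have "tdeg (- (const (e / B) * t)) \<le> d"
    using tdeg_mult_le[of "const (e / B)" 0 t d] t_deg by (simp add: tdeg_uminus)
  then have "q \<in> polys_le (int d)"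
    using f tdeg_add_le[of "f - const a" d "- (const (e / B) * t)"] by (simp add: polys_le_nat q_def)
  moreover have "\<bar>Poly_Mapping.lookup q m - Poly_Mapping.lookup (f - const a) m\<bar> < e" for m
  proof -
    have "\<bar>Poly_Mapping.lookup q m - Poly_Mapping.lookup (f - const a) m\<bar> = e / B * \<bar>Poly_Mapping.lookup t m\<bar>"
      using e B(2) by (simp add: q_def lookup_minus lookup_const_mult abs_mult)
    also have "\<dots> < e / B * B" using e B by (intro mult_strict_left_mono) auto
    finally show ?thesis using B(2) by simp
  qed
  ultimately have "q \<in> nonneg_polys (int d) K" by (intro nn) auto
  then have "\<forall>y\<in>K. a + e / B * eval theta y ^ \<delta> \<le> eval f y"
    by (auto simp: nonneg_polys_def q_def t_def eval_simps algebra_simps)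
  then show ?thesis using e B(2) by (intro exI[of _ "e / B"]) auto
qed

lemma (in homogenized_problem) F_in_qm_imp_f_den:
  assumes "F \<in> qm" "K \<noteq> {}"
  shows "\<forall>\<^sub>F k in sequentially. f_den f c E I k = ereal (f_min f K)"
proof -
  obtain k0 where "\<forall>k\<ge>k0. theta ^ k * (f - const (f_min f K)) \<in>
    ideal_trunc c E (int (2 * k + tdeg f)) + qmodule_trunc c I (int (2 * k + tdeg f))"
    using F_in_qm_imp_certificate[OF assms(1)] by blast
  then show ?thesis
    unfolding eventually_sequentially using f_den_eqI[OF assms(2)] by blast
qed

section \<open>Affine points of the homogenized feasible set and the two cases\<close>

lemma norm_square_eq_1_iff: "(norm x)\<^sup>2 = 1 \<longleftrightarrow> norm x = 1"
  using norm_ge_zero[of x] by (auto simp: power2_eq_1_iff simp del: norm_ge_zero)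

lemma hom_set_affine_point:
  assumes "u \<in> hom_set c E I" "u $ None > 0"
  shows "(\<chi> i. u $ Some i / u $ None) \<in> semialg_set c E I"
proof -
  have "\<not> (u $ None) ^ k \<le> 0" for k using assms(2) by (simp add: not_le)
  then show ?thesis
    using assms by (auto simp: hom_set_def semialg_set_def feasible_set_def eval_homogenize zero_le_mult_iff)
qed

lemma eval_theta_affine_point:
  assumes "norm u = 1" "u $ None \<noteq> 0"
  shows "eval theta (\<chi> i. u $ Some i / u $ None) = 1 / (u $ None)\<^sup>2"
proof -
  have "(u $ None)\<^sup>2 + (\<Sum>i\<in>UNIV. (u $ Some i)\<^sup>2) = 1"
    using assms(1) unfolding norm_eq_1_iff_sum_squares sum_UNIV_option .
  then show ?thesis
    using assms(2) by (simp add: theta_def eval_simps power_divide field_simps flip: sum_divide_distrib)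
qed

text \<open>After multiplication by the power of x0 the lower bound for \<open>f - a\<close> becomes
  the constant \<open>e\<close> on the sphere, so it passes to closures. Closedness at infinity puts
  the feasible points with x0 = 0 into such a closure, which makes the leading form positive
  there.\<close>

theorem finite_convergence_closed_at_infinity:
  fixes f :: "'n::finite rpoly" and c :: "'i \<Rightarrow> 'n rpoly"
  assumes fin: "finite E" "finite I" and disj: "E \<inter> I = {}" and ne: "semialg_set c E I \<noteq> {}"
    and closed: "closed_at_infinity c E I" and even_f: "even (tdeg f)" and even_c: "\<forall>j\<in>I. even (tdeg (c j))"
    and interior: "f - const a \<in> poly_topology (int (tdeg f)) interior_of nonneg_polys (int (tdeg f)) (semialg_set c E I)"
    and opt: "\<And>u. global_minimizer (hom_objective f (f_min f (semialg_set c E I))) (hom_constraint c)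
        (insert Sphere (Orig ` E)) (Orig ` I) u \<Longrightarrow>
      LICQC (hom_constraint c) (insert Sphere (Orig ` E)) (Orig ` I) u \<and>
      SCC (hom_objective f (f_min f (semialg_set c E I))) (hom_constraint c) (insert Sphere (Orig ` E)) (Orig ` I) u \<and>
      SOSC (hom_objective f (f_min f (semialg_set c E I))) (hom_constraint c) (insert Sphere (Orig ` E)) (Orig ` I) u"
  shows "\<forall>\<^sub>F k in sequentially. f_den f c E I k = ereal (f_min f (semialg_set c E I))"
proof (cases "tdeg f = 0")
  case True
  then show ?thesis using f_den_degree_0[OF ne] by simp
next
  case False
  define \<delta> where "\<delta> = tdeg f div 2"
  have \<delta>: "tdeg f = 2 * \<delta>" using even_f by (simp add: \<delta>_def)
  obtain e where e: "e > 0" and lower: "\<And>y. y \<in> semialg_set c E I \<Longrightarrow> a + e * eval theta y ^ \<delta> \<le> eval f y"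
    using interior_nonneg_polys_lower_bound[OF interior \<delta>] by blast
  have "bdd_below (eval f ` semialg_set c E I)"
  proof (rule bdd_belowI2)
    fix y assume "y \<in> semialg_set c E I"
    moreover have "e * eval theta y ^ \<delta> \<ge> 0" using e theta_pos[of y] by simp
    ultimately show "a \<le> eval f y" using lower by fastforce
  qed
  then interpret homogenized_problem f c E I
    by unfold_locales (use fin disj even_f False in auto)
  have constraint: "even_constraint c I = hom_poly c"
    using even_c by (auto simp: even_constraint_def fun_eq_iff)
  have feas_eq: "feas = feasible_set (hom_constraint c) (insert Sphere (Orig ` E)) (Orig ` I)"
    unfolding feas_def unfolding constraint
    by (auto simp: feasible_set_def hom_constraint_eq Eh_def Ih_def norm_square_eq_1_iff)
  have hom_f: "e \<le> eval (homogenize f) u - a * (u $ None) ^ tdeg f" if u: "u \<in> hom_set c E I" "u $ None > 0" for u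
  proof -
    let ?y = "\<chi> i. u $ Some i / u $ None"
    have "(norm u)\<^sup>2 - 1 = 0" using u(1) by (simp add: hom_set_def feasible_set_def)
    then have norm: "norm u = 1" by (simp add: norm_square_eq_1_iff)
    have "e = (u $ None) ^ tdeg f * (e * eval theta ?y ^ \<delta>)"
      using u(2) eval_theta_affine_point[OF norm] by (simp add: \<delta> power_mult power_divide)
    also have "\<dots> \<le> (u $ None) ^ tdeg f * (eval f ?y - a)"
      using lower[OF hom_set_affine_point[OF u]] u(2) by (intro mult_left_mono) auto
    also have "\<dots> = eval (homogenize f) u - a * (u $ None) ^ tdeg f"
      using u(2) by (simp add: eval_homogenize algebra_simps)
    finally show ?thesis .
  qed
  have "closed {u. e \<le> eval (homogenize f) u - a * (u $ None) ^ tdeg f}"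
    by (intro closed_Collect_le continuous_intros)
  then have closure: "closure (hom_set c E I \<inter> {u. u $ None > 0}) \<subseteq>
      {u. e \<le> eval (homogenize f) u - a * (u $ None) ^ tdeg f}"
    using hom_f by (intro closure_minimal) auto
  have infinity: "eval (homogenize f) u > 0" if u: "u \<in> feas" "u $ None = 0" for u
  proof -
    have "u \<in> hom_set c E I" using u by (auto simp: feas_eq hom_set_def feasible_set_def)
    then have "u \<in> closure (hom_set c E I \<inter> {u. u $ None > 0})" using closed unfolding closed_at_infinity_def by blast
    then have "e \<le> eval (homogenize f) u - a * (u $ None) ^ tdeg f" using closure by blast
    then show ?thesis using e u(2) False by (simp add: power_0_left)
  qed
  have nonneg: "eval F w \<ge> 0" if "w \<in> feas" for w
    by (rule F_nonneg[OF that]) (use infinity[OF that] in blast)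
  have "F \<in> qm"
  proof (rule F_in_qm[OF infinity])
    fix u assume u: "u \<in> feas" "u $ None > 0" "eval F u = 0"
    have obj: "hom_objective f (f_min f K) = eval F" by (simp add: F_def hom_objective_eq)
    have min: "global_minimizer (eval F) (hom_constraint c) (insert Sphere (Orig ` E)) (Orig ` I) u"
      unfolding global_minimizer_def feas_eq[symmetric] using u nonneg by simp
    have "sphere_problem.nondegenerate (even_constraint c I) Eh Ih F u"
    proof (rule optimality_conditions_imp_nondegenerate)
      show "Eh \<inter> Ih = {}" using disj by (auto simp: Eh_def Ih_def)
    qed (use opt[unfolded obj, OF min] min u(3) in \<open>simp_all add: constraint hom_constraint_eq Eh_def Ih_def\<close>)
    then show "nondegenerate F u" .
  qed
  from F_in_qm_imp_f_den[OF this ne] show ?thesis .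
qed

text \<open>A form of odd degree takes opposite values at opposite points, here at the all-ones
  vector placed at infinity and its negative.\<close>

lemma positive_definite_leading_form_even:
  fixes f :: "'n::finite rpoly"
  assumes "positive_definite (leading_form f)"
  shows "even (tdeg f)"
proof (rule ccontr)
  assume odd: "odd (tdeg f)"
  define v :: "real ^ 'n option" where "v = (\<chi> j. case j of None \<Rightarrow> 0 | Some i \<Rightarrow> 1)"
  have pos: "eval (homogenize f) u > 0" if "u = v \<or> u = - v" for u
  proof -
    have "u $ None = 0" using that by (auto simp: v_def)
    moreover have "(\<chi> i. u $ Some i) \<noteq> 0" using that by (auto simp: v_def vec_eq_iff)
    ultimately show ?thesis using assms by (simp add: eval_homogenize_infinity positive_definite_def)
  qed
  from pos[of v] pos[of "- v"] odd show False by (simp add: eval_homogenize_uminus)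
qed

theorem finite_convergence_positive_definite:
  fixes f :: "'n::finite rpoly" and c :: "'i \<Rightarrow> 'n rpoly"
  assumes fin: "finite E" "finite I" and disj: "E \<inter> I = {}" and ne: "semialg_set c E I \<noteq> {}"
    and pd: "positive_definite (leading_form f)"
    and opt: "\<And>u. global_minimizer (hom_objective f (f_min f (semialg_set c E I))) (hom_constraint c)
        (insert Sphere (Orig ` E)) (insert X0 (Orig ` I)) u \<Longrightarrow>
      LICQC (hom_constraint c) (insert Sphere (Orig ` E)) (insert X0 (Orig ` I)) u \<and>
      SCC (hom_objective f (f_min f (semialg_set c E I))) (hom_constraint c) (insert Sphere (Orig ` E)) (insert X0 (Orig ` I)) u \<and>
      SOSC (hom_objective f (f_min f (semialg_set c E I))) (hom_constraint c) (insert Sphere (Orig ` E)) (insert X0 (Orig ` I)) u"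
  shows "\<forall>\<^sub>F k in sequentially. f_den f c E I k = ereal (f_min f (semialg_set c E I))"
proof (cases "tdeg f = 0")
  case True
  then show ?thesis using f_den_degree_0[OF ne] by simp
next
  case False
  have even_f: "even (tdeg f)" by (rule positive_definite_leading_form_even[OF pd])
  have infinity: "eval (homogenize f) u > 0" if "norm u = 1" "u $ None = 0" for u
  proof -
    have "(\<chi> i. u $ Some i) \<noteq> 0"
    proof
      assume "(\<chi> i. u $ Some i) = 0"
      then have "u $ j = 0" for j using that(2) by (cases j) (auto simp: vec_eq_iff)
      then have "u = 0" by (simp add: vec_eq_iff)
      then show False using that(1) by simp
    qed
    then show ?thesis using pd that(2) by (simp add: eval_homogenize_infinity positive_definite_def)
  qed
  \<comment> \<open>Positivity at x0 = 0 extends to the whole sphere at the cost of a penalty in x0.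
    At a lifted point this says that \<open>eval f y + N\<close> is positive, so \<open>f\<close> is
    bounded below.\<close>
  have "\<exists>N>0. \<forall>u\<in>sphere 0 1. eval (homogenize f) u + N * (u $ None) ^ tdeg f > 0"
  proof (rule compact_penalty)
    show "(u $ None) ^ tdeg f \<ge> 0" for u :: "real ^ 'n option" using even_f by (simp add: zero_le_power_eq)
  qed (use infinity in \<open>auto intro!: continuous_intros\<close>)
  then obtain N where N: "\<And>u. u \<in> sphere 0 1 \<Longrightarrow> eval (homogenize f) u + N * (u $ None) ^ tdeg f > 0" by blast
  have "bdd_below (eval f ` semialg_set c E I)"
  proof (rule bdd_belowI2)
    fix y :: "real ^ 'n"
    let ?r = "sqrt (eval theta y) ^ tdeg f"
    have r: "?r > 0" using theta_pos[of y] by simp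
    have "0 < (eval f y + N) / ?r"
      using N[OF lift_sphere_in_sphere[of y]] by (simp add: eval_homogenize_lift power_divide add_divide_distrib)
    then have "0 * ?r < eval f y + N" by (simp only: pos_less_divide_eq[OF r])
    then show "- N \<le> eval f y" by simp
  qed
  then interpret homogenized_problem f c E I
    by unfold_locales (use fin disj even_f False in auto)
  interpret X0: sphere_problem "hom_poly c" Eh "insert X0 Ih"
    by unfold_locales (rule finite_E, simp add: finite_I)
  have feas_X0: "X0.feas = feasible_set (hom_constraint c) (insert Sphere (Orig ` E)) (insert X0 (Orig ` I))"
    unfolding X0.feas_def
    by (auto simp: feasible_set_def hom_constraint_eq Eh_def Ih_def norm_square_eq_1_iff)
  have "F \<in> qm"
  proof (rule F_in_qm)
    show "eval (homogenize f) u > 0" if "u \<in> feas" "u $ None = 0" for u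
      using infinity[of u] that feas_subset by auto
  next
    fix u assume u: "u \<in> feas" "u $ None > 0" "eval F u = 0"
    have F_nonneg: "eval F w \<ge> 0" if w: "w \<in> X0.feas" for w
    proof (cases "w $ None = 0")
      case True
      have "norm w = 1" using w by (simp add: X0.feas_def)
      from infinity[OF this True] show ?thesis using True False by (simp add: eval_F power_0_left)
    next
      case nz: False
      have "w $ None \<ge> 0" using w by (simp add: feas_X0 feasible_set_def)
      with nz have "w $ None > 0" by simp
      then show ?thesis
        using w by (intro F_nonneg_affine) (auto simp: feas_X0 feasible_set_def)
    qed
    have u_X0: "u \<in> X0.feas"
      using u(1,2) feas_affine[OF u(1,2)] unfolding feas_X0 by (auto simp: feas_def feasible_set_def)
    have obj: "hom_objective f (f_min f K) = eval F" by (simp add: F_def hom_objective_eq)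
    have min: "global_minimizer (eval F) (hom_constraint c) (insert Sphere (Orig ` E)) (insert X0 (Orig ` I)) u"
      unfolding global_minimizer_def feas_X0[symmetric] using u(3) u_X0 F_nonneg by simp
    have disj': "Eh \<inter> insert X0 Ih = {}" "Eh \<inter> Ih = {}" using disj by (auto simp: Eh_def Ih_def)
    have nd_X0: "X0.nondegenerate F u"
      by (rule X0.optimality_conditions_imp_nondegenerate[OF disj'(1) u(3)])
        (use opt[unfolded obj, OF min] min in \<open>simp_all add: hom_constraint_eq Eh_def Ih_def\<close>)
    interpret H: sphere_problem "hom_poly c" Eh Ih
      by unfold_locales (rule finite_E finite_I)+
    \<comment> \<open>As x0 is positive at \<open>u\<close>, the constraint \<open>X0\<close> is
      inactive, and both problems have the same augmented Lagrangian at \<open>u\<close>.\<close>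
    have "X0.active u = H.active u" using u(2) by (auto simp: X0.active_def H.active_def)
    then have "H.nondegenerate F u"
      using nd_X0 by (simp add: X0.nondegenerate_def H.nondegenerate_def X0.aug_lagrangian_def H.aug_lagrangian_def)
    from H.nondegenerate_mult[OF this disj'(2), of "var None" "Orig ` {i \<in> I. odd (tdeg (c i))}"]
    show "nondegenerate F u"
      using u(2) unfolding even_constraint_def[abs_def] by (auto simp: Ih_def)
  qed
  from F_in_qm_imp_f_den[OF this ne] show ?thesis .
qed

theorem theorem4p7:
  fixes f :: "'n::finite rpoly" and c :: "'i \<Rightarrow> 'n rpoly" and E I :: "'i set"
    and K :: "(real ^ 'n) set" and d :: nat
  assumes "finite E" and "finite I" and "E \<inter> I = {}"
    and "tdeg f = d"
    and "K = semialg_set c E I" and "K \<noteq> {}"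
  shows
    "(closed_at_infinity c E I \<longrightarrow>
      even d \<longrightarrow> (\<forall>j\<in>I. even (tdeg (c j))) \<longrightarrow>
      (\<exists>a. f - const a \<in> poly_topology (int d) interior_of nonneg_polys (int d) K) \<longrightarrow>
      (\<forall>u. global_minimizer (hom_objective f (f_min f K)) (hom_constraint c)
              (insert Sphere (Orig ` E)) (Orig ` I) u \<longrightarrow>
           LICQC (hom_constraint c) (insert Sphere (Orig ` E)) (Orig ` I) u \<and>
           SCC (hom_objective f (f_min f K)) (hom_constraint c)
             (insert Sphere (Orig ` E)) (Orig ` I) u \<and>
           SOSC (hom_objective f (f_min f K)) (hom_constraint c)
             (insert Sphere (Orig ` E)) (Orig ` I) u) \<longrightarrow>
      (\<forall>\<^sub>F k in sequentially. f_den f c E I k = ereal (f_min f K)))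
     \<and>
     (positive_definite (leading_form f) \<longrightarrow>
      (\<forall>u. global_minimizer (hom_objective f (f_min f K)) (hom_constraint c)
              (insert Sphere (Orig ` E)) (insert X0 (Orig ` I)) u \<longrightarrow>
           LICQC (hom_constraint c) (insert Sphere (Orig ` E)) (insert X0 (Orig ` I)) u \<and>
           SCC (hom_objective f (f_min f K)) (hom_constraint c)
             (insert Sphere (Orig ` E)) (insert X0 (Orig ` I)) u \<and>
           SOSC (hom_objective f (f_min f K)) (hom_constraint c)
             (insert Sphere (Orig ` E)) (insert X0 (Orig ` I)) u) \<longrightarrow>
      (\<forall>\<^sub>F k in sequentially. f_den f c E I k = ereal (f_min f K)))"
proof (intro conjI impI)
  note [simp] = \<open>tdeg f = d\<close>[symmetric] \<open>K = semialg_set c E I\<close>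
  have ne: "semialg_set c E I \<noteq> {}" using assms by simp
  {
    assume *: "closed_at_infinity c E I" "even d" "\<forall>j\<in>I. even (tdeg (c j))"
      and "\<exists>a. f - const a \<in> poly_topology (int d) interior_of nonneg_polys (int d) K"
      and opt: "\<forall>u. global_minimizer (hom_objective f (f_min f K)) (hom_constraint c)
              (insert Sphere (Orig ` E)) (Orig ` I) u \<longrightarrow>
           LICQC (hom_constraint c) (insert Sphere (Orig ` E)) (Orig ` I) u \<and>
           SCC (hom_objective f (f_min f K)) (hom_constraint c)
             (insert Sphere (Orig ` E)) (Orig ` I) u \<and>
           SOSC (hom_objective f (f_min f K)) (hom_constraint c)
             (insert Sphere (Orig ` E)) (Orig ` I) u"
    then obtain a where "f - const a \<in> poly_topology (int d) interior_of nonneg_polys (int d) K" by blast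
    from finite_convergence_closed_at_infinity[OF assms(1-3) ne *(1) _ *(3), of f a] this *(2) opt
    show "\<forall>\<^sub>F k in sequentially. f_den f c E I k = ereal (f_min f K)" by simp
  next
    assume pd: "positive_definite (leading_form f)"
      and opt: "\<forall>u. global_minimizer (hom_objective f (f_min f K)) (hom_constraint c)
              (insert Sphere (Orig ` E)) (insert X0 (Orig ` I)) u \<longrightarrow>
           LICQC (hom_constraint c) (insert Sphere (Orig ` E)) (insert X0 (Orig ` I)) u \<and>
           SCC (hom_objective f (f_min f K)) (hom_constraint c)
             (insert Sphere (Orig ` E)) (insert X0 (Orig ` I)) u \<and>
           SOSC (hom_objective f (f_min f K)) (hom_constraint c)
             (insert Sphere (Orig ` E)) (insert X0 (Orig ` I)) u"
    from finite_convergence_positive_definite[OF assms(1-3) ne pd] opt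
    show "\<forall>\<^sub>F k in sequentially. f_den f c E I k = ereal (f_min f K)" by simp
  }
qed

end
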